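(* Let $d\ge 1$, $T=(T_1,\dots,T_d)$ with $T_i>0$, and $[0,T]=\prod_{i=1}^d[0,T_i]$. Let $\{\theta_n\}_{n\in\mathbb{N}}$ be a sequence of real-valued, jointly measurable stochastic processes $\theta_n=\{\theta_n(u):u\in[0,T]\}$ such that the finite dimensional distributions of the processes $\zeta_n(t)=\int_{[0,t]}\theta_n(u)\,du$, $t\in[0,T]$, converge, as $n\to\infty$, to those of a Brownian sheet on $[0,T]$. Let $1\le q<\infty$; assume that $\int_{[0,T]}|g(u)\theta_n(u)|\,du<\infty$ almost surely for every $g\in L^{2q}([0,T])$ and every $n$. Suppose that there are $m>2q$ and a positive constant $C$ independent of $n$ such that $$\mathbb{E}\left[\left|\int_{[0,T]}g_n(u)\theta_n(u)\,du\right|^m\right]\le C\left(\int_{[0,T]}|g_n(u)|^{2q}\,du\right)^{\frac{m}{2q}}$$ for every $n\in\mathbb{N}$ and any sequence of functions $\{g_n\}_{n\in\mathbb{N}}\subset L^{2q}([0,T])$. Then, whenever $\{f_n\}_{n\in\mathbb{N}}\subset L^{2q}([0,T])$ converges in $L^{2q}([0,T])$ to $f\in L^{2q}([0,T])$, the processes $$X_n=\left\{X_n(t)=\int_{[0,t]}f_n(u)\theta_n(u)\,du:\ t\in[0,T]\right\}$$ converge in law in $\mathcal{C}([0,T])$, as $n\to\infty$, to the process $$X=\left\{X(t)=\int_{[0,t]}f(u)\,W(du):\ t\in[0,T]\right\},$$ the Wiener integral of $f$ with respect to the Brownian sheet.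
   Context: For $t=(t_1,\dots,t_d)\in[0,T]$, $[0,t]=\prod_{i=1}^d[0,t_i]$. $\mathcal{C}([0,T])$ is the space of real continuous functions on $[0,T]$ with the uniform norm. $L^{p}([0,T])$ is taken with respect to Lebesgue measure. An isonormal Gaussian process over $H=L^2([0,T])$ is a centered Gaussian process $W=\{W(h):h\in H\}$ on a complete probability space with $\mathbb{E}[W(h)W(g)]=\langle h,g\rangle_H$ for all $h,g\in H$. The Brownian sheet is the process $t\mapsto W(\mathbb{I}_{(0,t]})$, $t\in[0,T]$ (a centered Gaussian process with covariance $\prod_{i=1}^d (s_i\wedge t_i)$), and, for $f\in L^2([0,T])$, the Wiener integral is $\int_{[0,t]}f(u)\,W(du):=W(f\,\mathbb{I}_{[0,t]})$. Both the Brownian sheet and the Wiener integral process $t\mapsto\int_{[0,t]}f(u)W(du)$ are taken in their continuous versions. *)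

theory Defs
  imports "HOL-Probability.Probability"
begin

section \<open>The function spaces\<close>

text \<open>\<open>L\<^sup>p(K)\<close> as a set of functions rather than of classes modulo null sets. Only the values
  on \<open>K\<close> matter.\<close>

definition Lspace :: "real \<Rightarrow> (real ^ 'n) set \<Rightarrow> (real ^ 'n \<Rightarrow> real) set"
  where "Lspace p K = {g. g \<in> borel_measurable (lebesgue_on K) \<and>
                          integrable (lebesgue_on K) (\<lambda>u. \<bar>g u\<bar> powr p)}"

definition Lnorm :: "real \<Rightarrow> (real ^ 'n) set \<Rightarrow> (real ^ 'n \<Rightarrow> real) \<Rightarrow> real"
  where "Lnorm p K g = (LINT u|lebesgue_on K. \<bar>g u\<bar> powr p) powr (1 / p)"

text \<open>The space \<open>\<C>(K)\<close> with the uniform metric. Its points are the continuous functions on \<open>K\<close>,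
  made \<open>undefined\<close> outside \<open>K\<close>; on a compact \<open>K\<close> the boundedness built into
  \<^const>\<open>cfunspace\<close> is automatic.\<close>

definition Cspace :: "(real ^ 'n) set \<Rightarrow> (real ^ 'n \<Rightarrow> real) metric"
  where "Cspace K = cfunspace (top_of_set K) euclidean_metric"

section \<open>Convergence in law\<close>

definition borel_sigma :: "'s topology \<Rightarrow> 's measure"
  where "borel_sigma S = sigma (topspace S) {U. openin S U}"

text \<open>The random elements may live on different probability spaces.\<close>

definition converges_in_law ::
  "'s topology \<Rightarrow> (nat \<Rightarrow> 'a measure) \<Rightarrow> (nat \<Rightarrow> 'a \<Rightarrow> 's) \<Rightarrow> 'b measure \<Rightarrow> ('b \<Rightarrow> 's) \<Rightarrow> bool"
  where "converges_in_law S M X N Y \<longleftrightarrow>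
    (\<forall>n. X n \<in> measurable (M n) (borel_sigma S)) \<and> Y \<in> measurable N (borel_sigma S) \<and>
    (\<forall>F. continuous_map S euclideanreal F \<and> bounded (F ` topspace S) \<longrightarrow>
      (\<lambda>n. LINT \<omega>|M n. F (X n \<omega>)) \<longlonglongrightarrow> (LINT \<omega>|N. F (Y \<omega>)))"

definition fdd_converge ::
  "'i set \<Rightarrow> (nat \<Rightarrow> 'a measure) \<Rightarrow> (nat \<Rightarrow> 'a \<Rightarrow> 'i \<Rightarrow> real) \<Rightarrow> 'b measure \<Rightarrow> ('b \<Rightarrow> 'i \<Rightarrow> real) \<Rightarrow> bool"
  where "fdd_converge I M X N Y \<longleftrightarrow>
    (\<forall>J. finite J \<and> J \<subseteq> I \<longrightarrow>
      converges_in_law (powertop_real J) M (\<lambda>n \<omega>. restrict (X n \<omega>) J) N (\<lambda>\<omega>. restrict (Y \<omega>) J))"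

section \<open>Isonormal Gaussian processes, Brownian sheet, Wiener integral\<close>

text \<open>The first disjunct is the degenerate case of variance \<open>0\<close>.\<close>

definition centered_normal :: "'b measure \<Rightarrow> ('b \<Rightarrow> real) \<Rightarrow> bool"
  where "centered_normal N Y \<longleftrightarrow> Y \<in> borel_measurable N \<and>
    ((AE \<omega> in N. Y \<omega> = 0) \<or> (\<exists>\<sigma>>0. distributed N lborel Y (normal_density 0 \<sigma>)))"

definition centered_gaussian_process :: "'b measure \<Rightarrow> 'i set \<Rightarrow> ('i \<Rightarrow> 'b \<Rightarrow> real) \<Rightarrow> bool"
  where "centered_gaussian_process N I W \<longleftrightarrow>
    (\<forall>J a. finite J \<and> J \<subseteq> I \<longrightarrow> centered_normal N (\<lambda>\<omega>. \<Sum>i\<in>J. a i * W i \<omega>))"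

text \<open>An isonormal process over \<open>L\<^sup>2(K)\<close> is indexed here by functions; by the covariance identity,
  functions that agree almost everywhere on \<open>K\<close> get almost surely equal random variables.\<close>

definition isonormal :: "'b measure \<Rightarrow> (real ^ 'n) set \<Rightarrow> ((real ^ 'n \<Rightarrow> real) \<Rightarrow> 'b \<Rightarrow> real) \<Rightarrow> bool"
  where "isonormal N K W \<longleftrightarrow>
    prob_space N \<and> complete_measure N \<and> centered_gaussian_process N (Lspace 2 K) W \<and>
    (\<forall>h\<in>Lspace 2 K. \<forall>g\<in>Lspace 2 K.
      (LINT \<omega>|N. W h \<omega> * W g \<omega>) = (LINT u|lebesgue_on K. h u * g u))"

text \<open>The indicator is that of the half-open box \<open>(0,t]\<close>. No continuous version is chosen: this
  process is used only through its finite dimensional distributions.\<close>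

definition brownian_sheet ::
  "((real ^ 'n \<Rightarrow> real) \<Rightarrow> 'b \<Rightarrow> real) \<Rightarrow> 'b \<Rightarrow> real ^ 'n \<Rightarrow> real"
  where "brownian_sheet W \<omega> t = W (indicator {u. \<forall>i. 0 < u $ i \<and> u $ i \<le> t $ i}) \<omega>"

definition wiener_integral ::
  "((real ^ 'n \<Rightarrow> real) \<Rightarrow> 'b \<Rightarrow> real) \<Rightarrow> (real ^ 'n \<Rightarrow> real) \<Rightarrow> 'b \<Rightarrow> real ^ 'n \<Rightarrow> real"
  where "wiener_integral W f \<omega> t = W (\<lambda>u. f u * indicator (cbox 0 t) u) \<omega>"

definition continuous_version ::
  "'b measure \<Rightarrow> (real ^ 'n) set \<Rightarrow> ('b \<Rightarrow> real ^ 'n \<Rightarrow> real) \<Rightarrow> ('b \<Rightarrow> real ^ 'n \<Rightarrow> real) \<Rightarrow> bool"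
  where "continuous_version N K Y X \<longleftrightarrow>
    (\<forall>\<omega>\<in>space N. X \<omega> \<in> mspace (Cspace K)) \<and> (\<forall>t\<in>K. AE \<omega> in N. X \<omega> t = Y \<omega> t)"

section \<open>Integrals of the processes \<open>\<theta>\<close>\<close>

text \<open>The process \<open>t \<mapsto> \<integral>\<^bsub>[0,t]\<^esub> f(u) \<theta>(u) du\<close> on \<open>[0,T]\<close>. Where \<open>f \<theta>\<close> is not integrable over
  \<open>[0,T]\<close> (a null event in the theorem) the whole path is set to \<open>0\<close>, so that every path lies
  in \<open>\<C>([0,T])\<close>.\<close>

definition integral_process ::
  "real ^ 'n \<Rightarrow> ('a \<Rightarrow> real ^ 'n \<Rightarrow> real) \<Rightarrow> (real ^ 'n \<Rightarrow> real) \<Rightarrow> 'a \<Rightarrow> real ^ 'n \<Rightarrow> real"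
  where "integral_process T \<theta> f \<omega> =
    (\<lambda>t\<in>cbox 0 T. if integrable (lebesgue_on (cbox 0 T)) (\<lambda>u. f u * \<theta> \<omega> u)
                   then LINT u|lebesgue_on (cbox 0 t). f u * \<theta> \<omega> u else 0)"

end

theory Submission
  imports Defs
begin

text \<open>
  Put \<open>p = 2q\<close> and \<open>\<gamma> = m / p > 1\<close>. The moment assumption says that the set function
  \<open>A \<mapsto> \<integral>\<^sub>A g \<theta>\<^sub>n\<close> is bounded in \<open>L\<^sup>m\<close> by the power \<open>\<gamma> / m\<close> of the measure \<open>\<integral>\<^sub>A |g|\<^sup>p\<close>. As in
  the lemma of Christ and Kiselev, bisecting the mass of that measure bounds the maximum over any
  chain of sublevel sets of one coordinate with a constant independent of the chain; the maximal
  functional is again subadditive, so the argument iterates over the \<open>d\<close> coordinates. Hence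
  \<open>sup\<^sub>t |\<integral>\<^bsub>[0,t]\<^esub> g \<theta>\<^sub>n|\<close> is controlled by the norm of \<open>g\<close>. Writing \<open>f\<^sub>n\<close> as a step function
  plus a small error, and applying the maximal inequality to thin slabs for the step function, gives
  a uniform bound on the modulus of continuity. Since step functions are dense, the finite
  dimensional distributions of \<open>X\<^sub>n\<close> converge by approximation with those of \<open>\<zeta>\<^sub>n\<close>. Finally, bounded
  continuous functionals are reduced to Lipschitz ones, and these to finite dimensional ones by
  interpolation on a finite net.
\<close>

section \<open>A maximal inequality for set functionals\<close>

text \<open>As \<open>f\<close> lies only in \<open>L^p\<close>, the measure \<open>|f|^p du\<close>
  may charge thin regions heavily, so no power of the distance between \<open>s\<close> and
  \<open>t\<close> bounds the increments of the limiting paths as in Kolmogorov's criterion.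
  Bisection therefore follows the mass of the measure and not the geometry of the box. Two halves
  together gain the factor \<open>2 powr (1 - \<gamma>)\<close>; half of this exponent is spent on
  splitting the \<open>m\<close>-th power of a sum, and what remains is a contraction, so that the
  constant solves a fixed-point equation instead of growing with the number of levels. The condition
  \<gamma> > 1 acts a second time for the step part: of the order of \<open>1/\<delta>\<close> slabs
  of mass \<open>O(\<delta>)\<close> contribute \<open>\<delta> powr \<gamma>\<close> each, which
  leaves \<open>\<delta> powr (\<gamma> - 1)\<close>. Tightness and Prokhorov's theorem are
  bypassed: the limit is given as a continuous process, and its oscillations over finite sets
  inherit the bounds for \<open>X\<^sub>n\<close> through finite dimensional convergence. For this
  reason every supremum is taken over a finite set, with constants that do not depend on that
  set.\<close>

lemma powr_add_le_weighted:
  fixes x y l m :: real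
  assumes "0 \<le> x" "0 \<le> y" "0 < l" "l < 1" "1 \<le> m"
  shows "(x + y) powr m \<le> l powr (1 - m) * x powr m + (1 - l) powr (1 - m) * y powr m"
proof -
  have scale: "s * (z / s) powr m = s powr (1 - m) * z powr m" if "0 < s" "0 \<le> z" for s z :: real
  proof -
    have "s * (z / s) powr m = s powr 1 / s powr m * z powr m"
      using that by (simp add: powr_divide)
    then show ?thesis using that by (simp add: powr_diff)
  qed
  consider "x = 0" | "y = 0" | "0 < x" "0 < y" using assms by fastforce
  then show ?thesis
  proof cases
    case 1
    have "1 \<le> (1 - l) powr (1 - m)"
      using assms powr_mono'[of "1 - m" 0 "1 - l"] by simp
    with 1 show ?thesis using mult_right_mono[of 1 "(1 - l) powr (1 - m)" "y powr m"] by simp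
  next
    case 2
    have "1 \<le> l powr (1 - m)"
      using assms powr_mono'[of "1 - m" 0 l] by simp
    with 2 show ?thesis using mult_right_mono[of 1 "l powr (1 - m)" "x powr m"] by simp
  next
    case 3
    \<comment> \<open>Convexity of the \<open>m\<close>-th power for
      \<open>x + y = l * (x / l) + (1 - l) * (y / (1 - l))\<close>. The free weight \<open>l\<close>
      lets the constant of one summand be close to 1 at the expense of the other.\<close>
    have "((1 - (1 - l)) *\<^sub>R (x / l) + (1 - l) *\<^sub>R (y / (1 - l))) powr m
        \<le> (1 - (1 - l)) * (x / l) powr m + (1 - l) * (y / (1 - l)) powr m"
      by (rule convex_onD[OF powr_convex]) (use assms 3 in auto)
    then show ?thesis
      using scale[of l x] scale[of "1 - l" y] assms by simp
  qed
qed

text \<open>In the application \<open>S A \<omega> = |\<integral>\<^sub>A g(u) \<theta>(u) du|\<close> and \<open>v A = \<integral>\<^sub>A |g(u)|\<^sup>p du\<close>.\<close>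

definition moment_dominated ::
  "'a measure \<Rightarrow> 's measure \<Rightarrow> ('s set \<Rightarrow> real) \<Rightarrow> real \<Rightarrow> real \<Rightarrow> real \<Rightarrow> ('s set \<Rightarrow> 'a \<Rightarrow> real) \<Rightarrow> bool"
  where "moment_dominated M L v m \<gamma> C S \<longleftrightarrow>
    (\<forall>A\<in>sets L. S A \<in> borel_measurable M) \<and>
    (\<forall>A\<in>sets L. \<forall>\<omega>\<in>space M. 0 \<le> S A \<omega>) \<and>
    (\<forall>A\<in>sets L. \<forall>B\<in>sets L. \<forall>\<omega>\<in>space M. A \<inter> B = {} \<longrightarrow> S (A \<union> B) \<omega> \<le> S A \<omega> + S B \<omega>) \<and>
    (\<forall>A\<in>sets L. (\<integral>\<^sup>+\<omega>. ennreal (S A \<omega> powr m) \<partial>M) \<le> ennreal (C * v A powr \<gamma>))"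

text \<open>With the set \<open>A\<close> kept as an argument this is again a set functional of the
  kind of \<open>S\<close>, ready to be maximised over the next coordinate. The inserted
  \<open>0\<close> covers empty \<open>F\<close> and changes nothing otherwise, as \<open>S\<close>
  is nonnegative.\<close>

definition level_max :: "('s \<Rightarrow> real) \<Rightarrow> real set \<Rightarrow> ('s set \<Rightarrow> 'a \<Rightarrow> real) \<Rightarrow> 's set \<Rightarrow> 'a \<Rightarrow> real"
  where "level_max a F S A \<omega> = Max (insert 0 ((\<lambda>c. S {u \<in> A. a u \<le> c} \<omega>) ` F))"

lemma level_max_empty [simp]: "level_max a {} S A \<omega> = 0"
  by (simp add: level_max_def)

lemma level_max_nonneg: "finite F \<Longrightarrow> 0 \<le> level_max a F S A \<omega>"
  by (simp add: level_max_def)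

lemma level_max_ge: "finite F \<Longrightarrow> c \<in> F \<Longrightarrow> S {u \<in> A. a u \<le> c} \<omega> \<le> level_max a F S A \<omega>"
  by (simp add: level_max_def)

lemma level_max_le:
  assumes "finite F" "0 \<le> b" "\<And>c. c \<in> F \<Longrightarrow> S {u \<in> A. a u \<le> c} \<omega> \<le> b"
  shows "level_max a F S A \<omega> \<le> b"
  using assms by (auto simp: level_max_def)

locale finitely_additive =
  fixes L :: "'s measure" and v :: "'s set \<Rightarrow> real" and m \<gamma> :: real
  assumes v_nonneg: "A \<in> sets L \<Longrightarrow> 0 \<le> v A"
    and v_add: "A \<in> sets L \<Longrightarrow> B \<in> sets L \<Longrightarrow> A \<inter> B = {} \<Longrightarrow> v (A \<union> B) = v A + v B"
    and m_gt_1: "1 < m" and \<gamma>_gt_1: "1 < \<gamma>"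
begin

text \<open>Solves \<open>(1 - l) powr (1 - m) = 2 powr ((\<gamma> - 1) / 2)\<close>: the price paid
  in front of the two halves is the square root of their gain \<open>2 powr (\<gamma> - 1)\<close>,
  so a net factor below 1 survives.\<close>

definition bisect_weight :: real
  where "bisect_weight = 1 - 2 powr (- (\<gamma> - 1) / (2 * (m - 1)))"

text \<open>Sum of a geometric series: each bisection costs
  \<open>bisect_weight powr (1 - m)\<close> and passes the rest on with ratio
  \<open>2 powr (- (\<gamma> - 1) / 2)\<close>. Being the fixed point of this recursion, it
  reproduces itself in the induction on the number of levels.\<close>

definition max_const :: real
  where "max_const = bisect_weight powr (1 - m) / (1 - 2 powr (- (\<gamma> - 1) / 2))"

lemma bisect_weight: "0 < bisect_weight" "bisect_weight < 1"
  using m_gt_1 \<gamma>_gt_1 powr_less_cancel_iff[of 2 "- (\<gamma> - 1) / (2 * (m - 1))" 0]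
  by (auto simp: bisect_weight_def divide_neg_pos)

lemma half_powr_less_1: "2 powr (- (\<gamma> - 1) / 2) < (1::real)"
  using \<gamma>_gt_1 powr_less_cancel_iff[of 2 "- (\<gamma> - 1) / 2" 0] by simp

lemma max_const_pos: "0 < max_const"
  using half_powr_less_1 bisect_weight(1) by (simp add: max_const_def)

lemma bisect_weight_powr:
  "(1 - bisect_weight) powr (1 - m) * (2 * (1/2) powr \<gamma>) = 2 powr (- (\<gamma> - 1) / 2)"
proof -
  have e: "- (\<gamma> - 1) / (2 * (m - 1)) * (1 - m) = (\<gamma> - 1) / 2"
    using m_gt_1 by (simp add: field_simps)
  have "(1 - bisect_weight) powr (1 - m) = 2 powr ((\<gamma> - 1) / 2)"
    unfolding bisect_weight_def using e by (simp only: powr_powr diff_diff_eq2 add_diff_cancel_left' diff_add_cancel)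
  moreover have "2 * (1/2::real) powr \<gamma> = 2 powr (1 - \<gamma>)"
    by (simp add: powr_diff powr_divide)
  moreover have "(\<gamma> - 1) / 2 + (1 - \<gamma>) = - (\<gamma> - 1) / 2" by (simp add: field_simps)
  ultimately show ?thesis by (metis powr_add)
qed

lemma max_const_fixpoint:
  "bisect_weight powr (1 - m) + 2 powr (- (\<gamma> - 1) / 2) * max_const = max_const"
proof -
  define b r :: real where "b = bisect_weight powr (1 - m)" and "r = 2 powr (- (\<gamma> - 1) / 2)"
  have "b + r * (b / (1 - r)) = b / (1 - r)" if "r < 1" using that by (simp add: field_simps)
  then show ?thesis using half_powr_less_1 unfolding max_const_def b_def r_def by blast
qed

lemma v_mono:
  assumes "A \<in> sets L" "B \<in> sets L" "A \<subseteq> B" shows "v A \<le> v B"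
proof -
  have "v (A \<union> (B - A)) = v A + v (B - A)" using assms by (intro v_add) auto
  moreover have "A \<union> (B - A) = B" using assms by auto
  ultimately show ?thesis using v_nonneg[of "B - A"] assms by auto
qed

lemma level_sets [measurable]:
  fixes a :: "'s \<Rightarrow> real"
  assumes "a \<in> borel_measurable L" "A \<in> sets L"
  shows "{u \<in> A. a u \<le> c} \<in> sets L" "{u \<in> A. c < a u} \<in> sets L"
proof -
  have "{u \<in> space L. a u \<le> c} \<inter> A \<in> sets L" "{u \<in> space L. c < a u} \<inter> A \<in> sets L"
    using assms by measurable
  moreover have "{u \<in> A. a u \<le> c} = {u \<in> space L. a u \<le> c} \<inter> A"
    "{u \<in> A. c < a u} = {u \<in> space L. c < a u} \<inter> A"
    using sets.sets_into_space[OF assms(2)] by auto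
  ultimately show "{u \<in> A. a u \<le> c} \<in> sets L" "{u \<in> A. c < a u} \<in> sets L" by simp_all
qed

lemma v_split:
  fixes a :: "'s \<Rightarrow> real"
  assumes "a \<in> borel_measurable L" "A \<in> sets L"
  shows "v A = v {u \<in> A. a u \<le> c} + v {u \<in> A. c < a u}"
proof -
  have "v ({u \<in> A. a u \<le> c} \<union> {u \<in> A. c < a u}) = v {u \<in> A. a u \<le> c} + v {u \<in> A. c < a u}"
    using assms by (intro v_add) auto
  moreover have "{u \<in> A. a u \<le> c} \<union> {u \<in> A. c < a u} = A" by auto
  ultimately show ?thesis by simp
qed

lemma moment_dominatedD:
  assumes "moment_dominated M L v m \<gamma> C S" "A \<in> sets L"
  shows "S A \<in> borel_measurable M" "\<omega> \<in> space M \<Longrightarrow> 0 \<le> S A \<omega>"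
    "B \<in> sets L \<Longrightarrow> \<omega> \<in> space M \<Longrightarrow> A \<inter> B = {} \<Longrightarrow> S (A \<union> B) \<omega> \<le> S A \<omega> + S B \<omega>"
    "(\<integral>\<^sup>+\<omega>. ennreal (S A \<omega> powr m) \<partial>M) \<le> ennreal (C * v A powr \<gamma>)"
  using assms unfolding moment_dominated_def by auto

lemma level_max_measurable:
  assumes "moment_dominated M L v m \<gamma> C S" "a \<in> borel_measurable L" "A \<in> sets L" "finite F"
  shows "level_max a F S A \<in> borel_measurable M"
proof -
  have "(\<lambda>\<omega>. Max ((\<lambda>g. g \<omega>) ` insert (\<lambda>_. 0) ((\<lambda>c. S {u \<in> A. a u \<le> c}) ` F))) \<in> borel_measurable M"
    using assms moment_dominatedD(1)[OF assms(1)] by (intro borel_measurable_Max) auto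
  then show ?thesis by (simp add: level_max_def[abs_def] image_image)
qed

text \<open>A level below \<open>c0\<close> sees only the part up to \<open>c1\<close>, and a level
  above \<open>c0\<close> sees the whole lower part plus a level set of the upper part. A given
  level lies on one side only, hence the maximum of \<open>M1\<close> and \<open>M2\<close> rather
  than their sum.\<close>

lemma level_max_bisect:
  assumes S: "moment_dominated M L v m \<gamma> C S" and a: "a \<in> borel_measurable L"
    and A: "A \<in> sets L" and F: "finite F" and c0: "c0 \<in> F"
    and c1: "\<And>c. c \<in> F \<Longrightarrow> c < c0 \<Longrightarrow> c \<le> c1" and \<omega>: "\<omega> \<in> space M"
  defines "M1 \<equiv> level_max a {c \<in> F. c < c0} S {u \<in> A. a u \<le> c1} \<omega>"
    and "M2 \<equiv> level_max a {c \<in> F. c0 < c} S {u \<in> A. c0 < a u} \<omega>"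
  shows "level_max a F S A \<omega> \<le> S {u \<in> A. a u \<le> c0} \<omega> + max M1 M2"
proof (rule level_max_le[OF F])
  have nn: "0 \<le> S {u \<in> A. a u \<le> c0} \<omega>"
    by (rule moment_dominatedD(2)[OF S _ \<omega>]) (use a A in auto)
  have M1: "0 \<le> M1" and M2: "0 \<le> M2" using F by (auto simp: M1_def M2_def intro!: level_max_nonneg)
  show "0 \<le> S {u \<in> A. a u \<le> c0} \<omega> + max M1 M2" using nn M1 by auto
  fix c assume c: "c \<in> F"
  consider "c = c0" | "c < c0" | "c0 < c" by linarith
  then show "S {u \<in> A. a u \<le> c} \<omega> \<le> S {u \<in> A. a u \<le> c0} \<omega> + max M1 M2"
  proof cases
    case 1 then show ?thesis using M1 by auto
  next
    case 2
    have "{u \<in> {u \<in> A. a u \<le> c1}. a u \<le> c} = {u \<in> A. a u \<le> c}" using c1[OF c 2] by auto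
    moreover have "S {u \<in> {u \<in> A. a u \<le> c1}. a u \<le> c} \<omega> \<le> M1"
      unfolding M1_def using c 2 F by (intro level_max_ge) auto
    ultimately show ?thesis using nn by auto
  next
    case 3
    have eq: "{u \<in> A. a u \<le> c} = {u \<in> A. a u \<le> c0} \<union> {u \<in> {u \<in> A. c0 < a u}. a u \<le> c}"
      using 3 by auto
    have "S {u \<in> A. a u \<le> c} \<omega> \<le> S {u \<in> A. a u \<le> c0} \<omega> + S {u \<in> {u \<in> A. c0 < a u}. a u \<le> c} \<omega>"
      unfolding eq by (rule moment_dominatedD(3)[OF S]) (use a A \<omega> in auto)
    moreover have "S {u \<in> {u \<in> A. c0 < a u}. a u \<le> c} \<omega> \<le> M2"
      unfolding M2_def using c 3 F by (intro level_max_ge) auto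
    ultimately show ?thesis by linarith
  qed
qed

text \<open>The levels are cut at the first one carrying at least half of the mass of \<open>A\<close>, so that both
  remaining parts carry at most half of it; as \<open>\<gamma> > 1\<close> the two halves together contribute a
  factor less than \<open>1\<close>, and the constant does not grow with the number of levels.\<close>

lemma level_max_moment:
  assumes S: "moment_dominated M L v m \<gamma> C S" and a: "a \<in> borel_measurable L" and C: "0 \<le> C"
    and F: "finite F" and A: "A \<in> sets L"
  shows "(\<integral>\<^sup>+\<omega>. ennreal (level_max a F S A \<omega> powr m) \<partial>M) \<le> ennreal (max_const * C * v A powr \<gamma>)"
  using F A
proof (induction "card F" arbitrary: F A rule: less_induct)
  case less
  note F = less.prems(1) and A = less.prems(2)
  show ?case
  proof (cases "F = {}")
    case True then show ?thesis using m_gt_1 by simp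
  next
    case False
    define V where "V = v A"
    have V: "0 \<le> V" unfolding V_def using A by (rule v_nonneg)
    define H where "H = {c \<in> F. V / 2 \<le> v {u \<in> A. a u \<le> c}}"
    \<comment> \<open>If no level reaches half of the mass, cutting at the top level leaves no level
      above, so that \<open>F2\<close> is empty.\<close>
    define c0 where "c0 = (if H = {} then Max F else Min H)"
    have finH: "finite H" using F by (simp add: H_def)
    have c0F: "c0 \<in> F"
      using Min_in[OF finH] Max_in[OF F False] by (auto simp: c0_def H_def)
    define F1 F2 where "F1 = {c \<in> F. c < c0}" and "F2 = {c \<in> F. c0 < c}"
    \<comment> \<open>The lower part is cut at the last level before \<open>c0\<close>, since the
      level set of \<open>c0\<close> itself may carry more than half of the mass. The default is
      immaterial: for empty \<open>F1\<close> the maximum \<open>M1\<close> is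
      \<open>0\<close>.\<close>
    define c1 where "c1 = (if F1 = {} then c0 else Max F1)"
    have finF: "finite F1" "finite F2" using F by (auto simp: F1_def F2_def)
    have card: "card F1 < card F" "card F2 < card F"
      using c0F F by (auto simp: F1_def F2_def intro!: psubset_card_mono)
    define A1 A2 where "A1 = {u \<in> A. a u \<le> c1}" and "A2 = {u \<in> A. c0 < a u}"
    have A12: "A1 \<in> sets L" "A2 \<in> sets L" using a A by (auto simp: A1_def A2_def)
    have A0: "{u \<in> A. a u \<le> c0} \<in> sets L" using a A by auto
    define K where "K = max_const * C"
    have K: "0 \<le> K" using max_const_pos C by (simp add: K_def)
    define M1 M2 where "M1 = (\<lambda>\<omega>. level_max a F1 S A1 \<omega>)" and "M2 = (\<lambda>\<omega>. level_max a F2 S A2 \<omega>)"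
    have meas [measurable]: "M1 \<in> borel_measurable M" "M2 \<in> borel_measurable M"
      "S {u \<in> A. a u \<le> c0} \<in> borel_measurable M"
      unfolding M1_def M2_def
      by (intro level_max_measurable[OF S a A12(1) finF(1)] level_max_measurable[OF S a A12(2) finF(2)]
            moment_dominatedD(1)[OF S A0])+
    have I1: "(\<integral>\<^sup>+\<omega>. ennreal (M1 \<omega> powr m) \<partial>M) \<le> ennreal (K * (V / 2) powr \<gamma>)"
    proof (cases "F1 = {}")
      case True then show ?thesis using m_gt_1 by (simp add: M1_def)
    next
      case F1: False
      then have "c1 \<in> F1" using Max_in[OF finF(1)] by (simp add: c1_def)
      then have "c1 \<notin> H" "c1 \<in> F"
        using Min_le[OF finH, of c1] by (auto simp: F1_def c0_def split: if_splits)
      then have "v A1 \<le> V / 2" by (auto simp: H_def A1_def)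
      then have "v A1 powr \<gamma> \<le> (V / 2) powr \<gamma>"
        using v_nonneg[OF A12(1)] \<gamma>_gt_1 by (intro powr_mono2) auto
      then have "ennreal (K * v A1 powr \<gamma>) \<le> ennreal (K * (V / 2) powr \<gamma>)"
        using K by (intro ennreal_leI mult_left_mono) auto
      then show ?thesis
        using less.hyps[OF card(1) finF(1) A12(1)] unfolding M1_def K_def by (rule order_trans[rotated])
    qed
    have I2: "(\<integral>\<^sup>+\<omega>. ennreal (M2 \<omega> powr m) \<partial>M) \<le> ennreal (K * (V / 2) powr \<gamma>)"
    proof (cases "H = {}")
      case True
      then have "F2 = {}" using Max_ge[OF F] by (force simp: F2_def c0_def)
      then show ?thesis using m_gt_1 by (simp add: M2_def)
    next
      case False
      then have "c0 \<in> H" using Min_in[OF finH] by (simp add: c0_def)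
      then have "v A2 \<le> V / 2" using v_split[OF a A, of c0] by (simp add: H_def A2_def V_def)
      then have "v A2 powr \<gamma> \<le> (V / 2) powr \<gamma>"
        using v_nonneg[OF A12(2)] \<gamma>_gt_1 by (intro powr_mono2) auto
      then have "ennreal (K * v A2 powr \<gamma>) \<le> ennreal (K * (V / 2) powr \<gamma>)"
        using K by (intro ennreal_leI mult_left_mono) auto
      then show ?thesis
        using less.hyps[OF card(2) finF(2) A12(2)] unfolding M2_def K_def by (rule order_trans[rotated])
    qed
    have I0: "(\<integral>\<^sup>+\<omega>. ennreal (S {u \<in> A. a u \<le> c0} \<omega> powr m) \<partial>M) \<le> ennreal (C * V powr \<gamma>)"
    proof -
      have "v {u \<in> A. a u \<le> c0} powr \<gamma> \<le> V powr \<gamma>"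
        unfolding V_def using v_nonneg[OF A0] \<gamma>_gt_1 A0 A by (intro powr_mono2 v_mono) auto
      then have "ennreal (C * v {u \<in> A. a u \<le> c0} powr \<gamma>) \<le> ennreal (C * V powr \<gamma>)"
        using C by (intro ennreal_leI mult_left_mono) auto
      then show ?thesis using moment_dominatedD(4)[OF S A0] by (rule order_trans[rotated])
    qed
    define w1 w2 where "w1 = bisect_weight powr (1 - m)" and "w2 = (1 - bisect_weight) powr (1 - m)"
    have w: "0 \<le> w1" "0 \<le> w2" by (auto simp: w1_def w2_def)
    have "(\<integral>\<^sup>+\<omega>. ennreal (level_max a F S A \<omega> powr m) \<partial>M)
        \<le> (\<integral>\<^sup>+\<omega>. ennreal w1 * ennreal (S {u \<in> A. a u \<le> c0} \<omega> powr m)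
             + ennreal w2 * (ennreal (M1 \<omega> powr m) + ennreal (M2 \<omega> powr m)) \<partial>M)"
    proof (rule nn_integral_mono)
      fix \<omega> assume \<omega>: "\<omega> \<in> space M"
      have s0: "0 \<le> S {u \<in> A. a u \<le> c0} \<omega>" by (rule moment_dominatedD(2)[OF S A0 \<omega>])
      have nn: "0 \<le> M1 \<omega>" "0 \<le> M2 \<omega>" using finF by (auto simp: M1_def M2_def intro!: level_max_nonneg)
      have "level_max a F S A \<omega> \<le> S {u \<in> A. a u \<le> c0} \<omega> + max (M1 \<omega>) (M2 \<omega>)"
        unfolding M1_def M2_def A1_def A2_def F1_def F2_def
        using finF(1) Max_ge[OF finF(1)] by (intro level_max_bisect[OF S a A F c0F _ \<omega>]) (auto simp: c1_def F1_def)
      then have "level_max a F S A \<omega> powr m \<le> (S {u \<in> A. a u \<le> c0} \<omega> + max (M1 \<omega>) (M2 \<omega>)) powr m"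
        using level_max_nonneg[OF F] m_gt_1 by (intro powr_mono2) auto
      also have "\<dots> \<le> w1 * S {u \<in> A. a u \<le> c0} \<omega> powr m + w2 * max (M1 \<omega>) (M2 \<omega>) powr m"
        unfolding w1_def w2_def using bisect_weight m_gt_1 s0 nn by (intro powr_add_le_weighted) auto
      \<comment> \<open>The power of a maximum is at most the sum of the powers, so treating the two
        halves together costs no further constant.\<close>
      also have "\<dots> \<le> w1 * S {u \<in> A. a u \<le> c0} \<omega> powr m + w2 * (M1 \<omega> powr m + M2 \<omega> powr m)"
        using w by (intro add_left_mono mult_left_mono) (auto simp: max_def)
      finally show "ennreal (level_max a F S A \<omega> powr m)
          \<le> ennreal w1 * ennreal (S {u \<in> A. a u \<le> c0} \<omega> powr m)
             + ennreal w2 * (ennreal (M1 \<omega> powr m) + ennreal (M2 \<omega> powr m))"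
        using w by (simp add: ennreal_leI flip: ennreal_mult ennreal_plus)
    qed
    also have "\<dots> = ennreal w1 * (\<integral>\<^sup>+\<omega>. ennreal (S {u \<in> A. a u \<le> c0} \<omega> powr m) \<partial>M)
        + ennreal w2 * ((\<integral>\<^sup>+\<omega>. ennreal (M1 \<omega> powr m) \<partial>M) + (\<integral>\<^sup>+\<omega>. ennreal (M2 \<omega> powr m) \<partial>M))"
      by (simp add: nn_integral_add nn_integral_cmult)
    also have "\<dots> \<le> ennreal w1 * ennreal (C * V powr \<gamma>)
        + ennreal w2 * (ennreal (K * (V / 2) powr \<gamma>) + ennreal (K * (V / 2) powr \<gamma>))"
      by (intro add_mono mult_left_mono I0 I1 I2) auto
    also have "\<dots> = ennreal (w1 * (C * V powr \<gamma>) + w2 * (K * (V / 2) powr \<gamma> + K * (V / 2) powr \<gamma>))"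
      using w C K by (simp flip: ennreal_mult ennreal_plus)
    also have "w1 * (C * V powr \<gamma>) + w2 * (K * (V / 2) powr \<gamma> + K * (V / 2) powr \<gamma>)
        = max_const * C * V powr \<gamma>"
    proof -
      have "(V / 2) powr \<gamma> = (1/2) powr \<gamma> * V powr \<gamma>"
        using V by (simp add: powr_divide)
      then have "w1 * (C * V powr \<gamma>) + w2 * (K * (V / 2) powr \<gamma> + K * (V / 2) powr \<gamma>)
          = (w1 + w2 * (2 * (1/2) powr \<gamma>) * max_const) * C * V powr \<gamma>"
        by (simp add: K_def algebra_simps)
      then show ?thesis
        unfolding w1_def w2_def bisect_weight_powr max_const_fixpoint .
    qed
    finally show ?thesis unfolding V_def .
  qed
qed

text \<open>Level sets of a disjoint union split, so subadditivity survives the maximum. With the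
  moment bound this returns to the same class, at the cost of one factor \<open>max_const\<close>,
  and the maximisation can be repeated for another coordinate.\<close>

lemma moment_dominated_level_max:
  assumes S: "moment_dominated M L v m \<gamma> C S" and a: "a \<in> borel_measurable L" and C: "0 \<le> C"
    and F: "finite F"
  shows "moment_dominated M L v m \<gamma> (max_const * C) (level_max a F S)"
  unfolding moment_dominated_def
proof (intro conjI ballI impI)
  fix A assume A: "A \<in> sets L"
  show "level_max a F S A \<in> borel_measurable M"
    by (rule level_max_measurable[OF S a A F])
  show "(\<integral>\<^sup>+\<omega>. ennreal (level_max a F S A \<omega> powr m) \<partial>M) \<le> ennreal (max_const * C * v A powr \<gamma>)"
    by (rule level_max_moment[OF S a C F A])
  fix \<omega> assume \<omega>: "\<omega> \<in> space M"
  show "0 \<le> level_max a F S A \<omega>" using F by (rule level_max_nonneg)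
  fix B assume B: "B \<in> sets L" and AB: "A \<inter> B = {}"
  show "level_max a F S (A \<union> B) \<omega> \<le> level_max a F S A \<omega> + level_max a F S B \<omega>"
  proof (rule level_max_le[OF F])
    show "0 \<le> level_max a F S A \<omega> + level_max a F S B \<omega>"
      using level_max_nonneg[OF F] by (intro add_nonneg_nonneg)
    fix c assume c: "c \<in> F"
    have eq: "{u \<in> A \<union> B. a u \<le> c} = {u \<in> A. a u \<le> c} \<union> {u \<in> B. a u \<le> c}" by auto
    have "S {u \<in> A \<union> B. a u \<le> c} \<omega> \<le> S {u \<in> A. a u \<le> c} \<omega> + S {u \<in> B. a u \<le> c} \<omega>"
      unfolding eq by (rule moment_dominatedD(3)[OF S]) (use a A B AB \<omega> in auto)
    also have "\<dots> \<le> level_max a F S A \<omega> + level_max a F S B \<omega>"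
      using F c by (intro add_mono level_max_ge)
    finally show "S {u \<in> A \<union> B. a u \<le> c} \<omega> \<le> level_max a F S A \<omega> + level_max a F S B \<omega>" .
  qed
qed

text \<open>Induction over the coordinates: the constraint of the new coordinate is absorbed into
  the set, \<open>S'\<close> handles the old ones on that smaller set, and \<open>level_max\<close>
  then maximises over the new level.\<close>

lemma multiparameter_maximal:
  fixes a :: "'i \<Rightarrow> 's \<Rightarrow> real" and F :: "'i \<Rightarrow> real set"
  assumes S: "moment_dominated M L v m \<gamma> C S" and C: "0 \<le> C" and I: "finite I"
    and a: "\<And>i. i \<in> I \<Longrightarrow> a i \<in> borel_measurable L" and F: "\<And>i. i \<in> I \<Longrightarrow> finite (F i)"
  shows "\<exists>S'. moment_dominated M L v m \<gamma> (max_const ^ card I * C) S' \<and>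
    (\<forall>A\<in>sets L. \<forall>\<omega>\<in>space M. \<forall>c. (\<forall>i\<in>I. c i \<in> F i) \<longrightarrow> S {u \<in> A. \<forall>i\<in>I. a i u \<le> c i} \<omega> \<le> S' A \<omega>)"
  using I a F
proof (induction I)
  case empty
  then show ?case using S by (intro exI[of _ S]) auto
next
  case (insert k I)
  then obtain S' where S': "moment_dominated M L v m \<gamma> (max_const ^ card I * C) S'"
    and le: "\<And>A \<omega> c. A \<in> sets L \<Longrightarrow> \<omega> \<in> space M \<Longrightarrow> (\<forall>i\<in>I. c i \<in> F i) \<Longrightarrow>
      S {u \<in> A. \<forall>i\<in>I. a i u \<le> c i} \<omega> \<le> S' A \<omega>"
    using insert.IH[OF insert.prems(1) insert.prems(2)] by blast
  have k: "a k \<in> borel_measurable L" "finite (F k)" using insert.prems by auto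
  have C': "0 \<le> max_const ^ card I * C" using C max_const_pos by simp
  show ?case
  proof (intro exI[of _ "level_max (a k) (F k) S'"] conjI ballI allI impI)
    show "moment_dominated M L v m \<gamma> (max_const ^ card (insert k I) * C) (level_max (a k) (F k) S')"
      using moment_dominated_level_max[OF S' k(1) C' k(2)] insert.hyps by (simp add: mult_ac)
    fix A \<omega> c assume A: "A \<in> sets L" and \<omega>: "\<omega> \<in> space M" and c: "\<forall>i\<in>insert k I. c i \<in> F i"
    have Ak: "{u \<in> A. a k u \<le> c k} \<in> sets L" using k(1) A by (rule level_sets)
    have "{u \<in> A. \<forall>i\<in>insert k I. a i u \<le> c i} = {u \<in> {u \<in> A. a k u \<le> c k}. \<forall>i\<in>I. a i u \<le> c i}" by auto
    then have "S {u \<in> A. \<forall>i\<in>insert k I. a i u \<le> c i} \<omega> \<le> S' {u \<in> A. a k u \<le> c k} \<omega>"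
      using le[OF Ak \<omega>, of c] c by simp
    also have "\<dots> \<le> level_max (a k) (F k) S' A \<omega>" using c k by (intro level_max_ge) auto
    finally show "S {u \<in> A. \<forall>i\<in>insert k I. a i u \<le> c i} \<omega> \<le> level_max (a k) (F k) S' A \<omega>" .
  qed
qed

end

section \<open>Convergence in law in metric spaces\<close>

lemma measurable_borel_sigma_iff:
  "X \<in> measurable M (borel_sigma S) \<longleftrightarrow>
    X \<in> space M \<rightarrow> topspace S \<and> (\<forall>U. openin S U \<longrightarrow> X -` U \<inter> space M \<in> sets M)"
proof -
  have pow: "{U. openin S U} \<subseteq> Pow (topspace S)" using openin_subset by auto
  show ?thesis
  proof
    assume X: "X \<in> measurable M (borel_sigma S)"
    then have "X \<in> space M \<rightarrow> topspace S"
      by (auto simp: borel_sigma_def measurable_def space_measure_of[OF pow])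
    moreover have "X -` U \<inter> space M \<in> sets M" if "openin S U" for U
      using measurable_sets[OF X, of U] that by (auto simp: borel_sigma_def sets_measure_of[OF pow])
    ultimately show "X \<in> space M \<rightarrow> topspace S \<and> (\<forall>U. openin S U \<longrightarrow> X -` U \<inter> space M \<in> sets M)" by auto
  qed (auto simp: borel_sigma_def intro!: measurable_measure_of[OF pow])
qed

lemma measurable_continuous_map_borel_sigma:
  assumes X: "X \<in> measurable M (borel_sigma S)" and F: "continuous_map S euclideanreal F"
  shows "(\<lambda>\<omega>. F (X \<omega>)) \<in> borel_measurable M"
proof (rule borel_measurableI)
  fix V :: "real set" assume "open V"
  then have U: "openin S {x \<in> topspace S. F x \<in> V}"
    using F by (auto simp: continuous_map_def)
  have "(\<lambda>\<omega>. F (X \<omega>)) -` V \<inter> space M = X -` {x \<in> topspace S. F x \<in> V} \<inter> space M"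
    using X by (auto simp: measurable_borel_sigma_iff)
  then show "(\<lambda>\<omega>. F (X \<omega>)) -` V \<inter> space M \<in> sets M"
    using X U by (auto simp: measurable_borel_sigma_iff)
qed

definition metric_lipschitz :: "'s metric \<Rightarrow> real \<Rightarrow> ('s \<Rightarrow> real) \<Rightarrow> bool"
  where "metric_lipschitz S k F \<longleftrightarrow> (\<forall>x\<in>mspace S. \<forall>y\<in>mspace S. \<bar>F x - F y\<bar> \<le> k * mdist S x y)"

lemma metric_lipschitz_continuous_map:
  assumes "metric_lipschitz S k F"
  shows "continuous_map (mtopology_of S) euclideanreal F"
proof -
  have "Lipschitz_continuous_map S euclidean_metric F"
    using assms by (auto simp: Lipschitz_continuous_map_def metric_lipschitz_def dist_real_def)
  then show ?thesis using Lipschitz_continuous_imp_continuous_map by fastforce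
qed

text \<open>The Lipschitz regularisation (Pasch-Hausdorff envelope) of \<open>F\<close>: a
  \<open>k\<close>-Lipschitz minorant which, for \<open>F\<close> bounded below, tends to
  \<open>F\<close> at every point of lower semicontinuity.\<close>

definition inf_convolution :: "'s metric \<Rightarrow> nat \<Rightarrow> ('s \<Rightarrow> real) \<Rightarrow> 's \<Rightarrow> real"
  where "inf_convolution S k F x = (INF y\<in>mspace S. F y + real k * mdist S x y)"

context
  fixes S :: "'s metric" and F :: "'s \<Rightarrow> real" and a :: real
  assumes lower: "\<forall>x\<in>mspace S. a \<le> F x"
begin

lemma inf_convolution_bdd: "x \<in> mspace S \<Longrightarrow> bdd_below ((\<lambda>y. F y + real k * mdist S x y) ` mspace S)"
  using lower by (intro bdd_belowI[of _ a]) (auto intro!: add_increasing2 mult_nonneg_nonneg)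

lemma inf_convolution_le:
  assumes "x \<in> mspace S" "y \<in> mspace S"
  shows "inf_convolution S k F x \<le> F y + real k * mdist S x y"
  unfolding inf_convolution_def
  using cINF_lower[OF inf_convolution_bdd[OF assms(1)] assms(2)] .

lemma inf_convolution_le_self: "x \<in> mspace S \<Longrightarrow> inf_convolution S k F x \<le> F x"
  by (metis add.right_neutral inf_convolution_le mdist_zero mult_zero_right)

lemma inf_convolution_ge:
  assumes "x \<in> mspace S" "\<And>y. y \<in> mspace S \<Longrightarrow> b \<le> F y + real k * mdist S x y"
  shows "b \<le> inf_convolution S k F x"
  unfolding inf_convolution_def using assms by (intro cINF_greatest) auto

lemma inf_convolution_lower: "x \<in> mspace S \<Longrightarrow> a \<le> inf_convolution S k F x"
  using lower by (intro inf_convolution_ge) (auto intro!: add_increasing2 mult_nonneg_nonneg)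

lemma inf_convolution_lipschitz: "metric_lipschitz S (real k) (inf_convolution S k F)"
proof -
  have "inf_convolution S k F x - k * mdist S x y \<le> inf_convolution S k F y"
    if "x \<in> mspace S" "y \<in> mspace S" for x y
  proof (rule inf_convolution_ge[OF that(2)])
    fix z assume z: "z \<in> mspace S"
    have "mdist S x z \<le> mdist S x y + mdist S y z" using that z by (rule mdist_triangle)
    then have "real k * mdist S x z \<le> real k * mdist S x y + real k * mdist S y z"
      by (metis distrib_left mult_left_mono of_nat_0_le_iff)
    then show "inf_convolution S k F x - k * mdist S x y \<le> F z + real k * mdist S y z"
      using inf_convolution_le[OF that(1) z, of k] by linarith
  qed
  note le = this
  show ?thesis
    unfolding metric_lipschitz_def
  proof (intro ballI)
    fix x y assume xy: "x \<in> mspace S" "y \<in> mspace S"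
    show "\<bar>inf_convolution S k F x - inf_convolution S k F y\<bar> \<le> real k * mdist S x y"
      using le[OF xy] le[OF xy(2) xy(1)] mdist_commute[of S x y] by (simp add: abs_le_iff)
  qed
qed

text \<open>Near \<open>x\<close> lower semicontinuity prevents a drop by more than
  \<open>e / 2\<close>; farther away the penalty \<open>k * mdist S x y\<close> outweighs any drop
  down to the lower bound \<open>a\<close>.\<close>

lemma inf_convolution_tendsto:
  assumes x: "x \<in> mspace S"
    and lsc: "\<And>e. 0 < e \<Longrightarrow> \<exists>r>0. \<forall>y\<in>mspace S. mdist S x y < r \<longrightarrow> F x - e \<le> F y"
  shows "(\<lambda>k. inf_convolution S k F x) \<longlonglongrightarrow> F x"
proof (rule LIMSEQ_I)
  fix e :: real assume "0 < e"
  then obtain r where r: "r > 0" "\<And>y. y \<in> mspace S \<Longrightarrow> mdist S x y < r \<Longrightarrow> F x - e / 2 \<le> F y"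
    using lsc[of "e / 2"] by auto
  \<comment> \<open>From this index on, the penalty at distance \<open>r\<close> is at least
    \<open>F x - a\<close>, the largest possible drop.\<close>
  obtain k0 where k0: "(F x - a) / r \<le> real k0" using real_arch_simple by blast
  show "\<exists>k0. \<forall>k\<ge>k0. norm (inf_convolution S k F x - F x) < e"
  proof (intro exI allI impI)
    fix k assume k: "k \<ge> k0"
    have "F x - e / 2 \<le> inf_convolution S k F x"
    proof (rule inf_convolution_ge[OF x])
      fix y assume y: "y \<in> mspace S"
      show "F x - e / 2 \<le> F y + real k * mdist S x y"
      proof (cases "mdist S x y < r")
        case True
        moreover have "0 \<le> real k * mdist S x y" by simp
        ultimately show ?thesis using r(2)[OF y] by linarith
      next
        case False
        have "F x - a \<le> real k0 * r" using k0 r(1) by (simp add: divide_le_eq)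
        also have "\<dots> \<le> real k * mdist S x y" using False k r(1) by (intro mult_mono) auto
        finally show ?thesis using bspec[OF lower y] \<open>0 < e\<close> by linarith
      qed
    qed
    then show "norm (inf_convolution S k F x - F x) < e"
      using inf_convolution_le_self[OF x, of k] \<open>0 < e\<close> by (simp add: abs_if)
  qed
qed

end

text \<open>The indicator of an open set is lower semicontinuous, hence a pointwise limit of bounded
  Lipschitz functions. Separability of the space does not enter the argument.\<close>

lemma measurable_borel_sigma_lipschitz:
  fixes S :: "'s metric"
  assumes X: "X \<in> space M \<rightarrow> mspace S"
    and meas: "\<And>F k b. metric_lipschitz S k F \<Longrightarrow> (\<And>x. x \<in> mspace S \<Longrightarrow> \<bar>F x\<bar> \<le> b) \<Longrightarrow>
      (\<lambda>\<omega>. F (X \<omega>)) \<in> borel_measurable M"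
  shows "X \<in> measurable M (borel_sigma (mtopology_of S))"
  unfolding measurable_borel_sigma_iff
proof (intro conjI allI impI)
  show "X \<in> space M \<rightarrow> topspace (mtopology_of S)" using X by simp
  fix U assume U: "openin (mtopology_of S) U"
  interpret Metric_space "mspace S" "mdist S" by simp
  have Uo: "openin mtopology U" using U by (simp add: mtopology_of_def)
  define F :: "'s \<Rightarrow> real" where "F = indicator U"
  have F: "\<forall>x\<in>mspace S. 0 \<le> F x" by (simp add: F_def)
  have "(\<lambda>\<omega>. F (X \<omega>)) \<in> borel_measurable M"
  proof (rule borel_measurable_LIMSEQ_real)
    fix k
    show "(\<lambda>\<omega>. inf_convolution S k F (X \<omega>)) \<in> borel_measurable M"
    proof (rule meas[OF inf_convolution_lipschitz[OF F]])
      fix x assume "x \<in> mspace S"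
      moreover from this have "F x \<le> 1" by (simp add: F_def)
      ultimately show "\<bar>inf_convolution S k F x\<bar> \<le> 1"
        using inf_convolution_lower[OF F, of x k] inf_convolution_le_self[OF F, of x k] by auto
    qed
  next
    fix \<omega> assume "\<omega> \<in> space M"
    then have x: "X \<omega> \<in> mspace S" using X by auto
    show "(\<lambda>k. inf_convolution S k F (X \<omega>)) \<longlonglongrightarrow> F (X \<omega>)"
    proof (rule inf_convolution_tendsto[OF F x])
      fix e :: real assume e: "0 < e"
      show "\<exists>r>0. \<forall>y\<in>mspace S. mdist S (X \<omega>) y < r \<longrightarrow> F (X \<omega>) - e \<le> F y"
      proof (cases "X \<omega> \<in> U")
        case True
        then obtain r where "r > 0" "mball (X \<omega>) r \<subseteq> U" using Uo by (auto simp: openin_mtopology)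
        then show ?thesis using x e by (intro exI[of _ r]) (auto simp: F_def in_mball subset_iff indicator_def)
      next
        case False
        then show ?thesis using e by (intro exI[of _ 1]) (auto simp: F_def indicator_def)
      qed
    qed
  qed
  then have "(\<lambda>\<omega>. F (X \<omega>)) -` {1} \<inter> space M \<in> sets M" by (rule measurable_sets) simp
  moreover have "(\<lambda>\<omega>. F (X \<omega>)) -` {1} \<inter> space M = X -` U \<inter> space M"
    by (auto simp: F_def indicator_def)
  ultimately show "X -` U \<inter> space M \<in> sets M" by simp
qed

lemma tendsto_gt_ltI:
  fixes f :: "nat \<Rightarrow> real"
  assumes "\<And>e. 0 < e \<Longrightarrow> \<forall>\<^sub>F n in sequentially. l - e < f n" "\<And>e. 0 < e \<Longrightarrow> \<forall>\<^sub>F n in sequentially. f n < l + e"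
  shows "f \<longlonglongrightarrow> l"
proof (rule tendstoI)
  fix e :: real assume e: "0 < e"
  from assms(1)[OF e] assms(2)[OF e] show "\<forall>\<^sub>F n in sequentially. dist (f n) l < e"
    by eventually_elim (auto simp: dist_real_def)
qed

text \<open>Lipschitz minorants lie below \<open>F\<close> and, by dominated convergence, nearly
  have its integral at the limit. This gives the lower half of the convergence; applying it to
  \<open>- F\<close> gives the upper half.\<close>

lemma converges_in_law_lipschitzI:
  assumes M: "\<And>n. prob_space (M n)" and N: "prob_space N"
    and X: "\<And>n. X n \<in> measurable (M n) (borel_sigma (mtopology_of S))"
    and Y: "Y \<in> measurable N (borel_sigma (mtopology_of S))"
    and lim: "\<And>F k b. metric_lipschitz S k F \<Longrightarrow> (\<And>x. x \<in> mspace S \<Longrightarrow> \<bar>F x\<bar> \<le> b) \<Longrightarrow>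
      (\<lambda>n. LINT \<omega>|M n. F (X n \<omega>)) \<longlonglongrightarrow> (LINT \<omega>|N. F (Y \<omega>))"
  shows "converges_in_law (mtopology_of S) M X N Y"
proof -
  interpret N: prob_space N by (rule N)
  have Xm: "X n \<omega> \<in> mspace S" if "\<omega> \<in> space (M n)" for n \<omega>
    using X[of n] that by (auto simp: measurable_borel_sigma_iff)
  have Ym: "Y \<omega> \<in> mspace S" if "\<omega> \<in> space N" for \<omega>
    using Y that by (auto simp: measurable_borel_sigma_iff)
  have half: "\<forall>\<^sub>F n in sequentially. (LINT \<omega>|N. F (Y \<omega>)) - e < (LINT \<omega>|M n. F (X n \<omega>))"
    if F: "continuous_map (mtopology_of S) euclideanreal F" and b: "\<And>x. x \<in> mspace S \<Longrightarrow> \<bar>F x\<bar> \<le> b" and e: "0 < e"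
    for F b e
  proof -
    have lo: "\<forall>x\<in>mspace S. - b \<le> F x" using b by (force simp: abs_le_iff)
    have reg_b: "\<bar>inf_convolution S k F x\<bar> \<le> b" if "x \<in> mspace S" for x k
      using inf_convolution_lower[OF lo that, where k=k] inf_convolution_le_self[OF lo that, where k=k]
        b[OF that] by auto
    have reg_l: "metric_lipschitz S (real k) (inf_convolution S k F)" for k
      by (rule inf_convolution_lipschitz[OF lo])
    have meas: "(\<lambda>\<omega>. inf_convolution S k F (Y \<omega>)) \<in> borel_measurable N"
      "(\<lambda>\<omega>. inf_convolution S k F (X n \<omega>)) \<in> borel_measurable (M n)" for k n
      by (intro measurable_continuous_map_borel_sigma[OF Y] measurable_continuous_map_borel_sigma[OF X]
            metric_lipschitz_continuous_map[OF reg_l])+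
    have "(\<lambda>k. LINT \<omega>|N. inf_convolution S k F (Y \<omega>)) \<longlonglongrightarrow> (LINT \<omega>|N. F (Y \<omega>))"
    proof (rule integral_dominated_convergence[where w="\<lambda>_. b"])
      show "AE \<omega> in N. (\<lambda>k. inf_convolution S k F (Y \<omega>)) \<longlonglongrightarrow> F (Y \<omega>)"
      proof (intro AE_I2 inf_convolution_tendsto[OF lo Ym])
        fix \<omega> e :: real and w assume w: "w \<in> space N" and "0 < e"
        interpret Metric_space "mspace S" "mdist S" by simp
        have "openin mtopology {x \<in> mspace S. F x \<in> {F (Y w) - e <..}}"
          using F by (intro openin_continuous_map_preimage[where Y=euclideanreal, of mtopology F, simplified])
            (auto simp: mtopology_of_def)
        then obtain r where "r > 0" "mball (Y w) r \<subseteq> {x \<in> mspace S. F x \<in> {F (Y w) - e <..}}"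
          using Ym[OF w] \<open>0 < e\<close> by (auto simp: openin_mtopology)
        then show "\<exists>r>0. \<forall>y\<in>mspace S. mdist S (Y w) y < r \<longrightarrow> F (Y w) - e \<le> F y"
          by (intro exI[of _ r]) (use Ym[OF w] in \<open>force simp: subset_iff in_mball\<close>)
      qed
      show "AE \<omega> in N. norm (inf_convolution S k F (Y \<omega>)) \<le> b" for k
        using reg_b Ym by (intro AE_I2) auto
    qed (use meas measurable_continuous_map_borel_sigma[OF Y F] in auto)
    from LIMSEQ_D[OF this, of "e / 2"] e obtain k where
      "norm ((LINT \<omega>|N. inf_convolution S k F (Y \<omega>)) - (LINT \<omega>|N. F (Y \<omega>))) < e / 2" by auto
    then have k: "(LINT \<omega>|N. F (Y \<omega>)) - e / 2 < (LINT \<omega>|N. inf_convolution S k F (Y \<omega>))"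
      by (simp add: abs_if split: if_splits)
    have "\<forall>\<^sub>F n in sequentially. (LINT \<omega>|N. inf_convolution S k F (Y \<omega>)) - e / 2
        < (LINT \<omega>|M n. inf_convolution S k F (X n \<omega>))"
      using lim[OF reg_l reg_b] e by (intro order_tendstoD(1)) auto
    then show ?thesis
    proof eventually_elim
      case (elim n)
      interpret Mn: prob_space "M n" by (rule M)
      have "(LINT \<omega>|M n. inf_convolution S k F (X n \<omega>)) \<le> (LINT \<omega>|M n. F (X n \<omega>))"
      proof (rule integral_mono)
        show "integrable (M n) (\<lambda>\<omega>. inf_convolution S k F (X n \<omega>))"
          using reg_b Xm meas by (intro Mn.integrable_const_bound[where B=b]) auto
        show "integrable (M n) (\<lambda>\<omega>. F (X n \<omega>))"
          using b Xm measurable_continuous_map_borel_sigma[OF X F]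
          by (intro Mn.integrable_const_bound[where B=b]) auto
        show "inf_convolution S k F (X n \<omega>) \<le> F (X n \<omega>)" if "\<omega> \<in> space (M n)" for \<omega>
          using inf_convolution_le_self[OF lo Xm[OF that]] .
      qed
      then show ?case using elim k by linarith
    qed
  qed
  show ?thesis
    unfolding converges_in_law_def
  proof (intro conjI allI impI)
    fix F assume F: "continuous_map (mtopology_of S) euclideanreal F \<and> bounded (F ` topspace (mtopology_of S))"
    then obtain b where b: "\<And>x. x \<in> mspace S \<Longrightarrow> \<bar>F x\<bar> \<le> b" by (auto simp: bounded_iff)
    have F': "continuous_map (mtopology_of S) euclideanreal (\<lambda>x. - F x)"
      using F by (intro continuous_map_minus) auto
    show "(\<lambda>n. LINT \<omega>|M n. F (X n \<omega>)) \<longlonglongrightarrow> (LINT \<omega>|N. F (Y \<omega>))"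
    proof (rule tendsto_gt_ltI)
      fix e :: real assume e: "0 < e"
      show "\<forall>\<^sub>F n in sequentially. (LINT \<omega>|N. F (Y \<omega>)) - e < (LINT \<omega>|M n. F (X n \<omega>))"
        using F b e by (intro half[of F b]) auto
      show "\<forall>\<^sub>F n in sequentially. (LINT \<omega>|M n. F (X n \<omega>)) < (LINT \<omega>|N. F (Y \<omega>)) + e"
        using half[OF F' _ e, of b] b by (auto elim!: eventually_mono)
    qed
  qed (use X Y in auto)
qed

section \<open>Convergence in law of continuous processes\<close>

text \<open>\<open>\<Phi>\<close> takes total functions, and the bound forces it to depend on the
  coordinates in \<open>J\<close> only. Whole paths can thus be inserted without restricting them to
  \<open>J\<close>.\<close>

definition coord_lipschitz :: "'i set \<Rightarrow> real \<Rightarrow> (('i \<Rightarrow> real) \<Rightarrow> real) \<Rightarrow> bool"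
  where "coord_lipschitz J k \<Phi> \<longleftrightarrow> (\<forall>x y. \<bar>\<Phi> x - \<Phi> y\<bar> \<le> k * (\<Sum>c\<in>J. \<bar>x c - y c\<bar>))"

lemma coord_lipschitzD: "coord_lipschitz J k \<Phi> \<Longrightarrow> \<bar>\<Phi> x - \<Phi> y\<bar> \<le> k * (\<Sum>c\<in>J. \<bar>x c - y c\<bar>)"
  by (auto simp: coord_lipschitz_def)

lemma coord_lipschitz_cong:
  "coord_lipschitz J k \<Phi> \<Longrightarrow> (\<And>c. c \<in> J \<Longrightarrow> x c = y c) \<Longrightarrow> \<Phi> x = \<Phi> y"
  using coord_lipschitzD[of J k \<Phi> x y] by simp

text \<open>Renumbering \<open>J\<close> by naturals, padded with \<open>0\<close>, moves to a
  countable product, where coordinatewise measurability implies Borel measurability. The original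
  index type may be uncountable.\<close>

lemma coord_lipschitz_factor:
  assumes J: "finite J" and \<Phi>: "coord_lipschitz J k \<Phi>"
  obtains \<Psi> :: "(nat \<Rightarrow> real) \<Rightarrow> real" and h
  where "continuous_on UNIV \<Psi>" "\<And>i. i < card J \<Longrightarrow> h i \<in> J"
    "\<And>x. \<Phi> x = \<Psi> (\<lambda>i. if i < card J then x (h i) else 0)"
proof -
  obtain h where h: "bij_betw h {0..<card J} J" using ex_bij_betw_nat_finite[OF J] by blast
  define g where "g = inv_into {0..<card J} h"
  have g: "g c < card J" "h (g c) = c" if "c \<in> J" for c
    using bij_betw_inv_into_right[OF h that] inv_into_into[of c h "{0..<card J}"] h that
    by (auto simp: g_def bij_betw_def)
  define \<Psi> where "\<Psi> = (\<lambda>y::nat \<Rightarrow> real. \<Phi> (\<lambda>c. y (g c)))"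
  have "(\<Psi> \<longlongrightarrow> \<Psi> z) (at z)" for z
  proof (rule LIM_zero_cancel, rule Lim_null_comparison)
    show "\<forall>\<^sub>F y in at z. norm (\<Psi> y - \<Psi> z) \<le> k * (\<Sum>c\<in>J. \<bar>y (g c) - z (g c)\<bar>)"
      using coord_lipschitzD[OF \<Phi>] by (intro always_eventually) (simp add: \<Psi>_def)
    have "continuous_on UNIV (\<lambda>y::nat \<Rightarrow> real. k * (\<Sum>c\<in>J. \<bar>y (g c) - z (g c)\<bar>))"
      by (intro continuous_intros continuous_on_product_coordinates)
    then have "isCont (\<lambda>y::nat \<Rightarrow> real. k * (\<Sum>c\<in>J. \<bar>y (g c) - z (g c)\<bar>)) z"
      by (simp add: continuous_on_eq_continuous_at)
    then show "((\<lambda>y. k * (\<Sum>c\<in>J. \<bar>y (g c) - z (g c)\<bar>)) \<longlongrightarrow> 0) (at z)"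
      by (simp add: isCont_def)
  qed
  then have "continuous_on UNIV \<Psi>" by (simp add: continuous_on_def)
  moreover have "h i \<in> J" if "i < card J" for i using h that by (auto simp: bij_betw_def)
  moreover have "\<Phi> x = \<Psi> (\<lambda>i. if i < card J then x (h i) else 0)" for x
    unfolding \<Psi>_def by (rule coord_lipschitz_cong[OF \<Phi>]) (simp add: g)
  ultimately show ?thesis by (rule that)
qed

lemma coord_lipschitz_measurable:
  assumes J: "finite J" and \<Phi>: "coord_lipschitz J k \<Phi>"
    and Y: "\<And>c. c \<in> J \<Longrightarrow> (\<lambda>\<omega>. Y \<omega> c) \<in> borel_measurable M"
  shows "(\<lambda>\<omega>. \<Phi> (Y \<omega>)) \<in> borel_measurable M"
proof -
  obtain \<Psi> h where \<Psi>: "continuous_on UNIV (\<Psi> :: (nat \<Rightarrow> real) \<Rightarrow> real)" "\<And>i. i < card J \<Longrightarrow> h i \<in> J"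
    "\<And>x. \<Phi> x = \<Psi> (\<lambda>i. if i < card J then x (h i) else 0)"
    using coord_lipschitz_factor[OF J \<Phi>] by metis
  have "(\<lambda>\<omega> i. if i < card J then Y \<omega> (h i) else 0) \<in> borel_measurable M"
  proof (rule measurable_coordinatewise_then_product)
    fix i show "(\<lambda>\<omega>. if i < card J then Y \<omega> (h i) else 0) \<in> borel_measurable M"
      using Y \<Psi>(2) by (cases "i < card J") auto
  qed
  from measurable_compose[OF this borel_measurable_continuous_onI[OF \<Psi>(1)]]
  show ?thesis by (simp add: \<Psi>(3))
qed

lemma coord_lipschitz_converges_in_law:
  assumes J: "finite J" and \<Phi>: "coord_lipschitz J k \<Phi>" and b: "\<And>x. \<bar>\<Phi> x\<bar> \<le> b"
    and conv: "converges_in_law (powertop_real J) M (\<lambda>n \<omega>. restrict (X n \<omega>) J) N (\<lambda>\<omega>. restrict (Y \<omega>) J)"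
  shows "(\<lambda>n. LINT \<omega>|M n. \<Phi> (X n \<omega>)) \<longlonglongrightarrow> (LINT \<omega>|N. \<Phi> (Y \<omega>))"
proof -
  obtain \<Psi> h where \<Psi>: "continuous_on UNIV (\<Psi> :: (nat \<Rightarrow> real) \<Rightarrow> real)" "\<And>i. i < card J \<Longrightarrow> h i \<in> J"
    "\<And>x. \<Phi> x = \<Psi> (\<lambda>i. if i < card J then x (h i) else 0)"
    using coord_lipschitz_factor[OF J \<Phi>] by metis
  have "continuous_map (powertop_real J) (powertop_real UNIV) (\<lambda>x i. if i < card J then x (h i) else 0)"
    unfolding continuous_map_componentwise_UNIV
  proof
    fix i show "continuous_map (powertop_real J) euclideanreal (\<lambda>x. if i < card J then x (h i) else 0)"
      using \<Psi>(2) by (cases "i < card J") (auto intro: continuous_map_product_projection)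
  qed
  then have "continuous_map (powertop_real J) euclideanreal (\<Psi> \<circ> (\<lambda>x i. if i < card J then x (h i) else 0))"
    by (rule continuous_map_compose) (use \<Psi>(1) in \<open>simp add: euclidean_product_topology\<close>)
  then have "continuous_map (powertop_real J) euclideanreal \<Phi>"
    by (simp add: o_def \<Psi>(3)[symmetric] cong: if_cong)
  moreover have "bounded (\<Phi> ` topspace (powertop_real J))" using b by (auto simp: bounded_iff)
  ultimately have "(\<lambda>n. LINT \<omega>|M n. \<Phi> (restrict (X n \<omega>) J)) \<longlonglongrightarrow> (LINT \<omega>|N. \<Phi> (restrict (Y \<omega>) J))"
    using conv by (auto simp: converges_in_law_def)
  moreover have "\<Phi> (restrict x J) = \<Phi> x" for x by (rule coord_lipschitz_cong[OF \<Phi>]) simp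
  ultimately show ?thesis by simp
qed

section \<open>Oscillations of paths over finite parameter sets\<close>

definition oscillation :: "real \<Rightarrow> 'i::metric_space set \<Rightarrow> ('i \<Rightarrow> real) \<Rightarrow> real"
  where "oscillation \<delta> J x = Max (insert 0 ((\<lambda>(s, t). \<bar>x s - x t\<bar>) ` {(s, t) \<in> J \<times> J. dist s t < \<delta>}))"

lemma finite_close_pairs: "finite J \<Longrightarrow> finite {(s, t) \<in> J \<times> J. dist s t < \<delta>}"
  by (rule finite_subset[of _ "J \<times> J"]) auto

lemma oscillation_nonneg: "finite J \<Longrightarrow> 0 \<le> oscillation \<delta> J x"
  using finite_close_pairs[of J \<delta>] by (simp add: oscillation_def)

lemma oscillation_ge:
  assumes "finite J" "s \<in> J" "t \<in> J" "dist s t < \<delta>" shows "\<bar>x s - x t\<bar> \<le> oscillation \<delta> J x"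
  unfolding oscillation_def using assms finite_close_pairs[of J \<delta>] by (intro Max_ge) auto

lemma oscillation_le:
  assumes "finite J" "0 \<le> b" "\<And>s t. s \<in> J \<Longrightarrow> t \<in> J \<Longrightarrow> dist s t < \<delta> \<Longrightarrow> \<bar>x s - x t\<bar> \<le> b"
  shows "oscillation \<delta> J x \<le> b"
  unfolding oscillation_def using assms finite_close_pairs[of J \<delta>] by (subst Max_le_iff) auto

lemma oscillation_mono: "finite J' \<Longrightarrow> J \<subseteq> J' \<Longrightarrow> oscillation \<delta> J x \<le> oscillation \<delta> J' x"
  by (intro oscillation_le oscillation_nonneg oscillation_ge) (auto intro: finite_subset)

text \<open>Each difference involves two coordinates, whence the constant 2. Truncation at 1 makes
  the oscillation a bounded test function, so finite dimensional convergence applies to it.\<close>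

lemma oscillation_lipschitz:
  assumes J: "finite J" shows "coord_lipschitz J 2 (\<lambda>x. min 1 (oscillation \<delta> J x))"
proof -
  have "oscillation \<delta> J x \<le> oscillation \<delta> J y + 2 * (\<Sum>c\<in>J. \<bar>x c - y c\<bar>)" for x y :: "'a \<Rightarrow> real"
  proof (rule oscillation_le[OF J])
    show "0 \<le> oscillation \<delta> J y + 2 * (\<Sum>c\<in>J. \<bar>x c - y c\<bar>)"
      using oscillation_nonneg[OF J, of \<delta> y] by (intro add_nonneg_nonneg mult_nonneg_nonneg sum_nonneg) auto
    fix s t assume st: "s \<in> J" "t \<in> J" "dist s t < \<delta>"
    have "\<bar>x c - y c\<bar> \<le> (\<Sum>c\<in>J. \<bar>x c - y c\<bar>)" if "c \<in> J" for c
      using that J by (intro member_le_sum[of c J "\<lambda>c. \<bar>x c - y c\<bar>"]) auto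
    from this[OF st(1)] this[OF st(2)] oscillation_ge[OF J st, of y]
    show "\<bar>x s - x t\<bar> \<le> oscillation \<delta> J y + 2 * (\<Sum>c\<in>J. \<bar>x c - y c\<bar>)" by linarith
  qed
  note osc_le = this
  have le: "min 1 (oscillation \<delta> J x) \<le> min 1 (oscillation \<delta> J y) + 2 * (\<Sum>c\<in>J. \<bar>x c - y c\<bar>)"
    for x y :: "'a \<Rightarrow> real"
  proof -
    have "min 1 p \<le> min 1 q + 2 * r" if "p \<le> q + 2 * r" "0 \<le> r" for p q r :: real
      using that by (simp add: min_def)
    then show ?thesis using osc_le[of x y] by (simp add: sum_nonneg)
  qed
  show ?thesis
    unfolding coord_lipschitz_def
  proof (intro allI)
    fix x y :: "'a \<Rightarrow> real"
    have "(\<Sum>c\<in>J. \<bar>y c - x c\<bar>) = (\<Sum>c\<in>J. \<bar>x c - y c\<bar>)" by (simp add: abs_minus_commute)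
    then show "\<bar>min 1 (oscillation \<delta> J x) - min 1 (oscillation \<delta> J y)\<bar> \<le> 2 * (\<Sum>c\<in>J. \<bar>x c - y c\<bar>)"
      using le[of x y] le[of y x] by (simp add: abs_le_iff)
  qed
qed

section \<open>Interpolation of continuous functions on finite nets\<close>

lemma mspace_Cspace: "compact K \<Longrightarrow> mspace (Cspace K) = {x. x \<in> extensional K \<and> continuous_on K x}"
  unfolding Cspace_def by (subst compactin_mspace_cfunspace) (auto simp: compactin_subtopology)

lemma mdist_Cspace_le:
  "0 \<le> b \<Longrightarrow> (\<And>t. t \<in> K \<Longrightarrow> \<bar>x t - y t\<bar> \<le> b) \<Longrightarrow> mdist (Cspace K) x y \<le> b"
  unfolding Cspace_def by (rule mdist_cfunspace_le) (auto simp: dist_real_def)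

text \<open>A tent of radius \<delta> around \<open>c\<close>. Over a \<delta>-net the tents have
  positive sum everywhere on \<open>K\<close>, and normalising by it yields the partition of unity
  behind \<open>interpolation\<close>.\<close>

definition net_weight :: "real \<Rightarrow> 'i::metric_space \<Rightarrow> 'i \<Rightarrow> real"
  where "net_weight \<delta> c t = max 0 (\<delta> - dist t c)"

definition interpolation ::
  "'i::metric_space set \<Rightarrow> real \<Rightarrow> 'i set \<Rightarrow> ('i \<Rightarrow> real) \<Rightarrow> 'i \<Rightarrow> real"
  where "interpolation K \<delta> D x =
    (\<lambda>t\<in>K. (\<Sum>c\<in>D. net_weight \<delta> c t * x c) / (\<Sum>c\<in>D. net_weight \<delta> c t))"

locale net =
  fixes K :: "(real ^ 'n) set" and \<delta> :: real and D :: "(real ^ 'n) set"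
  assumes compact: "compact K" and D: "finite D" "D \<subseteq> K" and cover: "K \<subseteq> (\<Union>c\<in>D. ball c \<delta>)"
begin

lemma total_weight_pos: assumes "t \<in> K" shows "0 < (\<Sum>c\<in>D. net_weight \<delta> c t)"
proof -
  obtain c where "c \<in> D" "dist c t < \<delta>" using cover assms by auto
  then show ?thesis
    using D by (intro sum_pos2[of D c]) (auto simp: net_weight_def dist_commute)
qed

text \<open>The interpolated value is a convex combination of those \<open>x c\<close> with
  \<open>c\<close> closer to \<open>t\<close> than \<delta>. With \<open>z = x t\<close> this is the
  approximation error; with \<open>z = 0\<close> it gives the Lipschitz dependence on the values at
  the net.\<close>

lemma interpolation_diff_le:
  assumes t: "t \<in> K" and e: "\<And>c. c \<in> D \<Longrightarrow> dist t c < \<delta> \<Longrightarrow> \<bar>x c - z\<bar> \<le> e"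
  shows "\<bar>interpolation K \<delta> D x t - z\<bar> \<le> e"
proof -
  define w where "w = (\<Sum>c\<in>D. net_weight \<delta> c t)"
  have w: "0 < w" unfolding w_def by (rule total_weight_pos[OF t])
  have "interpolation K \<delta> D x t - z = (\<Sum>c\<in>D. net_weight \<delta> c t * (x c - z)) / w"
    using w t unfolding interpolation_def w_def[symmetric]
    by (simp add: right_diff_distrib sum_subtractf diff_divide_distrib w_def[symmetric] flip: sum_distrib_right)
  moreover have "\<bar>\<Sum>c\<in>D. net_weight \<delta> c t * (x c - z)\<bar> \<le> (\<Sum>c\<in>D. net_weight \<delta> c t * e)"
  proof (intro order_trans[OF sum_abs] sum_mono)
    fix c assume "c \<in> D"
    then show "\<bar>net_weight \<delta> c t * (x c - z)\<bar> \<le> net_weight \<delta> c t * e"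
      using e[of c] by (cases "dist t c < \<delta>") (auto simp: net_weight_def abs_mult intro!: mult_left_mono)
  qed
  then have "\<bar>\<Sum>c\<in>D. net_weight \<delta> c t * (x c - z)\<bar> \<le> w * e" by (simp add: w_def sum_distrib_right)
  ultimately show ?thesis using w by (simp add: abs_divide divide_le_eq mult.commute)
qed

lemma interpolation_mspace: "interpolation K \<delta> D x \<in> mspace (Cspace K)"
proof -
  have "continuous_on K (\<lambda>t. (\<Sum>c\<in>D. net_weight \<delta> c t * x c) / (\<Sum>c\<in>D. net_weight \<delta> c t))"
    using total_weight_pos unfolding net_weight_def by (intro continuous_intros) fastforce+
  then have "continuous_on K (interpolation K \<delta> D x)"
    by (rule continuous_on_eq) (simp add: interpolation_def)
  then show ?thesis by (simp add: mspace_Cspace compact interpolation_def)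
qed

lemma mdist_interpolation:
  "mdist (Cspace K) (interpolation K \<delta> D x) (interpolation K \<delta> D y) \<le> (\<Sum>c\<in>D. \<bar>x c - y c\<bar>)"
proof (rule mdist_Cspace_le)
  fix t assume t: "t \<in> K"
  have "interpolation K \<delta> D x t - interpolation K \<delta> D y t = interpolation K \<delta> D (\<lambda>c. x c - y c) t - 0"
    using t by (simp add: interpolation_def right_diff_distrib sum_subtractf diff_divide_distrib)
  also have "\<bar>\<dots>\<bar> \<le> (\<Sum>c\<in>D. \<bar>x c - y c\<bar>)"
    using D by (intro interpolation_diff_le[OF t]) (auto intro: member_le_sum[of _ D "\<lambda>c. \<bar>x c - y c\<bar>"])
  finally show "\<bar>interpolation K \<delta> D x t - interpolation K \<delta> D y t\<bar> \<le> (\<Sum>c\<in>D. \<bar>x c - y c\<bar>)" .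
qed (simp add: sum_nonneg)

lemma lipschitz_interpolation:
  assumes "metric_lipschitz (Cspace K) k F" "0 \<le> k"
  shows "coord_lipschitz D k (\<lambda>x. F (interpolation K \<delta> D x))"
  unfolding coord_lipschitz_def
proof (intro allI)
  fix x y
  have "\<bar>F (interpolation K \<delta> D x) - F (interpolation K \<delta> D y)\<bar>
      \<le> k * mdist (Cspace K) (interpolation K \<delta> D x) (interpolation K \<delta> D y)"
    using assms interpolation_mspace by (auto simp: metric_lipschitz_def)
  also have "\<dots> \<le> k * (\<Sum>c\<in>D. \<bar>x c - y c\<bar>)"
    using assms mdist_interpolation by (intro mult_left_mono)
  finally show "\<bar>F (interpolation K \<delta> D x) - F (interpolation K \<delta> D y)\<bar> \<le> k * (\<Sum>c\<in>D. \<bar>x c - y c\<bar>)" .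
qed

end

lemma net_exists:
  fixes K :: "(real ^ 'n) set"
  assumes "compact K" "0 < \<delta>" obtains D where "net K \<delta> D"
proof -
  obtain D where "finite D" "D \<subseteq> K" "K \<subseteq> (\<Union>c\<in>D. ball c \<delta>)"
    using assms by (elim compactE_image[of K K "\<lambda>c. ball c \<delta>"]) auto
  then show ?thesis using assms by (intro that) (auto simp: net_def)
qed

lemma metric_lipschitz_mono:
  "metric_lipschitz S k F \<Longrightarrow> k \<le> k' \<Longrightarrow> metric_lipschitz S k' F"
  unfolding metric_lipschitz_def by (meson mdist_nonneg mult_right_mono order_trans)

text \<open>By uniform continuity each path is the uniform limit of its interpolations on finer and
  finer nets, and a Lipschitz functional of an interpolation depends on finitely many coordinates
  only.\<close>

lemma measurable_Cspace:
  fixes K :: "(real ^ 'n) set"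
  assumes K: "compact K" and Z: "\<And>\<omega>. \<omega> \<in> space M \<Longrightarrow> Z \<omega> \<in> mspace (Cspace K)"
    and meas: "\<And>t. t \<in> K \<Longrightarrow> (\<lambda>\<omega>. Z \<omega> t) \<in> borel_measurable M"
  shows "Z \<in> measurable M (borel_sigma (mtopology_of (Cspace K)))"
proof (rule measurable_borel_sigma_lipschitz)
  show "Z \<in> space M \<rightarrow> mspace (Cspace K)" using Z by auto
  fix F :: "(real ^ 'n \<Rightarrow> real) \<Rightarrow> real" and k b assume F0: "metric_lipschitz (Cspace K) k F"
  define k' where "k' = max 0 k"
  have F: "metric_lipschitz (Cspace K) k' F" and k': "0 \<le> k'"
    using metric_lipschitz_mono[OF F0] by (auto simp: k'_def)
  have "\<exists>D. net K (1 / Suc i) D" for i using net_exists[OF K, of "1 / Suc i"] by (metis of_nat_0_less_iff zero_less_Suc zero_less_divide_1_iff)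
  then obtain D where D: "\<And>i. net K (1 / Suc i) (D i)" by metis
  define P where "P = (\<lambda>i. interpolation K (1 / Suc i) (D i))"
  show "(\<lambda>\<omega>. F (Z \<omega>)) \<in> borel_measurable M"
  proof (rule borel_measurable_LIMSEQ_real)
    fix i
    show "(\<lambda>\<omega>. F (P i (Z \<omega>))) \<in> borel_measurable M"
      unfolding P_def using net.D[OF D[of i]]
      by (intro coord_lipschitz_measurable[OF _ net.lipschitz_interpolation[OF D F k']] meas) auto
  next
    fix \<omega> assume \<omega>: "\<omega> \<in> space M"
    have "uniformly_continuous_on K (Z \<omega>)"
      using Z[OF \<omega>] K by (intro compact_uniformly_continuous) (auto simp: mspace_Cspace)
    have "(\<lambda>i. mdist (Cspace K) (P i (Z \<omega>)) (Z \<omega>)) \<longlonglongrightarrow> 0"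
    proof (rule LIMSEQ_I)
      fix e :: real assume e: "0 < e"
      then obtain r where r: "r > 0" "\<And>s t. s \<in> K \<Longrightarrow> t \<in> K \<Longrightarrow> dist s t < r \<Longrightarrow> \<bar>Z \<omega> s - Z \<omega> t\<bar> < e / 2"
        using \<open>uniformly_continuous_on K (Z \<omega>)\<close>
        unfolding uniformly_continuous_on_def dist_real_def by (metis half_gt_zero)
      obtain i0 where i0: "1 / Suc i0 < r" using nat_approx_posE[OF r(1)] by blast
      show "\<exists>i0. \<forall>i\<ge>i0. norm (mdist (Cspace K) (P i (Z \<omega>)) (Z \<omega>) - 0) < e"
      proof (intro exI allI impI)
        fix i assume "i0 \<le> i"
        then have "1 / Suc i \<le> 1 / Suc i0" by (intro divide_left_mono) auto
        then have i: "1 / Suc i < r" using i0 by linarith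
        have "mdist (Cspace K) (P i (Z \<omega>)) (Z \<omega>) \<le> e / 2"
        proof (rule mdist_Cspace_le)
          fix t assume t: "t \<in> K"
          show "\<bar>P i (Z \<omega>) t - Z \<omega> t\<bar> \<le> e / 2"
            unfolding P_def
          proof (rule net.interpolation_diff_le[OF D t])
            fix c assume "c \<in> D i" "dist t c < 1 / Suc i"
            then show "\<bar>Z \<omega> c - Z \<omega> t\<bar> \<le> e / 2"
              using r(2)[of c t] net.D(2)[OF D[of i]] t i by (force simp: dist_commute)
          qed
        qed (use e in auto)
        then show "norm (mdist (Cspace K) (P i (Z \<omega>)) (Z \<omega>) - 0) < e" using e by simp
      qed
    qed
    then have lim: "(\<lambda>i. k' * mdist (Cspace K) (P i (Z \<omega>)) (Z \<omega>)) \<longlonglongrightarrow> 0"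
      using tendsto_mult_right_zero by blast
    show "(\<lambda>i. F (P i (Z \<omega>))) \<longlonglongrightarrow> F (Z \<omega>)"
    proof (rule LIM_zero_cancel, rule Lim_null_comparison[OF _ lim], rule always_eventually, rule allI)
      fix i
      show "norm (F (P i (Z \<omega>)) - F (Z \<omega>)) \<le> k' * mdist (Cspace K) (P i (Z \<omega>)) (Z \<omega>)"
        using F Z[OF \<omega>] net.interpolation_mspace[OF D[of i]] by (auto simp: metric_lipschitz_def P_def)
    qed
  qed
qed

text \<open>The supremum over \<open>K\<close> is reached along finite sets exhausting a countable dense subset of \<open>K\<close>,
  so that only oscillations over finite sets, which are expressible by finite dimensional
  distributions, need to be controlled.\<close>

lemma (in net) integral_interpolation_error:
  fixes F :: "(real ^ 'n \<Rightarrow> real) \<Rightarrow> real"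
  assumes "prob_space M" and Z: "\<And>\<omega>. \<omega> \<in> space M \<Longrightarrow> Z \<omega> \<in> mspace (Cspace K)"
    and meas: "\<And>t. t \<in> K \<Longrightarrow> (\<lambda>\<omega>. Z \<omega> t) \<in> borel_measurable M"
    and osc: "\<And>J. finite J \<Longrightarrow> J \<subseteq> K \<Longrightarrow> (\<integral>\<^sup>+\<omega>. ennreal (min 1 (oscillation \<delta> J (Z \<omega>))) \<partial>M) \<le> ennreal e"
    and F: "metric_lipschitz (Cspace K) k F" and k: "0 \<le> k"
    and b: "\<And>x. x \<in> mspace (Cspace K) \<Longrightarrow> \<bar>F x\<bar> \<le> b" and e: "0 \<le> e"
  shows "\<bar>(LINT \<omega>|M. F (Z \<omega>)) - (LINT \<omega>|M. F (interpolation K \<delta> D (Z \<omega>)))\<bar> \<le> (2 * b + k) * e"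
proof -
  interpret prob_space M by fact
  obtain T where T: "countable T" "T \<subseteq> K" "K \<subseteq> closure T" using separable by blast
  have clT: "closure T = K" using T compact by (metis closure_minimal compact_imp_closed subset_antisym)
  \<comment> \<open>The net is included so that a net point and a dense point nearby form a pair
    seen by the oscillation. The case distinction is there because \<open>from_nat_into\<close>
    yields no element of an empty set.\<close>
  define J where "J = (\<lambda>i. D \<union> (if T = {} then {} else from_nat_into T ` {..i::nat}))"
  have J: "finite (J i)" "J i \<subseteq> K" "D \<subseteq> J i" for i
    using D T(2) from_nat_into[of T] by (auto simp: J_def)
  have incJ: "J i \<subseteq> J j" if "i \<le> j" for i j using that by (auto simp: J_def)
  define P where "P = interpolation K \<delta> D"
  define f where "f = (\<lambda>i \<omega>. ennreal (min 1 (oscillation \<delta> (J i) (Z \<omega>))))"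
  define U where "U = (\<lambda>\<omega>. SUP i. f i \<omega>)"
  have f_meas [measurable]: "f i \<in> borel_measurable M" for i
    unfolding f_def using J(2)[of i]
    by (intro measurable_compose[OF _ measurable_ennreal]
          coord_lipschitz_measurable[OF J(1) oscillation_lipschitz[OF J(1)]] meas) auto
  have U1: "U \<omega> \<le> 1" for \<omega> unfolding U_def f_def by (intro SUP_least) (simp add: min.coboundedI1 flip: ennreal_1)
  have "incseq f"
    unfolding f_def incseq_def le_fun_def
    by (intro allI impI ennreal_leI min.mono order_refl oscillation_mono J incJ)
  then have "(\<integral>\<^sup>+\<omega>. U \<omega> \<partial>M) = (SUP i. \<integral>\<^sup>+\<omega>. f i \<omega> \<partial>M)"
    unfolding U_def by (intro nn_integral_monotone_convergence_SUP) auto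
  also have "\<dots> \<le> ennreal e" unfolding f_def using osc J by (intro SUP_least) auto
  finally have U_int: "(\<integral>\<^sup>+\<omega>. U \<omega> \<partial>M) \<le> ennreal e" .
  have b0: "0 \<le> b" using b[OF interpolation_mspace] by (meson abs_ge_zero order_trans)
  have bound: "ennreal (norm (F (Z \<omega>) - F (P (Z \<omega>)))) \<le> ennreal (2 * b + k) * U \<omega>" if \<omega>: "\<omega> \<in> space M" for \<omega>
  proof -
    define u where "u = enn2real (U \<omega>)"
    have U: "U \<omega> = ennreal u" and u: "0 \<le> u" "u \<le> 1"
      using U1[of \<omega>] by (auto simp: u_def ennreal_enn2real_if top_unique enn2real_leI)
    have ZP: "Z \<omega> \<in> mspace (Cspace K)" "P (Z \<omega>) \<in> mspace (Cspace K)"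
      using Z[OF \<omega>] interpolation_mspace by (auto simp: P_def)
    have T_le: "min 1 \<bar>P (Z \<omega>) s - Z \<omega> s\<bar> \<le> u" if s: "s \<in> T" for s
    proof -
      obtain i where i: "s = from_nat_into T i" using from_nat_into_surj[OF T(1) s] by metis
      have sJ: "s \<in> J i" using s i by (auto simp: J_def)
      have "\<bar>P (Z \<omega>) s - Z \<omega> s\<bar> \<le> oscillation \<delta> (J i) (Z \<omega>)"
        unfolding P_def
      proof (rule interpolation_diff_le)
        show "s \<in> K" using s T by auto
        fix c assume "c \<in> D" "dist s c < \<delta>"
        then show "\<bar>Z \<omega> c - Z \<omega> s\<bar> \<le> oscillation \<delta> (J i) (Z \<omega>)"
          using sJ J[of i] by (intro oscillation_ge) (auto simp: dist_commute)
      qed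
      then have "ennreal (min 1 \<bar>P (Z \<omega>) s - Z \<omega> s\<bar>) \<le> f i \<omega>"
        unfolding f_def by (intro ennreal_leI min.mono) auto
      also have "\<dots> \<le> ennreal u" unfolding U[symmetric] U_def by (rule SUP_upper) simp
      finally show ?thesis using u by simp
    qed
    \<comment> \<open>Both the path and its interpolation are continuous, so the bound on the dense
      set extends to \<open>K\<close>.\<close>
    have "min 1 \<bar>P (Z \<omega>) t - Z \<omega> t\<bar> \<le> u" if t: "t \<in> K" for t
    proof (rule continuous_le_on_closure[of T])
      show "continuous_on (closure T) (\<lambda>t. min 1 \<bar>P (Z \<omega>) t - Z \<omega> t\<bar>)"
        using ZP unfolding clT by (intro continuous_intros) (auto simp: mspace_Cspace compact)
    qed (use t clT T_le in auto)
    note K_le = this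
    have "\<bar>F (Z \<omega>) - F (P (Z \<omega>))\<bar> \<le> (2 * b + k) * u"
    \<comment> \<open>Below 1 the truncation is inactive and \<open>u\<close> bounds the uniform
      distance, so the Lipschitz property applies. At \<open>u = 1\<close> the trivial bound
      \<open>2 * b\<close> suffices.\<close>
    proof (cases "u < 1")
      case True
      have "mdist (Cspace K) (Z \<omega>) (P (Z \<omega>)) \<le> u"
        using K_le True u by (intro mdist_Cspace_le) (force simp: min_def abs_minus_commute split: if_splits)+
      then have "\<bar>F (Z \<omega>) - F (P (Z \<omega>))\<bar> \<le> k * u"
        using F ZP k unfolding metric_lipschitz_def by (meson mult_left_mono order_trans)
      then show ?thesis using b0 u by (simp add: distrib_right add_increasing)
    next
      case False
      then have "u = 1" using u by simp
      then show ?thesis using b[OF ZP(1)] b[OF ZP(2)] k by (simp add: abs_le_iff)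
    qed
    then have "ennreal (norm (F (Z \<omega>) - F (P (Z \<omega>)))) \<le> ennreal ((2 * b + k) * u)"
      by (intro ennreal_leI) simp
    also have "\<dots> = ennreal (2 * b + k) * ennreal u" using b0 k u by (intro ennreal_mult) auto
    finally show ?thesis by (simp only: U)
  qed
  have mF: "(\<lambda>\<omega>. F (Z \<omega>)) \<in> borel_measurable M"
    by (rule measurable_continuous_map_borel_sigma[OF measurable_Cspace[OF compact Z meas]
          metric_lipschitz_continuous_map[OF F]])
  have mP: "(\<lambda>\<omega>. F (P (Z \<omega>))) \<in> borel_measurable M"
    unfolding P_def by (rule coord_lipschitz_measurable[OF D(1) lipschitz_interpolation[OF F k] meas])
      (use D in auto)
  have iF: "integrable M (\<lambda>\<omega>. F (Z \<omega>))" using b Z mF by (intro integrable_const_bound[where B=b]) auto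
  have iP: "integrable M (\<lambda>\<omega>. F (P (Z \<omega>)))"
    using b interpolation_mspace mP by (intro integrable_const_bound[where B=b]) (auto simp: P_def)
  have "ennreal (norm (LINT \<omega>|M. F (Z \<omega>) - F (P (Z \<omega>)))) \<le> (\<integral>\<^sup>+\<omega>. ennreal (norm (F (Z \<omega>) - F (P (Z \<omega>)))) \<partial>M)"
    using iF iP by (intro integral_norm_bound_ennreal) auto
  also have "\<dots> \<le> (\<integral>\<^sup>+\<omega>. ennreal (2 * b + k) * U \<omega> \<partial>M)" by (intro nn_integral_mono bound)
  also have "\<dots> = ennreal (2 * b + k) * (\<integral>\<^sup>+\<omega>. U \<omega> \<partial>M)" unfolding U_def by (intro nn_integral_cmult) simp
  also have "\<dots> \<le> ennreal (2 * b + k) * ennreal e" by (intro mult_left_mono U_int) auto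
  also have "\<dots> = ennreal ((2 * b + k) * e)" using b0 k e by (simp add: ennreal_mult)
  finally show ?thesis using iF iP b0 k e by (simp add: P_def)
qed

text \<open>On both sides \<open>F\<close> is replaced by its value at the interpolated path, a
  Lipschitz function of finitely many coordinates to which \<open>fdd\<close> applies. The
  replacement error is controlled by oscillations, uniformly for large \<open>n\<close>.\<close>

theorem converges_in_law_Cspace:
  fixes K :: "(real ^ 'n) set"
  assumes K: "compact K" and M: "\<And>n. prob_space (M n)" and N: "prob_space N"
    and X: "\<And>n \<omega>. \<omega> \<in> space (M n) \<Longrightarrow> X n \<omega> \<in> mspace (Cspace K)"
    and Y: "\<And>\<omega>. \<omega> \<in> space N \<Longrightarrow> Y \<omega> \<in> mspace (Cspace K)"
    and mX: "\<And>n t. t \<in> K \<Longrightarrow> (\<lambda>\<omega>. X n \<omega> t) \<in> borel_measurable (M n)"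
    and mY: "\<And>t. t \<in> K \<Longrightarrow> (\<lambda>\<omega>. Y \<omega> t) \<in> borel_measurable N"
    and fdd: "\<And>J k b (\<Phi> :: (real ^ 'n \<Rightarrow> real) \<Rightarrow> real). finite J \<Longrightarrow> J \<subseteq> K \<Longrightarrow> coord_lipschitz J k \<Phi> \<Longrightarrow>
      (\<And>x. \<bar>\<Phi> x\<bar> \<le> b) \<Longrightarrow> (\<lambda>n. LINT \<omega>|M n. \<Phi> (X n \<omega>)) \<longlonglongrightarrow> (LINT \<omega>|N. \<Phi> (Y \<omega>))"
    and osc: "\<And>e. 0 < e \<Longrightarrow> \<exists>\<delta>>0. \<forall>\<^sub>F n in sequentially. \<forall>J. finite J \<and> J \<subseteq> K \<longrightarrow>
      (\<integral>\<^sup>+\<omega>. ennreal (min 1 (oscillation \<delta> J (X n \<omega>))) \<partial>M n) \<le> ennreal e"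
  shows "converges_in_law (mtopology_of (Cspace K)) M X N Y"
proof (rule converges_in_law_lipschitzI[OF M N])
  show "X n \<in> measurable (M n) (borel_sigma (mtopology_of (Cspace K)))" for n
    using measurable_Cspace[OF K X mX] .
  show "Y \<in> measurable N (borel_sigma (mtopology_of (Cspace K)))"
    using measurable_Cspace[OF K Y mY] .
  fix F :: "(real ^ 'n \<Rightarrow> real) \<Rightarrow> real" and k0 b0
  assume F0: "metric_lipschitz (Cspace K) k0 F" and b0: "\<And>x. x \<in> mspace (Cspace K) \<Longrightarrow> \<bar>F x\<bar> \<le> b0"
  \<comment> \<open>Enlarged so that \<open>2 * b + k\<close> is positive and can serve as a
    denominator.\<close>
  define k b where "k = max 0 k0" and "b = max 1 b0"
  have F: "metric_lipschitz (Cspace K) k F" and k: "0 \<le> k" using metric_lipschitz_mono[OF F0] by (auto simp: k_def)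
  have b: "\<bar>F x\<bar> \<le> b" if "x \<in> mspace (Cspace K)" for x using b0[OF that] by (simp add: b_def)
  have b1: "1 \<le> b" by (simp add: b_def)
  show "(\<lambda>n. LINT \<omega>|M n. F (X n \<omega>)) \<longlonglongrightarrow> (LINT \<omega>|N. F (Y \<omega>))"
  proof (rule LIMSEQ_I)
    fix \<epsilon> :: real assume \<epsilon>: "0 < \<epsilon>"
    define e where "e = \<epsilon> / (3 * (2 * b + k))"
    have e: "0 < e" "(2 * b + k) * e = \<epsilon> / 3" using \<epsilon> b1 k by (auto simp: e_def field_simps)
    obtain \<delta> where \<delta>: "\<delta> > 0" and osc\<delta>: "\<forall>\<^sub>F n in sequentially. \<forall>J. finite J \<and> J \<subseteq> K \<longrightarrow>
      (\<integral>\<^sup>+\<omega>. ennreal (min 1 (oscillation \<delta> J (X n \<omega>))) \<partial>M n) \<le> ennreal e" using osc[OF e(1)] by blast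
    obtain D where "net K \<delta> D" using net_exists[OF K \<delta>] by blast
    then interpret net K \<delta> D .
    define P where "P = interpolation K \<delta> D"
    \<comment> \<open>Only the oscillations of \<open>X n\<close> are bounded by assumption. The
      bound passes to \<open>Y\<close> because the truncated oscillation over a fixed finite set is
      itself an admissible \<Phi> in \<open>fdd\<close>.\<close>
    have oscY: "(\<integral>\<^sup>+\<omega>. ennreal (min 1 (oscillation \<delta> J (Y \<omega>))) \<partial>N) \<le> ennreal e" if J: "finite J" "J \<subseteq> K" for J
    proof -
      interpret N: prob_space N by (rule N)
      have nn: "0 \<le> min 1 (oscillation \<delta> J x)" for x using oscillation_nonneg[OF J(1)] by auto
      have int: "integrable N (\<lambda>\<omega>. min 1 (oscillation \<delta> J (Y \<omega>)))"
        using nn J mY by (intro N.integrable_const_bound[where B=1]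
            coord_lipschitz_measurable[OF J(1) oscillation_lipschitz[OF J(1)]]) auto
      have "(LINT \<omega>|N. min 1 (oscillation \<delta> J (Y \<omega>))) \<le> e"
      proof (rule tendsto_upperbound)
        show "(\<lambda>n. LINT \<omega>|M n. min 1 (oscillation \<delta> J (X n \<omega>))) \<longlonglongrightarrow> (LINT \<omega>|N. min 1 (oscillation \<delta> J (Y \<omega>)))"
          using nn by (intro fdd[OF J oscillation_lipschitz[OF J(1)], where b=1]) auto
        show "\<forall>\<^sub>F n in sequentially. (LINT \<omega>|M n. min 1 (oscillation \<delta> J (X n \<omega>))) \<le> e"
          using osc\<delta>
        proof eventually_elim
          case (elim n)
          interpret Mn: prob_space "M n" by (rule M)
          have "integrable (M n) (\<lambda>\<omega>. min 1 (oscillation \<delta> J (X n \<omega>)))"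
            using nn J mX by (intro Mn.integrable_const_bound[where B=1]
                coord_lipschitz_measurable[OF J(1) oscillation_lipschitz[OF J(1)]]) auto
          then have "(\<integral>\<^sup>+\<omega>. ennreal (min 1 (oscillation \<delta> J (X n \<omega>))) \<partial>M n)
              = ennreal (LINT \<omega>|M n. min 1 (oscillation \<delta> J (X n \<omega>)))"
            using nn by (intro nn_integral_eq_integral) auto
          then have "ennreal (LINT \<omega>|M n. min 1 (oscillation \<delta> J (X n \<omega>))) \<le> ennreal e"
            using elim J by metis
          then show ?case using e(1) by (simp only: ennreal_le_iff less_imp_le)
        qed
      qed simp
      then show ?thesis using nn int by (simp add: nn_integral_eq_integral ennreal_leI)
    qed
    have "(\<lambda>n. LINT \<omega>|M n. F (P (X n \<omega>))) \<longlonglongrightarrow> (LINT \<omega>|N. F (P (Y \<omega>)))"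
      unfolding P_def using D b interpolation_mspace
      by (intro fdd[OF _ _ lipschitz_interpolation[OF F k], where b=b]) auto
    then have "\<forall>\<^sub>F n in sequentially. norm ((LINT \<omega>|M n. F (P (X n \<omega>))) - (LINT \<omega>|N. F (P (Y \<omega>)))) < \<epsilon> / 3"
      unfolding dist_norm[symmetric] using \<epsilon> by (intro tendstoD) auto
    with osc\<delta> have "\<forall>\<^sub>F n in sequentially. norm ((LINT \<omega>|M n. F (X n \<omega>)) - (LINT \<omega>|N. F (Y \<omega>))) < \<epsilon>"
    proof eventually_elim
      case (elim n)
      have "\<bar>(LINT \<omega>|M n. F (X n \<omega>)) - (LINT \<omega>|M n. F (P (X n \<omega>)))\<bar> \<le> \<epsilon> / 3"
        unfolding P_def e(2)[symmetric] using elim(1) e(1)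
        by (intro integral_interpolation_error[OF M X mX _ F k b]) auto
      moreover have "\<bar>(LINT \<omega>|N. F (Y \<omega>)) - (LINT \<omega>|N. F (P (Y \<omega>)))\<bar> \<le> \<epsilon> / 3"
        unfolding P_def e(2)[symmetric] using oscY e(1)
        by (intro integral_interpolation_error[OF N Y mY _ F k b]) auto
      ultimately show ?case using elim(2) unfolding real_norm_def by linarith
    qed
    then show "\<exists>n0. \<forall>n\<ge>n0. norm ((LINT \<omega>|M n. F (X n \<omega>)) - (LINT \<omega>|N. F (Y \<omega>))) < \<epsilon>"
      by (simp add: eventually_sequentially)
  qed
qed

section \<open>Density of step functions\<close>

text \<open>The \<open>p\<close>-th power of \<open>Lnorm\<close>. Without the root it is additive
  over disjoint sets, as the maximal inequality requires; in place of Minkowski's inequality a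
  triangle inequality with the factor \<open>2 powr p\<close> is used.\<close>

definition energy :: "real \<Rightarrow> (real ^ 'n) set \<Rightarrow> (real ^ 'n \<Rightarrow> real) \<Rightarrow> real"
  where "energy p K g = (LINT u|lebesgue_on K. \<bar>g u\<bar> powr p)"

lemma energy_nonneg: "0 \<le> energy p K g"
  by (simp add: energy_def)

lemma energy_cong_AE:
  assumes "g \<in> borel_measurable (lebesgue_on K)" "h \<in> borel_measurable (lebesgue_on K)"
    and "AE u in lebesgue_on K. g u = h u"
  shows "energy p K g = energy p K h"
  unfolding energy_def using assms by (intro integral_cong_AE) auto

lemma LspaceD:
  assumes "g \<in> Lspace p K"
  shows "g \<in> borel_measurable (lebesgue_on K)" "integrable (lebesgue_on K) (\<lambda>u. \<bar>g u\<bar> powr p)"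
  using assms by (auto simp: Lspace_def)

lemma Lspace_bound:
  assumes h: "h \<in> Lspace p K" and g: "g \<in> borel_measurable (lebesgue_on K)"
    and le: "\<And>u. u \<in> K \<Longrightarrow> \<bar>g u\<bar> \<le> \<bar>h u\<bar>" and p: "0 \<le> p"
  shows "g \<in> Lspace p K" "energy p K g \<le> energy p K h"
proof -
  have *: "\<bar>g u\<bar> powr p \<le> \<bar>h u\<bar> powr p" if "u \<in> space (lebesgue_on K)" for u
    using le that p by (intro powr_mono2) auto
  have "integrable (lebesgue_on K) (\<lambda>u. \<bar>g u\<bar> powr p)"
    using LspaceD[OF h] g * by (intro Bochner_Integration.integrable_bound[OF LspaceD(2)[OF h]]) auto
  then show "g \<in> Lspace p K" "energy p K g \<le> energy p K h"
    using g LspaceD(2)[OF h] * by (auto simp: Lspace_def energy_def intro!: integral_mono)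
qed

text \<open>The weight \<open>1/2\<close> in \<open>powr_add_le_weighted\<close> gives the constant
  \<open>2 powr (p - 1)\<close>, rounded up.\<close>

lemma powr_abs_add_le:
  fixes x y :: real
  assumes "1 \<le> p" shows "\<bar>x + y\<bar> powr p \<le> 2 powr p * (\<bar>x\<bar> powr p + \<bar>y\<bar> powr p)"
proof -
  have "\<bar>x + y\<bar> powr p \<le> (\<bar>x\<bar> + \<bar>y\<bar>) powr p" using assms by (intro powr_mono2) auto
  also have "\<dots> \<le> (1/2) powr (1 - p) * \<bar>x\<bar> powr p + (1 - 1/2) powr (1 - p) * \<bar>y\<bar> powr p"
    using assms by (intro powr_add_le_weighted) auto
  also have "\<dots> = (1/2) powr (1 - p) * (\<bar>x\<bar> powr p + \<bar>y\<bar> powr p)" by (simp add: distrib_left)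
  also have "(1/2::real) powr (1 - p) \<le> 2 powr p"
  proof -
    have "(1/2::real) powr (1 - p) = 2 powr (p - 1)"
      by (simp add: powr_divide powr_diff)
    then show ?thesis by (simp add: powr_mono)
  qed
  finally show ?thesis by (simp add: mult_right_mono)
qed

lemma Lspace_add:
  assumes g: "g \<in> Lspace p K" and h: "h \<in> Lspace p K" and p: "1 \<le> p"
  shows "(\<lambda>u. g u + h u) \<in> Lspace p K"
    "energy p K (\<lambda>u. g u + h u) \<le> 2 powr p * (energy p K g + energy p K h)"
proof -
  note [measurable] = LspaceD(1)[OF g] LspaceD(1)[OF h]
  have i: "integrable (lebesgue_on K) (\<lambda>u. 2 powr p * (\<bar>g u\<bar> powr p + \<bar>h u\<bar> powr p))"
    using LspaceD(2)[OF g] LspaceD(2)[OF h] by auto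
  have "integrable (lebesgue_on K) (\<lambda>u. \<bar>g u + h u\<bar> powr p)"
    using powr_abs_add_le[OF p] by (intro Bochner_Integration.integrable_bound[OF i]) auto
  then show "(\<lambda>u. g u + h u) \<in> Lspace p K" by (simp add: Lspace_def)
  have "energy p K (\<lambda>u. g u + h u) \<le> (LINT u|lebesgue_on K. 2 powr p * (\<bar>g u\<bar> powr p + \<bar>h u\<bar> powr p))"
    unfolding energy_def using powr_abs_add_le[OF p] i \<open>integrable (lebesgue_on K) (\<lambda>u. \<bar>g u + h u\<bar> powr p)\<close>
    by (intro integral_mono) auto
  also have "\<dots> = 2 powr p * (energy p K g + energy p K h)"
    unfolding energy_def using LspaceD(2)[OF g] LspaceD(2)[OF h] by simp
  finally show "energy p K (\<lambda>u. g u + h u) \<le> 2 powr p * (energy p K g + energy p K h)" .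
qed

lemma Lspace_cmult:
  assumes g: "g \<in> Lspace p K"
  shows "(\<lambda>u. c * g u) \<in> Lspace p K" "energy p K (\<lambda>u. c * g u) = \<bar>c\<bar> powr p * energy p K g"
  using LspaceD[OF g] by (auto simp: Lspace_def energy_def abs_mult powr_mult)

lemma Lspace_uminus:
  assumes g: "g \<in> Lspace p K"
  shows "(\<lambda>u. - g u) \<in> Lspace p K" "energy p K (\<lambda>u. - g u) = energy p K g"
  using LspaceD[OF g] by (auto simp: Lspace_def energy_def)

lemma Lspace_diff:
  assumes g: "g \<in> Lspace p K" and h: "h \<in> Lspace p K" and p: "1 \<le> p"
  shows "(\<lambda>u. g u - h u) \<in> Lspace p K"
    "energy p K (\<lambda>u. g u - h u) \<le> 2 powr p * (energy p K g + energy p K h)"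
  using Lspace_add[OF g Lspace_uminus(1)[OF h] p] Lspace_uminus(2)[OF h] by auto

lemma energy_triangle:
  assumes "f \<in> Lspace p K" "g \<in> Lspace p K" "h \<in> Lspace p K" "1 \<le> p"
  shows "energy p K (\<lambda>u. f u - h u) \<le> 2 powr p * (energy p K (\<lambda>u. f u - g u) + energy p K (\<lambda>u. g u - h u))"
  using Lspace_add(2)[OF Lspace_diff(1)[OF assms(1,2,4)] Lspace_diff(1)[OF assms(2,3,4)] assms(4)] by simp

lemma Lspace_mult_indicator:
  assumes g: "g \<in> Lspace p K" and A: "A \<in> sets lebesgue" and p: "0 \<le> p"
  shows "(\<lambda>u. g u * indicator A u) \<in> Lspace p K"
    "energy p K (\<lambda>u. g u * indicator A u) \<le> energy p K g"
proof -
  have A': "(indicator A :: real ^ 'a \<Rightarrow> real) \<in> borel_measurable (lebesgue_on K)"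
    using A by (intro measurable_restrict_space1) auto
  have m: "(\<lambda>u. g u * indicator A u) \<in> borel_measurable (lebesgue_on K)"
    using LspaceD(1)[OF g] A' by auto
  have le: "\<bar>g u * indicator A u\<bar> \<le> \<bar>g u\<bar>" for u by (simp add: indicator_def)
  show "(\<lambda>u. g u * indicator A u) \<in> Lspace p K" "energy p K (\<lambda>u. g u * indicator A u) \<le> energy p K g"
    using Lspace_bound[OF g m le p] by auto
qed

lemma Lspace_sum:
  assumes "\<And>i. i \<in> I \<Longrightarrow> g i \<in> Lspace p K" "1 \<le> p"
  shows "(\<lambda>u. \<Sum>i\<in>I. g i u) \<in> Lspace p K"
  using assms
proof (induction I rule: infinite_finite_induct)
  case (insert i I)
  then show ?case using Lspace_add(1)[of "g i" p K "\<lambda>u. \<Sum>i\<in>I. g i u"] by simp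
qed (auto simp: Lspace_def)

lemma Lspace_bounded:
  assumes K: "K \<in> lmeasurable" and g: "g \<in> borel_measurable (lebesgue_on K)" and c: "\<And>u. \<bar>g u\<bar> \<le> c" and p: "0 \<le> p"
  shows "g \<in> Lspace p K"
proof -
  interpret finite_measure "lebesgue_on K" using K by (rule finite_measure_lebesgue_on)
  have "\<bar>g u\<bar> powr p \<le> c powr p" for u using c[of u] p by (intro powr_mono2) auto
  then have "integrable (lebesgue_on K) (\<lambda>u. \<bar>g u\<bar> powr p)"
    using g by (intro integrable_const_bound[where B="c powr p"]) auto
  then show ?thesis using g by (simp add: Lspace_def)
qed

text \<open>Either \<open>x\<close> is at most \<eta>, or the factor
  \<open>(x / \<eta>) powr (r - 1)\<close> is at least 1. Integrated, this replaces Hoelder's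
  inequality: a small higher moment gives a small mean after a suitable choice of \<eta>.\<close>

lemma le_add_powr:
  fixes x \<eta> r :: real
  assumes "0 \<le> x" "0 < \<eta>" "1 \<le> r" shows "x \<le> \<eta> + \<eta> powr (1 - r) * x powr r"
proof (cases "x \<le> \<eta>")
  case False
  then have "x powr (1 - r) \<le> \<eta> powr (1 - r)" using assms by (intro powr_mono2') auto
  then have "x powr (1 - r) * x powr r \<le> \<eta> powr (1 - r) * x powr r" by (rule mult_right_mono) simp
  moreover have "x powr (1 - r) * x powr r = x" using False assms by (simp flip: powr_add)
  ultimately show ?thesis using assms by simp
qed (simp add: add_increasing2)

text \<open>Apply \<open>le_add_powr\<close> to \<open>(g u)\<^sup>2\<close> with exponent
  \<open>p / 2\<close>. This links the \<open>L^p\<close> approximation by step functions to the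
  \<open>L^2\<close> isometry of the isonormal process.\<close>

lemma Lspace_square:
  assumes K: "K \<in> lmeasurable" and g: "g \<in> Lspace p K" and p: "2 \<le> p"
  shows "g \<in> Lspace 2 K" "integrable (lebesgue_on K) (\<lambda>u. (g u)\<^sup>2)"
    "0 < \<eta> \<Longrightarrow> (LINT u|lebesgue_on K. (g u)\<^sup>2) \<le> \<eta> * measure lebesgue K + \<eta> powr (1 - p / 2) * energy p K g"
proof -
  interpret finite_measure "lebesgue_on K" using K by (rule finite_measure_lebesgue_on)
  note [measurable] = LspaceD(1)[OF g]
  have sq: "\<bar>x\<bar> powr 2 = x\<^sup>2" for x :: real by (cases "x = 0") auto
  have le: "(g u)\<^sup>2 \<le> \<eta> + \<eta> powr (1 - p / 2) * \<bar>g u\<bar> powr p" if "0 < \<eta>" for \<eta> u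
  proof -
    have "((g u)\<^sup>2) powr (p / 2) = \<bar>g u\<bar> powr p" using powr_powr[of "\<bar>g u\<bar>" 2 "p / 2"] by (simp add: sq)
    then show ?thesis using le_add_powr[of "(g u)\<^sup>2" \<eta> "p / 2"] that p by simp
  qed
  have i: "integrable (lebesgue_on K) (\<lambda>u. \<eta> + \<eta> powr (1 - p / 2) * \<bar>g u\<bar> powr p)" for \<eta>
    using LspaceD(2)[OF g] by auto
  show sqi: "integrable (lebesgue_on K) (\<lambda>u. (g u)\<^sup>2)"
    using le[of 1] by (intro Bochner_Integration.integrable_bound[OF i[of 1]]) auto
  then show "g \<in> Lspace 2 K" using LspaceD(1)[OF g] by (simp add: Lspace_def sq)
  assume "0 < \<eta>"
  then have "(LINT u|lebesgue_on K. (g u)\<^sup>2) \<le> (LINT u|lebesgue_on K. \<eta> + \<eta> powr (1 - p / 2) * \<bar>g u\<bar> powr p)"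
    using le i sqi by (intro integral_mono) auto
  also have "\<dots> = \<eta> * measure (lebesgue_on K) (space (lebesgue_on K)) + \<eta> powr (1 - p / 2) * energy p K g"
    using LspaceD(2)[OF g] by (simp add: energy_def mult.commute)
  also have "measure (lebesgue_on K) (space (lebesgue_on K)) = measure lebesgue K"
    using K by (simp add: measure_restrict_space fmeasurableD)
  finally show "(LINT u|lebesgue_on K. (g u)\<^sup>2) \<le> \<eta> * measure lebesgue K + \<eta> powr (1 - p / 2) * energy p K g" .
qed

text \<open>The half-open box is the one in \<open>brownian_sheet\<close>, so that
  \<open>W (corner s)\<close> is literally the sheet at \<open>s\<close>. The closed boxes of
  \<open>integral_process\<close> give the same function almost everywhere on
  \<open>cbox 0 T\<close>.\<close>

definition corner :: "real ^ 'n \<Rightarrow> real ^ 'n \<Rightarrow> real"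
  where "corner s = indicator {u. \<forall>i. 0 < u $ i \<and> u $ i \<le> s $ i}"

lemma corner_measurable:
  fixes s :: "real ^ 'n" shows "corner s \<in> borel_measurable (lebesgue_on K)"
proof -
  have "{u :: real ^ 'n. \<forall>i. 0 < u $ i \<and> u $ i \<le> s $ i} = (\<Inter>i. {u. 0 < u $ i} \<inter> {u. u $ i \<le> s $ i})" by auto
  moreover have "(\<Inter>i. {u :: real ^ 'n. 0 < u $ i} \<inter> {u. u $ i \<le> s $ i}) \<in> sets borel"
    by (intro sets.countable_INT') auto
  ultimately have "{u :: real ^ 'n. \<forall>i. 0 < u $ i \<and> u $ i \<le> s $ i} \<in> sets lebesgue" by auto
  then show ?thesis unfolding corner_def by (intro measurable_restrict_space1 borel_measurable_indicator)
qed

lemma corner_bound: "\<bar>corner s u\<bar> \<le> 1"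
  by (simp add: corner_def indicator_def)

section \<open>Approximation by step functions on the box\<close>

locale box =
  fixes T :: "real ^ 'n" and p :: real
  assumes T_positive: "\<And>i. 0 < T $ i" and p: "1 \<le> p"
begin

abbreviation "K \<equiv> cbox 0 T"
abbreviation "L \<equiv> lebesgue_on (cbox 0 T)"

definition step :: "(real ^ 'n) set \<Rightarrow> (real ^ 'n \<Rightarrow> real) \<Rightarrow> real ^ 'n \<Rightarrow> real"
  where "step S a u = (\<Sum>s\<in>S. a s * corner s u)"

lemma step_Lspace: "step S a \<in> Lspace p K"
  unfolding step_def[abs_def] using p
  by (intro Lspace_sum Lspace_cmult Lspace_bounded[OF _ corner_measurable corner_bound]) auto

lemma step_bounded: obtains c where "0 < c" "\<And>u. \<bar>step S a u\<bar> \<le> c"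
proof
  show "0 < 1 + (\<Sum>s\<in>S. \<bar>a s\<bar>)" by (intro add_pos_nonneg sum_nonneg) auto
  fix u
  have "\<bar>step S a u\<bar> \<le> (\<Sum>s\<in>S. \<bar>a s * corner s u\<bar>)" unfolding step_def by (rule sum_abs)
  also have "\<dots> \<le> (\<Sum>s\<in>S. \<bar>a s\<bar>)"
    using corner_bound[of _ u] by (intro sum_mono) (auto simp: abs_mult mult_left_le)
  finally show "\<bar>step S a u\<bar> \<le> 1 + (\<Sum>s\<in>S. \<bar>a s\<bar>)" by simp
qed

definition approx :: "(real ^ 'n \<Rightarrow> real) \<Rightarrow> bool"
  where "approx g \<longleftrightarrow> g \<in> Lspace p K \<and>
    (\<forall>e>0. \<exists>S a. finite S \<and> S \<subseteq> K \<and> energy p K (\<lambda>u. g u - step S a u) < e)"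

lemma approxE:
  assumes "approx g" "0 < e"
  obtains S a where "finite S" "S \<subseteq> K" "energy p K (\<lambda>u. g u - step S a u) < e"
  using assms unfolding approx_def by blast

lemma approx_step: "finite S \<Longrightarrow> S \<subseteq> K \<Longrightarrow> approx (step S a)"
  unfolding approx_def using step_Lspace p
  by (auto intro!: exI[of _ S] exI[of _ a] simp: energy_def)

lemma approx_cong_AE:
  assumes g: "approx g" and h: "h \<in> borel_measurable L" and eq: "AE u in L. g u = h u"
  shows "approx h"
proof -
  have gL: "g \<in> Lspace p K" using g by (simp add: approx_def)
  have "integrable L (\<lambda>u. \<bar>h u\<bar> powr p)"
    using LspaceD(2)[OF gL] LspaceD(1)[OF gL] h eq
    by (subst integrable_cong_AE[of _ _ "\<lambda>u. \<bar>g u\<bar> powr p"]) auto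
  moreover have "energy p K (\<lambda>u. h u - step S a u) = energy p K (\<lambda>u. g u - step S a u)" for S a
    using LspaceD(1)[OF gL] h LspaceD(1)[OF step_Lspace] eq by (intro energy_cong_AE) auto
  ultimately show ?thesis using g h by (simp add: approx_def Lspace_def)
qed

lemma approx_limit:
  assumes g: "g \<in> Lspace p K" and lim: "\<And>e. 0 < e \<Longrightarrow> \<exists>h. approx h \<and> energy p K (\<lambda>u. g u - h u) < e"
  shows "approx g"
  unfolding approx_def
proof (intro conjI allI impI g)
  fix e :: real assume e: "0 < e"
  \<comment> \<open>Two errors of this size, multiplied by the constant of
    \<open>energy_triangle\<close>, add up to \<open>e\<close>.\<close>
  define e' where "e' = e / (2 * 2 powr p)"
  have e': "0 < e'" "2 powr p * (e' + e') = e" using e by (auto simp: e'_def field_simps)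
  obtain h where h: "approx h" "energy p K (\<lambda>u. g u - h u) < e'" using lim[OF e'(1)] by blast
  obtain S a where S: "finite S" "S \<subseteq> K" "energy p K (\<lambda>u. h u - step S a u) < e'" using approxE[OF h(1) e'(1)] .
  have hL: "h \<in> Lspace p K" using h(1) by (simp add: approx_def)
  have "energy p K (\<lambda>u. g u - step S a u) \<le> 2 powr p * (energy p K (\<lambda>u. g u - h u) + energy p K (\<lambda>u. h u - step S a u))"
    by (rule energy_triangle[OF g hL step_Lspace p])
  also have "\<dots> < 2 powr p * (e' + e')" using h(2) S(3) by (intro mult_strict_left_mono) auto
  finally show "\<exists>S a. finite S \<and> S \<subseteq> K \<and> energy p K (\<lambda>u. g u - step S a u) < e"
    using S e'(2) by auto
qed

lemma step_add:
  assumes "finite S" "finite S'"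
  shows "step S a u + step S' a' u
    = step (S \<union> S') (\<lambda>s. (if s \<in> S then a s else 0) + (if s \<in> S' then a' s else 0)) u"
proof -
  have "step S a u = (\<Sum>s\<in>S \<union> S'. (if s \<in> S then a s else 0) * corner s u)"
    unfolding step_def using assms by (intro sum.mono_neutral_cong_left) auto
  moreover have "step S' a' u = (\<Sum>s\<in>S \<union> S'. (if s \<in> S' then a' s else 0) * corner s u)"
    unfolding step_def using assms by (intro sum.mono_neutral_cong_left) auto
  ultimately show ?thesis by (simp add: step_def sum.distrib distrib_right)
qed

lemma approx_add:
  assumes g: "approx g" and h: "approx h" shows "approx (\<lambda>u. g u + h u)"
  unfolding approx_def
proof (intro conjI allI impI)
  have L: "g \<in> Lspace p K" "h \<in> Lspace p K" using g h by (auto simp: approx_def)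
  show "(\<lambda>u. g u + h u) \<in> Lspace p K" by (rule Lspace_add(1)[OF L p])
  fix e :: real assume e: "0 < e"
  define e' where "e' = e / (2 * 2 powr p)"
  have e': "0 < e'" "2 powr p * (e' + e') = e" using e by (auto simp: e'_def field_simps)
  obtain S a where S: "finite S" "S \<subseteq> K" "energy p K (\<lambda>u. g u - step S a u) < e'" using approxE[OF g e'(1)] .
  obtain S' a' where S': "finite S'" "S' \<subseteq> K" "energy p K (\<lambda>u. h u - step S' a' u) < e'" using approxE[OF h e'(1)] .
  define b where "b = (\<lambda>s. (if s \<in> S then a s else 0) + (if s \<in> S' then a' s else 0))"
  have "energy p K (\<lambda>u. (g u - step S a u) + (h u - step S' a' u))
      \<le> 2 powr p * (energy p K (\<lambda>u. g u - step S a u) + energy p K (\<lambda>u. h u - step S' a' u))"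
    by (intro Lspace_add(2) Lspace_diff(1) L step_Lspace p)
  also have "\<dots> < 2 powr p * (e' + e')" using S(3) S'(3) by (intro mult_strict_left_mono) auto
  also have "(\<lambda>u. (g u - step S a u) + (h u - step S' a' u)) = (\<lambda>u. g u + h u - step (S \<union> S') b u)"
    unfolding b_def using step_add[OF S(1) S'(1), of a _ a'] by (auto simp: algebra_simps)
  finally show "\<exists>S a. finite S \<and> S \<subseteq> K \<and> energy p K (\<lambda>u. g u + h u - step S a u) < e"
    using S(1,2) S'(1,2) e'(2) by (intro exI[of _ "S \<union> S'"] exI[of _ b]) auto
qed

lemma approx_cmult:
  assumes g: "approx g" shows "approx (\<lambda>u. c * g u)"
  unfolding approx_def
proof (intro conjI allI impI)
  have L: "g \<in> Lspace p K" using g by (auto simp: approx_def)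
  show "(\<lambda>u. c * g u) \<in> Lspace p K" by (rule Lspace_cmult(1)[OF L])
  fix e :: real assume e: "0 < e"
  define e' where "e' = e / (\<bar>c\<bar> powr p + 1)"
  have pos: "0 < \<bar>c\<bar> powr p + 1" by (simp add: add_nonneg_pos)
  then have e': "0 < e'" "(\<bar>c\<bar> powr p + 1) * e' = e" using e by (auto simp: e'_def)
  obtain S a where S: "finite S" "S \<subseteq> K" "energy p K (\<lambda>u. g u - step S a u) < e'" using approxE[OF g e'(1)] .
  have "(\<lambda>u. c * g u - step S (\<lambda>s. c * a s) u) = (\<lambda>u. c * (g u - step S a u))"
    by (simp add: step_def sum_distrib_left right_diff_distrib mult.assoc)
  then have "energy p K (\<lambda>u. c * g u - step S (\<lambda>s. c * a s) u) = \<bar>c\<bar> powr p * energy p K (\<lambda>u. g u - step S a u)"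
    using Lspace_cmult(2)[OF Lspace_diff(1)[OF L step_Lspace p]] by simp
  also have "\<dots> \<le> \<bar>c\<bar> powr p * e'" using S(3) by (intro mult_left_mono) auto
  also have "\<dots> < (\<bar>c\<bar> powr p + 1) * e'" using e' by (simp add: distrib_right)
  finally show "\<exists>S a. finite S \<and> S \<subseteq> K \<and> energy p K (\<lambda>u. c * g u - step S a u) < e"
    using S e'(2) by (intro exI[of _ S] exI[of _ "\<lambda>s. c * a s"]) auto
qed

lemma approx_0: "approx (\<lambda>u. 0)"
  using approx_step[of "{}" "\<lambda>_. 0"] by (simp add: step_def[abs_def])

lemma approx_sum: "(\<And>i. i \<in> I \<Longrightarrow> approx (g i)) \<Longrightarrow> approx (\<lambda>u. \<Sum>i\<in>I. g i u)"
  by (induction I rule: infinite_finite_induct) (auto simp: approx_0 intro: approx_add)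

lemma AE_hyperplanes: "AE u in L. \<forall>i. u $ i \<noteq> t $ i"
proof -
  have "AE u :: real ^ 'n in lebesgue. \<forall>i. u $ i \<noteq> t $ i"
  proof (intro eventually_all_finite)
    fix i :: 'n
    have "{u :: real ^ 'n. u \<bullet> axis i 1 = t $ i} \<in> null_sets lebesgue"
      using negligible_standard_hyperplane[of "axis i (1 :: real)" "t $ i"] by (simp add: negligible_iff_null_sets axis_in_Basis_iff Basis_real_def)
    from AE_not_in[OF this] show "AE u :: real ^ 'n in lebesgue. u $ i \<noteq> t $ i" by (simp add: inner_axis)
  qed
  then show ?thesis by (subst AE_restrict_space_iff) auto
qed

lemma indicator_measurable: "A \<in> sets lebesgue \<Longrightarrow> (indicator A :: real ^ 'n \<Rightarrow> real) \<in> borel_measurable L"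
  by (intro measurable_restrict_space1) auto

text \<open>Within the box a lower orthant is the corner box of \<open>c\<close> cut off at
  \<open>T\<close>, up to the null faces \<open>u $ i = 0\<close>; if \<open>c\<close> has a
  negative coordinate it misses the box.\<close>

lemma approx_atMost: "approx (indicator {..c})"
proof (cases "\<forall>i. 0 \<le> c $ i")
  case True
  define s where "s = (\<chi> i. min (c $ i) (T $ i))"
  have s: "s \<in> K" using True T_positive by (auto simp: s_def mem_box_cart less_imp_le)
  have "approx (corner s)"
    using approx_step[of "{s}" "\<lambda>_. 1"] s by (simp add: step_def[abs_def])
  moreover have "AE u in L. corner s u = indicator {..c} u"
    using AE_hyperplanes[of 0] AE_space
  proof eventually_elim
    case (elim u)
    then have "0 < u $ i" "u $ i \<le> T $ i" for i by (auto simp: mem_box_cart order.strict_iff_order)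
    then show ?case by (auto simp: corner_def indicator_def s_def less_eq_vec_def)
  qed
  ultimately show ?thesis by (elim approx_cong_AE[OF _ indicator_measurable]) auto
next
  case False
  have "AE u in L. 0 = (indicator {..c} u :: real)"
    using AE_space
  proof eventually_elim
    case (elim u)
    then have "0 \<le> u $ i" for i by (auto simp: mem_box_cart)
    then show ?case using False by (auto simp: indicator_def less_eq_vec_def intro: order_trans)
  qed
  then show ?thesis by (intro approx_cong_AE[OF approx_0 indicator_measurable]) auto
qed

lemma energy_tendsto_0:
  assumes g: "g \<in> Lspace p K" and h: "\<And>i. h i \<in> borel_measurable L"
    and lim: "AE u in L. (\<lambda>i. h i u) \<longlonglongrightarrow> g u" and bd: "\<And>i. AE u in L. \<bar>g u - h i u\<bar> \<le> \<bar>w u\<bar>"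
    and w: "w \<in> Lspace p K"
  shows "(\<lambda>i. energy p K (\<lambda>u. g u - h i u)) \<longlonglongrightarrow> 0"
proof -
  note [measurable] = LspaceD(1)[OF g] h
  have "(\<lambda>i. LINT u|L. \<bar>g u - h i u\<bar> powr p) \<longlonglongrightarrow> (LINT u|L. 0)"
  proof (rule integral_dominated_convergence[where w="\<lambda>u. \<bar>w u\<bar> powr p"])
    show "AE u in L. (\<lambda>i. \<bar>g u - h i u\<bar> powr p) \<longlonglongrightarrow> 0"
      using lim
    proof eventually_elim
      case (elim u)
      then have "(\<lambda>i. \<bar>g u - h i u\<bar>) \<longlonglongrightarrow> \<bar>g u - g u\<bar>" by (intro tendsto_intros)
      then have "(\<lambda>i. \<bar>g u - h i u\<bar> powr p) \<longlonglongrightarrow> 0 powr p"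
        using p by (intro tendsto_powr2) auto
      then show ?case using p by simp
    qed
    show "AE u in L. norm (\<bar>g u - h i u\<bar> powr p) \<le> \<bar>w u\<bar> powr p" for i
      using bd[of i]
    proof eventually_elim
      case (elim u)
      then show ?case using p by (auto intro!: powr_mono2)
    qed
  qed (use LspaceD(2)[OF w] in auto)
  then show ?thesis by (simp add: energy_def)
qed

lemma approx_sequence:
  assumes "g \<in> Lspace p K" "\<And>i. approx (h i)"
    and "AE u in L. (\<lambda>i. h i u) \<longlonglongrightarrow> g u" "\<And>i. AE u in L. \<bar>g u - h i u\<bar> \<le> \<bar>w u\<bar>" "w \<in> Lspace p K"
  shows "approx g"
proof (rule approx_limit[OF assms(1)])
  fix e :: real assume e: "0 < e"
  have "h i \<in> borel_measurable L" for i using assms(2)[of i] by (auto simp: approx_def Lspace_def)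
  then have "(\<lambda>i. energy p K (\<lambda>u. g u - h i u)) \<longlonglongrightarrow> 0" using assms by (intro energy_tendsto_0[where w=w])
  then have "\<forall>\<^sub>F i in sequentially. energy p K (\<lambda>u. g u - h i u) < e" using e by (rule order_tendstoD)
  then show "\<exists>h. approx h \<and> energy p K (\<lambda>u. g u - h u) < e"
    using assms(2) by (auto simp: eventually_sequentially)
qed

lemma Lspace_indicator: "A \<in> sets lebesgue \<Longrightarrow> indicator A \<in> Lspace p K"
  using p by (intro Lspace_bounded[OF _ indicator_measurable, where c=1]) (auto simp: indicator_def)

text \<open>A Dynkin argument: lower orthants are stable under intersection and generate the Borel
  sets, while linearity and dominated limits give closure under complements and countable disjoint
  unions.\<close>

lemma approx_borel: assumes "A \<in> sets borel" shows "approx (indicator A)"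
proof -
  have "Int_stable (range (\<lambda>c :: real ^ 'n. {..c}))"
    unfolding Int_stable_def
  proof safe
    fix a b :: "real ^ 'n"
    have "{..a} \<inter> {..b} = {..inf a b}" by auto
    then show "{..a} \<inter> {..b} \<in> range (\<lambda>c. {..c})" by blast
  qed
  moreover have "range (\<lambda>c :: real ^ 'n. {..c}) \<subseteq> Pow UNIV" by simp
  moreover have "A \<in> sigma_sets UNIV (range (\<lambda>c :: real ^ 'n. {..c}))"
    using assms by (simp add: borel_eq_atMost)
  ultimately show ?thesis
  proof (induction rule: sigma_sets_induct_disjoint)
    case (basic A) then show ?case using approx_atMost by auto
  next
    case empty then show ?case using approx_0 by (simp add: indicator_def[abs_def])
  next
    case (compl A)
    \<comment> \<open>On the box the indicator of \<open>{..T}\<close> is the constant 1, so the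
      complement becomes a difference of approximable functions.\<close>
    have "approx (\<lambda>u. indicator {..T} u + (- 1) * indicator A u)"
      by (intro approx_add approx_cmult approx_atMost compl)
    moreover have "AE u in L. indicator {..T} u + (- 1) * indicator A u = (indicator (UNIV - A) u :: real)"
      by (intro AE_I2) (auto simp: indicator_def less_eq_vec_def mem_box_cart)
    moreover have "A \<in> sets borel" using compl by (simp add: borel_eq_atMost)
    ultimately show ?case by (elim approx_cong_AE[OF _ indicator_measurable]) auto
  next
    case (union A)
    have A: "A i \<in> sets lebesgue" for i
    proof -
      have "A i \<in> sets borel" using union(2) by (auto simp: borel_eq_atMost)
      then show ?thesis by auto
    qed
    show ?case
    proof (rule approx_sequence[where h="\<lambda>n u. \<Sum>i<n. indicator (A i) u" and w="\<lambda>u. 1"])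
      show "indicator (\<Union>i. A i) \<in> Lspace p K" using A by (intro Lspace_indicator) auto
      show "approx (\<lambda>u. \<Sum>i<n. indicator (A i) u)" for n by (intro approx_sum union)
      have sums: "(\<lambda>i. indicator (A i) u) sums (indicator (\<Union>i. A i) u :: real)" for u
        using indicator_sums[OF union(1)[unfolded disjoint_family_on_def, rule_format]] by auto
      then show "AE u in L. (\<lambda>n. \<Sum>i<n. indicator (A i) u :: real) \<longlonglongrightarrow> indicator (\<Union>i. A i) u"
        by (simp add: sums_def)
      have "0 \<le> (\<Sum>i<n. indicator (A i) u :: real)" "(\<Sum>i<n. indicator (A i) u :: real) \<le> indicator (\<Union>i. A i) u" for n u
        using sums[of u] sum_le_suminf[of "\<lambda>i. indicator (A i) u :: real" "{..<n}"]
        by (auto intro: sum_nonneg simp: sums_iff)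
      moreover have "(indicator (\<Union>i. A i) u :: real) \<le> 1" for u by (simp add: indicator_def)
      ultimately show "AE u in L. \<bar>indicator (\<Union>i. A i) u - (\<Sum>i<n. indicator (A i) u)\<bar> \<le> \<bar>1::real\<bar>" for n
        by (intro AE_I2) (smt (verit))
      show "(\<lambda>u. 1) \<in> Lspace p K" using p by (intro Lspace_bounded[where c=1]) auto
    qed
  qed
qed

lemma approx_lebesgue: assumes "A \<in> sets lebesgue" shows "approx (indicator A)"
proof -
  obtain S N N' where A: "A = S \<union> N" "N \<subseteq> N'" "N' \<in> null_sets lborel" "S \<in> sets lborel"
    using sets_completionE[OF assms] .
  have "AE u in lebesgue. u \<notin> N'" using A(3) by (intro AE_completion AE_not_in)
  then have "AE u in L. u \<notin> N'" by (subst AE_restrict_space_iff) auto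
  then have "AE u in L. indicator S u = (indicator A u :: real)"
    by eventually_elim (use A in \<open>auto simp: indicator_def\<close>)
  moreover have "approx (indicator S)" using A by (intro approx_borel) simp
  ultimately show ?thesis using approx_cong_AE[OF _ indicator_measurable[OF assms]] by blast
qed

theorem steps_dense: assumes g: "g \<in> Lspace p K" shows "approx g"
proof -
  obtain F where F: "\<And>i. simple_function L (F i)" "\<And>u. u \<in> space L \<Longrightarrow> (\<lambda>i. F i u) \<longlonglongrightarrow> g u"
    "\<And>i u. u \<in> space L \<Longrightarrow> dist (F i u) 0 \<le> 2 * dist (g u) 0"
    using borel_measurable_implies_sequence_metric[OF LspaceD(1)[OF g], of 0] by blast
  have simple: "approx (F i)" for i
  proof (rule approx_cong_AE)
    have "F i -` {y} \<inter> space L \<in> sets lebesgue" for y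
    proof -
      have "F i -` {y} \<inter> space L \<in> sets L" using simple_functionD(2)[OF F(1)] .
      then show ?thesis by (auto simp: sets_restrict_space_iff)
    qed
    then show "approx (\<lambda>u. \<Sum>y\<in>F i ` space L. y * indicator (F i -` {y} \<inter> space L) u)"
      by (intro approx_sum approx_cmult approx_lebesgue)
    show "AE u in L. (\<Sum>y\<in>F i ` space L. y * indicator (F i -` {y} \<inter> space L) u) = F i u"
    proof (intro AE_I2)
      fix u assume "u \<in> space L"
      from simple_function_indicator_representation_banach[OF F(1) this, symmetric, of i]
      show "(\<Sum>y\<in>F i ` space L. y * indicator (F i -` {y} \<inter> space L) u) = F i u"
        by (simp only: real_scaleR_def mult.commute)
    qed
    show "F i \<in> borel_measurable L" using F(1) by (rule borel_measurable_simple_function)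
  qed
  show ?thesis
  proof (rule approx_sequence[OF g simple])
    show "AE u in L. (\<lambda>i. F i u) \<longlonglongrightarrow> g u" using F(2) by (intro AE_I2)
    \<comment> \<open>The simple functions satisfy \<open>|F i| \<le> 2 * |g|\<close>, whence the
      dominating function \<open>3 * g\<close>.\<close>
    show "AE u in L. \<bar>g u - F i u\<bar> \<le> \<bar>3 * g u\<bar>" for i
    proof (intro AE_I2)
      fix u assume "u \<in> space L"
      from F(3)[OF this, of i] show "\<bar>g u - F i u\<bar> \<le> \<bar>3 * g u\<bar>" by (simp add: dist_real_def abs_mult)
    qed
    show "(\<lambda>u. 3 * g u) \<in> Lspace p K" by (rule Lspace_cmult[OF g])
  qed
qed

end

section \<open>Convergence of finite families of integrals\<close>

lemma powr_eventually_small: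
  fixes c e r :: real
  assumes "0 \<le> c" "0 < e" "0 < r"
  obtains d where "0 < d" "\<And>x. 0 \<le> x \<Longrightarrow> x < d \<Longrightarrow> c * x powr r \<le> e"
proof
  show "0 < (e / (c + 1)) powr (1 / r)" using assms by simp
  fix x assume x: "0 \<le> x" "x < (e / (c + 1)) powr (1 / r)"
  have "x powr r \<le> ((e / (c + 1)) powr (1 / r)) powr r" using x assms by (intro powr_mono2) auto
  also have "\<dots> = e / (c + 1)" using assms by (simp add: powr_powr)
  finally have "c * x powr r \<le> c * (e / (c + 1))" using assms by (intro mult_left_mono)
  also have "\<dots> \<le> e" using assms by (simp add: field_simps)
  finally show "c * x powr r \<le> e" .
qed

lemma lipschitz_mean_diff:
  fixes k d :: real
  assumes "prob_space M" and I: "finite I" and \<Phi>: "coord_lipschitz I k \<Phi>" and k: "0 \<le> k"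
    and b: "\<And>x. \<bar>\<Phi> x\<bar> \<le> b"
    and A: "\<And>i. i \<in> I \<Longrightarrow> (\<lambda>\<omega>. A \<omega> i) \<in> borel_measurable M"
    and B: "\<And>i. i \<in> I \<Longrightarrow> (\<lambda>\<omega>. B \<omega> i) \<in> borel_measurable M"
    and d: "\<And>i. i \<in> I \<Longrightarrow> (\<integral>\<^sup>+\<omega>. ennreal \<bar>A \<omega> i - B \<omega> i\<bar> \<partial>M) \<le> ennreal d" and d0: "0 \<le> d"
  shows "\<bar>(LINT \<omega>|M. \<Phi> (A \<omega>)) - (LINT \<omega>|M. \<Phi> (B \<omega>))\<bar> \<le> k * (card I * d)"
proof -
  interpret prob_space M by fact
  have mA: "(\<lambda>\<omega>. \<Phi> (A \<omega>)) \<in> borel_measurable M" using A by (rule coord_lipschitz_measurable[OF I \<Phi>])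
  have mB: "(\<lambda>\<omega>. \<Phi> (B \<omega>)) \<in> borel_measurable M" using B by (rule coord_lipschitz_measurable[OF I \<Phi>])
  have i: "integrable M (\<lambda>\<omega>. \<Phi> (A \<omega>))" "integrable M (\<lambda>\<omega>. \<Phi> (B \<omega>))"
    using b mA mB by (auto intro!: integrable_const_bound[where B=b])
  have "ennreal (norm (LINT \<omega>|M. \<Phi> (A \<omega>) - \<Phi> (B \<omega>))) \<le> (\<integral>\<^sup>+\<omega>. ennreal (norm (\<Phi> (A \<omega>) - \<Phi> (B \<omega>))) \<partial>M)"
    using i by (intro integral_norm_bound_ennreal) auto
  also have "\<dots> \<le> (\<integral>\<^sup>+\<omega>. ennreal k * (\<Sum>i\<in>I. ennreal \<bar>A \<omega> i - B \<omega> i\<bar>) \<partial>M)"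
  proof (intro nn_integral_mono)
    fix \<omega>
    have "norm (\<Phi> (A \<omega>) - \<Phi> (B \<omega>)) \<le> k * (\<Sum>i\<in>I. \<bar>A \<omega> i - B \<omega> i\<bar>)" using coord_lipschitzD[OF \<Phi>] by simp
    then have "ennreal (norm (\<Phi> (A \<omega>) - \<Phi> (B \<omega>))) \<le> ennreal (k * (\<Sum>i\<in>I. \<bar>A \<omega> i - B \<omega> i\<bar>))" by (rule ennreal_leI)
    also have "\<dots> = ennreal k * (\<Sum>i\<in>I. ennreal \<bar>A \<omega> i - B \<omega> i\<bar>)"
      using k by (subst ennreal_mult) (auto simp: sum_nonneg)
    finally show "ennreal (norm (\<Phi> (A \<omega>) - \<Phi> (B \<omega>))) \<le> ennreal k * (\<Sum>i\<in>I. ennreal \<bar>A \<omega> i - B \<omega> i\<bar>)" .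
  qed
  also have "\<dots> = ennreal k * (\<Sum>i\<in>I. \<integral>\<^sup>+\<omega>. ennreal \<bar>A \<omega> i - B \<omega> i\<bar> \<partial>M)"
  proof -
    have m: "(\<lambda>\<omega>. ennreal \<bar>A \<omega> i - B \<omega> i\<bar>) \<in> borel_measurable M" if "i \<in> I" for i using A B that by auto
    then show ?thesis by (subst nn_integral_cmult) (auto simp: nn_integral_sum simp del: sum_ennreal intro!: borel_measurable_sum)
  qed
  also have "\<dots> \<le> ennreal k * (\<Sum>i\<in>I. ennreal d)" using d by (intro mult_left_mono sum_mono) auto
  also have "\<dots> = ennreal (k * (card I * d))"
    using k d0 by (simp add: ennreal_mult ennreal_of_nat_eq_real_of_nat)
  finally show ?thesis using i k d0 by simp
qed

text \<open>A continuous version is specified only through almost sure equality at each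
  \<open>t\<close>; completeness of \<open>N\<close> supplies the measurability of its
  coordinates.\<close>

lemma AE_eq_measurable_complete:
  fixes f g :: "'a \<Rightarrow> real"
  assumes "complete_measure N" and f: "f \<in> borel_measurable N" and eq: "AE \<omega> in N. f \<omega> = g \<omega>"
  shows "g \<in> borel_measurable N"
proof (rule measurableI)
  fix A :: "real set" assume A: "A \<in> sets borel"
  have "f -` A \<inter> space N \<in> sets N" using f A by (rule measurable_sets)
  then show "g -` A \<inter> space N \<in> sets N"
    by (rule complete_measure.in_sets_AE[OF assms(1), rotated]) (use eq in \<open>auto elim!: eventually_mono\<close>)
qed simp

text \<open>The setting of the theorem with \<open>p\<close> for \<open>2 * q\<close>. The moment
  bound is stated for a single function, the form in which it is applied to restrictions of
  \<open>g\<close> to sets.\<close>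

locale moment_setting =
  fixes T :: "real ^ 'n" and M :: "nat \<Rightarrow> 'a measure" and \<theta> :: "nat \<Rightarrow> 'a \<Rightarrow> real ^ 'n \<Rightarrow> real"
    and N :: "'b measure" and W :: "(real ^ 'n \<Rightarrow> real) \<Rightarrow> 'b \<Rightarrow> real" and p m C :: real
  assumes T_pos: "\<And>i. 0 < T $ i"
    and prob: "\<And>n. prob_space (M n)"
    and meas: "\<And>n. (\<lambda>(\<omega>, u). \<theta> n \<omega> u) \<in> borel_measurable (M n \<Otimes>\<^sub>M lebesgue_on (cbox 0 T))"
    and W: "isonormal N (cbox 0 T) W"
    and fdd: "fdd_converge (cbox 0 T) M (\<lambda>n. integral_process T (\<theta> n) (\<lambda>_. 1)) N (brownian_sheet W)"
    and p2: "2 \<le> p"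
    and integ: "\<And>g n. g \<in> Lspace p (cbox 0 T) \<Longrightarrow>
      AE \<omega> in M n. integrable (lebesgue_on (cbox 0 T)) (\<lambda>u. g u * \<theta> n \<omega> u)"
    and m: "p < m" and C: "0 < C"
    and moment: "\<And>g n. g \<in> Lspace p (cbox 0 T) \<Longrightarrow>
      (\<integral>\<^sup>+ \<omega>. ennreal (\<bar>LINT u|lebesgue_on (cbox 0 T). g u * \<theta> n \<omega> u\<bar> powr m) \<partial>M n)
        \<le> ennreal (C * energy p (cbox 0 T) g powr (m / p))"
begin

sublocale box T p
  using T_pos p2 by unfold_locales auto

definition \<gamma> :: real where "\<gamma> = m / p"

lemma exponents: "1 < \<gamma>" "1 < m"
  using p2 m by (auto simp: \<gamma>_def)

sublocale L: finite_measure L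
  by (rule finite_measure_lebesgue_on) simp

text \<open>No integrability guard: the integral is \<open>0\<close> where
  \<open>g * \<theta>\<close> is not integrable. In contrast, \<open>integral_process\<close> sets
  the whole path to \<open>0\<close> there, so identities between the two are claimed on the event
  \<open>good\<close> only.\<close>

definition J :: "nat \<Rightarrow> (real ^ 'n \<Rightarrow> real) \<Rightarrow> 'a \<Rightarrow> real"
  where "J n g \<omega> = (LINT u|L. g u * \<theta> n \<omega> u)"

abbreviation good :: "nat \<Rightarrow> (real ^ 'n \<Rightarrow> real) \<Rightarrow> 'a \<Rightarrow> bool"
  where "good n g \<omega> \<equiv> integrable L (\<lambda>u. g u * \<theta> n \<omega> u)"

lemma measurable_pair:
  assumes "g \<in> borel_measurable L"
  shows "(\<lambda>(\<omega>, u). g u * \<theta> n \<omega> u) \<in> borel_measurable (M n \<Otimes>\<^sub>M L)"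
proof -
  have "(\<lambda>x. g (snd x) * (\<lambda>(\<omega>, u). \<theta> n \<omega> u) x) \<in> borel_measurable (M n \<Otimes>\<^sub>M L)"
    using assms meas by (intro borel_measurable_times measurable_compose[OF measurable_snd]) auto
  then show ?thesis by (simp add: case_prod_beta')
qed

lemma J_measurable: "g \<in> borel_measurable L \<Longrightarrow> J n g \<in> borel_measurable (M n)"
  unfolding J_def[abs_def] by (rule L.borel_measurable_lebesgue_integral[OF measurable_pair])

lemma good_measurable: "g \<in> borel_measurable L \<Longrightarrow> Measurable.pred (M n) (good n g)"
  by (rule L.borel_measurable_lebesgue_integrable[OF measurable_pair])

lemma moment_J:
  "g \<in> Lspace p K \<Longrightarrow> (\<integral>\<^sup>+\<omega>. ennreal (\<bar>J n g \<omega>\<bar> powr m) \<partial>M n) \<le> ennreal (C * energy p K g powr \<gamma>)"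
  unfolding J_def \<gamma>_def by (rule moment)

lemma mean_J:
  assumes g: "g \<in> Lspace p K" and \<eta>: "0 < \<eta>"
  shows "(\<integral>\<^sup>+\<omega>. ennreal \<bar>J n g \<omega>\<bar> \<partial>M n) \<le> ennreal (\<eta> + \<eta> powr (1 - m) * (C * energy p K g powr \<gamma>))"
proof -
  interpret prob_space "M n" by (rule prob)
  note [measurable] = J_measurable[OF LspaceD(1)[OF g], of n]
  have "(\<integral>\<^sup>+\<omega>. ennreal \<bar>J n g \<omega>\<bar> \<partial>M n) \<le> (\<integral>\<^sup>+\<omega>. ennreal \<eta> + ennreal (\<eta> powr (1 - m)) * ennreal (\<bar>J n g \<omega>\<bar> powr m) \<partial>M n)"
  proof (intro nn_integral_mono)
    fix \<omega>
    have "ennreal \<bar>J n g \<omega>\<bar> \<le> ennreal (\<eta> + \<eta> powr (1 - m) * \<bar>J n g \<omega>\<bar> powr m)"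
      using exponents \<eta> by (intro ennreal_leI le_add_powr) auto
    then show "ennreal \<bar>J n g \<omega>\<bar> \<le> ennreal \<eta> + ennreal (\<eta> powr (1 - m)) * ennreal (\<bar>J n g \<omega>\<bar> powr m)"
      using \<eta> by (simp add: ennreal_mult)
  qed
  also have "\<dots> = ennreal \<eta> + ennreal (\<eta> powr (1 - m)) * (\<integral>\<^sup>+\<omega>. ennreal (\<bar>J n g \<omega>\<bar> powr m) \<partial>M n)"
    by (simp add: nn_integral_add nn_integral_cmult emeasure_space_1)
  also have "\<dots> \<le> ennreal \<eta> + ennreal (\<eta> powr (1 - m)) * ennreal (C * energy p K g powr \<gamma>)"
    by (intro add_left_mono mult_left_mono moment_J g) auto
  also have "\<dots> = ennreal (\<eta> + \<eta> powr (1 - m) * (C * energy p K g powr \<gamma>))"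
    using \<eta> C by (simp add: ennreal_mult)
  finally show ?thesis .
qed

text \<open>The threshold \<open>e\<close> is uniform in \<open>n\<close> because \<open>C\<close>
  is. Half of \<open>d\<close> goes to the cut-off \<eta> of \<open>mean_J\<close>, half to the
  moment term.\<close>

lemma mean_J_small:
  assumes d: "0 < d"
  obtains e where "0 < e"
    "\<And>n g. g \<in> Lspace p K \<Longrightarrow> energy p K g < e \<Longrightarrow> (\<integral>\<^sup>+\<omega>. ennreal \<bar>J n g \<omega>\<bar> \<partial>M n) \<le> ennreal d"
proof -
  obtain e where e: "0 < e" "\<And>x. 0 \<le> x \<Longrightarrow> x < e \<Longrightarrow> ((d / 2) powr (1 - m) * C) * x powr \<gamma> \<le> d / 2"
    using powr_eventually_small[of "(d / 2) powr (1 - m) * C" "d / 2" \<gamma>] d C exponents by auto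
  show ?thesis
  proof (rule that[OF e(1)])
    fix n g assume g: "g \<in> Lspace p K" "energy p K g < e"
    have "d / 2 + (d / 2) powr (1 - m) * (C * energy p K g powr \<gamma>) \<le> d"
      using e(2)[OF energy_nonneg g(2)] by (simp add: mult.assoc)
    then show "(\<integral>\<^sup>+\<omega>. ennreal \<bar>J n g \<omega>\<bar> \<partial>M n) \<le> ennreal d"
      using mean_J[OF g(1), of "d / 2" n] d by (meson ennreal_leI half_gt_zero order_trans)
  qed
qed

lemma J_diff: "good n g \<omega> \<Longrightarrow> good n h \<omega> \<Longrightarrow> J n (\<lambda>u. g u - h u) \<omega> = J n g \<omega> - J n h \<omega>"
  unfolding J_def by (simp add: left_diff_distrib)

lemma good_diff: "good n g \<omega> \<Longrightarrow> good n h \<omega> \<Longrightarrow> good n (\<lambda>u. g u - h u) \<omega>"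
  by (simp add: left_diff_distrib)

lemma good_mult_indicator:
  assumes "good n g \<omega>" "A \<in> sets lebesgue" shows "good n (\<lambda>u. g u * indicator A u) \<omega>"
proof -
  have "integrable L (\<lambda>u. indicator (K \<inter> A) u *\<^sub>R (g u * \<theta> n \<omega> u))"
    using assms by (intro integrable_mult_indicator) (auto simp: sets_restrict_space)
  then show ?thesis
    by (rule Bochner_Integration.integrable_cong[OF refl, THEN iffD1, rotated]) (simp add: indicator_def)
qed

lemma integral_process_eq:
  assumes t: "t \<in> K" and g: "good n g \<omega>"
  shows "integral_process T (\<theta> n) g \<omega> t = J n (\<lambda>u. g u * indicator (cbox 0 t) u) \<omega>"
proof -
  have sub: "cbox 0 t \<subseteq> K" using t by (auto simp: mem_box_cart) (meson order_trans)
  have "integral_process T (\<theta> n) g \<omega> t = (LINT u|lebesgue. indicator (cbox 0 t) u *\<^sub>R (g u * \<theta> n \<omega> u))"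
    using t g by (simp add: integral_process_def integral_restrict_space)
  also have "\<dots> = (LINT u|lebesgue. indicator K u *\<^sub>R (g u * indicator (cbox 0 t) u * \<theta> n \<omega> u))"
    using sub by (intro Bochner_Integration.integral_cong) (auto simp: indicator_def)
  also have "\<dots> = J n (\<lambda>u. g u * indicator (cbox 0 t) u) \<omega>"
    by (simp add: J_def integral_restrict_space)
  finally show ?thesis .
qed

lemma integral_process_measurable:
  assumes g: "g \<in> Lspace p K" and t: "t \<in> K"
  shows "(\<lambda>\<omega>. integral_process T (\<theta> n) g \<omega> t) \<in> borel_measurable (M n)"
proof -
  have "(\<lambda>\<omega>. if good n g \<omega> then J n (\<lambda>u. g u * indicator (cbox 0 t) u) \<omega> else 0) \<in> borel_measurable (M n)"
    using g p2 by (intro measurable_If J_measurable LspaceD(1)[OF Lspace_mult_indicator(1)] predE[OF good_measurable] LspaceD(1)[OF g]) auto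
  also have "(\<lambda>\<omega>. if good n g \<omega> then J n (\<lambda>u. g u * indicator (cbox 0 t) u) \<omega> else 0)
      = (\<lambda>\<omega>. integral_process T (\<theta> n) g \<omega> t)"
    using t integral_process_eq[OF t] by (auto simp: integral_process_def fun_eq_iff)
  finally show ?thesis .
qed

lemma Lspace_1: "(\<lambda>_. 1) \<in> Lspace p K"
  using p by (intro Lspace_bounded[where c=1]) auto

lemma corner_cbox_AE: "AE u in L. corner t u = indicator (cbox 0 t) u"
  using AE_hyperplanes[of 0] AE_space
proof eventually_elim
  case (elim u)
  then have "0 < u $ i" for i by (auto simp: mem_box_cart order.strict_iff_order)
  then show ?case by (auto simp: corner_def indicator_def mem_box_cart less_imp_le)
qed

text \<open>The bridge to the hypothesis on finite dimensional distributions: corner boxes agree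
  almost everywhere with the closed boxes over which the approximating sheets integrate, so a step
  function sees the process only at the points of \<open>S\<close>.\<close>

lemma J_step:
  assumes S: "finite S" "S \<subseteq> K" and g: "good n (\<lambda>_. 1) \<omega>" and m\<theta>: "\<theta> n \<omega> \<in> borel_measurable L"
  shows "J n (step S a) \<omega> = (\<Sum>s\<in>S. a s * integral_process T (\<theta> n) (\<lambda>_. 1) \<omega> s)"
    "good n (step S a) \<omega>"
proof -
  have i: "integrable L (\<lambda>u. indicator (cbox 0 s) u * \<theta> n \<omega> u)" for s
    using good_mult_indicator[OF g, of "cbox 0 s"] by simp
  have AE: "AE u in L. (\<Sum>s\<in>S. a s * (indicator (cbox 0 s) u * \<theta> n \<omega> u)) = step S a u * \<theta> n \<omega> u"
  proof -
    have "AE u in L. \<forall>s\<in>S. corner s u = indicator (cbox 0 s) u"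
      using corner_cbox_AE S(1) by (subst AE_finite_all) auto
    then show ?thesis
      by eventually_elim (simp add: step_def sum_distrib_right mult.assoc)
  qed
  have mstep: "(\<lambda>u. step S a u * \<theta> n \<omega> u) \<in> borel_measurable L"
    using LspaceD(1)[OF step_Lspace] m\<theta> by auto
  have isum: "integrable L (\<lambda>u. \<Sum>s\<in>S. a s * (indicator (cbox 0 s) u * \<theta> n \<omega> u))"
    using i by auto
  show "good n (step S a) \<omega>"
    using isum AE mstep by (subst integrable_cong_AE[symmetric, OF _ _ AE]) auto
  have "J n (step S a) \<omega> = (LINT u|L. (\<Sum>s\<in>S. a s * (indicator (cbox 0 s) u * \<theta> n \<omega> u)))"
    unfolding J_def using isum AE mstep by (intro integral_cong_AE) auto
  also have "\<dots> = (\<Sum>s\<in>S. a s * (LINT u|L. indicator (cbox 0 s) u * \<theta> n \<omega> u))"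
    using i by (simp add: Bochner_Integration.integral_sum)
  also have "\<dots> = (\<Sum>s\<in>S. a s * integral_process T (\<theta> n) (\<lambda>_. 1) \<omega> s)"
    using S(2) g by (intro sum.cong) (auto simp: integral_process_eq J_def)
  finally show "J n (step S a) \<omega> = (\<Sum>s\<in>S. a s * integral_process T (\<theta> n) (\<lambda>_. 1) \<omega> s)" .
qed

lemma \<theta>_section: "\<omega> \<in> space (M n) \<Longrightarrow> \<theta> n \<omega> \<in> borel_measurable L"
  using measurable_Pair2[OF meas] by simp

section \<open>Second moments on the Gaussian side\<close>

sublocale N: prob_space N
  using W by (simp add: isonormal_def)

lemma W_normal: assumes "h \<in> Lspace 2 K" shows "centered_normal N (W h)"
proof -
  have "centered_gaussian_process N (Lspace 2 K) W" using W by (simp add: isonormal_def)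
  from this[unfolded centered_gaussian_process_def, rule_format, of "{h}" "\<lambda>_. 1"] assms
  show ?thesis by simp
qed

lemma W_measurable: "h \<in> Lspace 2 K \<Longrightarrow> W h \<in> borel_measurable N"
  using W_normal by (simp add: centered_normal_def)

text \<open>The covariance identity alone would not exclude a non-integrable square, whose Bochner
  integral is \<open>0\<close> by convention. Integrability comes from the normal density, or from
  vanishing almost surely in the degenerate case.\<close>

lemma W_square_integrable: assumes h: "h \<in> Lspace 2 K" shows "integrable N (\<lambda>\<omega>. (W h \<omega>)\<^sup>2)"
proof -
  note [measurable] = W_measurable[OF h]
  consider "AE \<omega> in N. W h \<omega> = 0" | \<sigma> where "\<sigma> > 0" "distributed N lborel (W h) (normal_density 0 \<sigma>)"
    using W_normal[OF h] by (auto simp: centered_normal_def)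
  then show ?thesis
  proof cases
    case 1
    then have "AE \<omega> in N. (W h \<omega>)\<^sup>2 = 0" by eventually_elim simp
    then show ?thesis by (subst integrable_cong_AE[of _ _ "\<lambda>_. 0"]) auto
  next
    case 2
    have "integrable lborel (\<lambda>x. normal_density 0 \<sigma> x * x\<^sup>2)"
      using integrable_normal_moment[OF 2(1), of 0 2] by simp
    then show ?thesis
      by (subst distributed_integrable[OF 2(2), symmetric]) auto
  qed
qed

lemma integrable_mult_squares:
  fixes f g :: "'c \<Rightarrow> real"
  assumes [measurable]: "f \<in> borel_measurable Q" "g \<in> borel_measurable Q"
    and "integrable Q (\<lambda>x. (f x)\<^sup>2)" "integrable Q (\<lambda>x. (g x)\<^sup>2)"
  shows "integrable Q (\<lambda>x. f x * g x)"
proof (rule Bochner_Integration.integrable_bound)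
  show "integrable Q (\<lambda>x. (f x)\<^sup>2 + (g x)\<^sup>2)" using assms by auto
  show "AE x in Q. norm (f x * g x) \<le> norm ((f x)\<^sup>2 + (g x)\<^sup>2)"
  proof (intro AE_I2)
    fix x
    have "2 * (\<bar>f x\<bar> * \<bar>g x\<bar>) \<le> (f x)\<^sup>2 + (g x)\<^sup>2"
      using sum_squares_bound[of "\<bar>f x\<bar>" "\<bar>g x\<bar>"] by simp
    moreover have "0 \<le> \<bar>f x\<bar> * \<bar>g x\<bar>" by simp
    ultimately have "\<bar>f x\<bar> * \<bar>g x\<bar> \<le> (f x)\<^sup>2 + (g x)\<^sup>2" by linarith
    then show "norm (f x * g x) \<le> norm ((f x)\<^sup>2 + (g x)\<^sup>2)" by (simp add: abs_mult)
  qed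
qed auto

lemma W_combination_square:
  assumes I: "finite I" and x: "\<And>i. i \<in> I \<Longrightarrow> x i \<in> Lspace 2 K"
  shows "integrable N (\<lambda>\<omega>. (\<Sum>i\<in>I. b i * W (x i) \<omega>)\<^sup>2)"
    "(LINT \<omega>|N. (\<Sum>i\<in>I. b i * W (x i) \<omega>)\<^sup>2) = (LINT u|L. (\<Sum>i\<in>I. b i * x i u)\<^sup>2)"
proof -
  have sq: "\<bar>z\<bar> powr 2 = z\<^sup>2" for z :: real by (cases "z = 0") auto
  have expand: "(\<Sum>i\<in>I. b i * y i)\<^sup>2 = (\<Sum>i\<in>I. \<Sum>j\<in>I. (b i * b j) * (y i * y j))" for y :: "_ \<Rightarrow> real"
    by (simp add: power2_eq_square sum_product mult_ac)
  have iN: "integrable N (\<lambda>\<omega>. W (x i) \<omega> * W (x j) \<omega>)" if "i \<in> I" "j \<in> I" for i j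
    using x that by (intro integrable_mult_squares W_measurable W_square_integrable) auto
  have iL: "integrable L (\<lambda>u. x i u * x j u)" if "i \<in> I" "j \<in> I" for i j
    using LspaceD[OF x[OF that(1)]] LspaceD[OF x[OF that(2)]] by (intro integrable_mult_squares) (auto simp: sq)
  have cov: "(LINT \<omega>|N. W (x i) \<omega> * W (x j) \<omega>) = (LINT u|L. x i u * x j u)" if "i \<in> I" "j \<in> I" for i j
    using W x that by (simp add: isonormal_def)
  show "integrable N (\<lambda>\<omega>. (\<Sum>i\<in>I. b i * W (x i) \<omega>)\<^sup>2)"
    unfolding expand using iN by (intro Bochner_Integration.integrable_sum integrable_mult_right) auto
  show "(LINT \<omega>|N. (\<Sum>i\<in>I. b i * W (x i) \<omega>)\<^sup>2) = (LINT u|L. (\<Sum>i\<in>I. b i * x i u)\<^sup>2)"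
    unfolding expand using iN iL cov by (simp add: Bochner_Integration.integral_sum)
qed

lemma corner_Lspace: "0 \<le> r \<Longrightarrow> corner s \<in> Lspace r K"
  by (intro Lspace_bounded[OF _ corner_measurable corner_bound]) auto

lemma W_step_square:
  assumes h: "h \<in> Lspace 2 K" and S: "finite S"
  shows "integrable N (\<lambda>\<omega>. (W h \<omega> - (\<Sum>s\<in>S. a s * W (corner s) \<omega>))\<^sup>2)"
    "(LINT \<omega>|N. (W h \<omega> - (\<Sum>s\<in>S. a s * W (corner s) \<omega>))\<^sup>2) = (LINT u|L. (h u - step S a u)\<^sup>2)"
proof -
  \<comment> \<open>Tagging with \<open>option\<close> keeps \<open>h\<close> apart from the corner
    functions, and these apart from each other, even if some of them coincide as functions.\<close>
  define I where "I = insert None (Some ` S)"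
  define x where "x = (\<lambda>i. case i of None \<Rightarrow> h | Some s \<Rightarrow> corner s)"
  define b where "b = (\<lambda>i. case i of None \<Rightarrow> 1 | Some s \<Rightarrow> - a s)"
  have I: "finite I" "\<And>i. i \<in> I \<Longrightarrow> x i \<in> Lspace 2 K"
    using S h corner_Lspace[of 2] by (auto simp: I_def x_def)
  have sum: "(\<Sum>i\<in>I. b i * y (x i)) = y h - (\<Sum>s\<in>S. a s * y (corner s))" for y :: "(real ^ 'n \<Rightarrow> real) \<Rightarrow> real"
    using S by (simp add: I_def sum.reindex b_def x_def sum_negf)
  show "integrable N (\<lambda>\<omega>. (W h \<omega> - (\<Sum>s\<in>S. a s * W (corner s) \<omega>))\<^sup>2)"
    "(LINT \<omega>|N. (W h \<omega> - (\<Sum>s\<in>S. a s * W (corner s) \<omega>))\<^sup>2) = (LINT u|L. (h u - step S a u)\<^sup>2)"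
    using W_combination_square[where I=I and x=x and b=b, OF I] sum[of "\<lambda>z. W z _"] sum[of "\<lambda>z. z _"] by (auto simp: step_def)
qed

lemma mean_W_small:
  assumes d: "0 < d"
  obtains e where "0 < e"
    "\<And>h S a. h \<in> Lspace p K \<Longrightarrow> finite S \<Longrightarrow> energy p K (\<lambda>u. h u - step S a u) < e \<Longrightarrow>
      (\<integral>\<^sup>+\<omega>. ennreal \<bar>W h \<omega> - (\<Sum>s\<in>S. a s * W (corner s) \<omega>)\<bar> \<partial>N) \<le> ennreal d"
proof -
  \<comment> \<open>Makes the first term of \<open>Lspace_square\<close> at most
    \<open>d\<^sup>2 / 8\<close>; \<open>e\<close> does the same for the second, so the second
    moment of the error is at most \<open>d\<^sup>2 / 4\<close>. The added 1 keeps the denominator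
    positive.\<close>
  define \<eta> where "\<eta> = d\<^sup>2 / (8 * (measure lebesgue K + 1))"
  have mK: "0 < measure lebesgue K + 1" by (simp add: add_nonneg_pos)
  then have \<eta>: "0 < \<eta>" "\<eta> * measure lebesgue K \<le> d\<^sup>2 / 8" using d by (auto simp: \<eta>_def field_simps)
  obtain e where e: "0 < e" "\<And>x. 0 \<le> x \<Longrightarrow> x < e \<Longrightarrow> \<eta> powr (1 - p / 2) * x powr 1 \<le> d\<^sup>2 / 8"
    using powr_eventually_small[of "\<eta> powr (1 - p / 2)" "d\<^sup>2 / 8" 1] d by auto
  show ?thesis
  proof (rule that[OF e(1)])
    fix h S a assume h: "h \<in> Lspace p K" and S: "finite S" and small: "energy p K (\<lambda>u. h u - step S a u) < e"
    define D where "D = (\<lambda>\<omega>. W h \<omega> - (\<Sum>s\<in>S. a s * W (corner s) \<omega>))"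
    have h2: "h \<in> Lspace 2 K" using Lspace_square(1)[OF _ h p2] by simp
    have "(LINT \<omega>|N. (D \<omega>)\<^sup>2) = (LINT u|L. (h u - step S a u)\<^sup>2)"
      unfolding D_def by (rule W_step_square(2)[OF h2 S])
    also have "\<dots> \<le> \<eta> * measure lebesgue K + \<eta> powr (1 - p / 2) * energy p K (\<lambda>u. h u - step S a u)"
      using \<eta> by (intro Lspace_square(3)[OF _ Lspace_diff(1)[OF h step_Lspace p] p2]) auto
    also have "\<dots> \<le> d\<^sup>2 / 4" using \<eta>(2) e(2)[OF energy_nonneg small] energy_nonneg[of p K "\<lambda>u. h u - step S a u"]
      by (simp add: powr_one)
    finally have sq: "(LINT \<omega>|N. (D \<omega>)\<^sup>2) \<le> d\<^sup>2 / 4" .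
    have iD: "integrable N (\<lambda>\<omega>. (D \<omega>)\<^sup>2)" unfolding D_def by (rule W_step_square(1)[OF h2 S])
    \<comment> \<open>Completing a square in place of Cauchy-Schwarz: a second moment of at most
      \<open>d\<^sup>2 / 4\<close> then gives a mean of at most
      \<open>d / 2 + d / 2\<close>.\<close>
    have le: "\<bar>D \<omega>\<bar> \<le> d / 2 + 2 / d * (D \<omega>)\<^sup>2" for \<omega>
    proof -
      have "0 \<le> (\<bar>D \<omega>\<bar> - d / 2)\<^sup>2" by simp
      then have "d * \<bar>D \<omega>\<bar> \<le> (D \<omega>)\<^sup>2 + d\<^sup>2 / 4" by (simp add: power2_eq_square algebra_simps)
      also have "\<dots> \<le> 2 * (D \<omega>)\<^sup>2 + d\<^sup>2 / 2" by simp
      also have "\<dots> = d * (d / 2 + 2 / d * (D \<omega>)\<^sup>2)" using d by (simp add: power2_eq_square algebra_simps)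
      finally have "d * \<bar>D \<omega>\<bar> \<le> d * (d / 2 + 2 / d * (D \<omega>)\<^sup>2)" .
      then show ?thesis using d by simp
    qed
    have "(\<integral>\<^sup>+\<omega>. ennreal \<bar>D \<omega>\<bar> \<partial>N) \<le> (\<integral>\<^sup>+\<omega>. ennreal (d / 2 + 2 / d * (D \<omega>)\<^sup>2) \<partial>N)"
      by (intro nn_integral_mono ennreal_leI le)
    also have "\<dots> = ennreal (LINT \<omega>|N. d / 2 + 2 / d * (D \<omega>)\<^sup>2)"
      using iD d by (intro nn_integral_eq_integral) auto
    also have "(LINT \<omega>|N. d / 2 + 2 / d * (D \<omega>)\<^sup>2) = d / 2 + 2 / d * (LINT \<omega>|N. (D \<omega>)\<^sup>2)"
      using iD by (simp add: N.prob_space)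
    also have "\<dots> \<le> d / 2 + 2 / d * (d\<^sup>2 / 4)" using sq d by (intro add_left_mono mult_left_mono) auto
    also have "\<dots> = d" using d by (simp add: power2_eq_square)
    finally show "(\<integral>\<^sup>+\<omega>. ennreal \<bar>W h \<omega> - (\<Sum>s\<in>S. a s * W (corner s) \<omega>)\<bar> \<partial>N) \<le> ennreal d"
      using d by (simp add: D_def ennreal_leI)
  qed
qed

text \<open>One family of step functions approximates both sides: it is close to \<open>h i\<close>
  by density and to \<open>g n i\<close> for large \<open>n\<close>, with mean errors that are
  uniform in \<open>n\<close>. Between the two step integrals only the convergence of the
  approximating sheets is needed.\<close>

theorem integrals_converge:
  fixes h :: "'i \<Rightarrow> real ^ 'n \<Rightarrow> real"
  assumes I: "finite I" and h: "\<And>i. i \<in> I \<Longrightarrow> h i \<in> Lspace p K"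
    and g: "\<And>n i. i \<in> I \<Longrightarrow> g n i \<in> Lspace p K"
    and lim: "\<And>i. i \<in> I \<Longrightarrow> (\<lambda>n. energy p K (\<lambda>u. g n i u - h i u)) \<longlonglongrightarrow> 0"
    and \<Phi>: "coord_lipschitz I k0 \<Phi>" and b: "\<And>x. \<bar>\<Phi> x\<bar> \<le> b"
  shows "(\<lambda>n. LINT \<omega>|M n. \<Phi> (\<lambda>i. J n (g n i) \<omega>)) \<longlonglongrightarrow> (LINT \<omega>|N. \<Phi> (\<lambda>i. W (h i) \<omega>))"
proof (rule LIMSEQ_I)
  fix \<epsilon> :: real assume \<epsilon>: "0 < \<epsilon>"
  define k where "k = max 0 k0"
  have k: "0 \<le> k" by (simp add: k_def)
  have \<Phi>k: "coord_lipschitz I k \<Phi>"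
    unfolding coord_lipschitz_def
  proof (intro allI)
    fix x y
    have "k0 * (\<Sum>c\<in>I. \<bar>x c - y c\<bar>) \<le> k * (\<Sum>c\<in>I. \<bar>x c - y c\<bar>)"
      by (intro mult_right_mono sum_nonneg) (auto simp: k_def)
    then show "\<bar>\<Phi> x - \<Phi> y\<bar> \<le> k * (\<Sum>c\<in>I. \<bar>x c - y c\<bar>)" using coord_lipschitzD[OF \<Phi>, of x y] by linarith
  qed
  \<comment> \<open>Each replacement by step functions then costs at most
    \<open>\<epsilon> / 4\<close>, as does the convergence of the step integrals. The added 1 avoids
    division by zero.\<close>
  define d where "d = \<epsilon> / (4 * (k * card I + 1))"
  have kI: "0 < k * card I + 1" using k by (simp add: add_nonneg_pos)
  then have d: "0 < d" using \<epsilon> by (simp add: d_def)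
  have "k * (card I * d) \<le> (k * card I + 1) * d" using d by (simp add: algebra_simps)
  also have "\<dots> = \<epsilon> / 4"
  proof -
    have "q * (\<epsilon> / (4 * q)) = \<epsilon> / 4" if "0 < q" for q using that by simp
    then show ?thesis using kI unfolding d_def by blast
  qed
  finally have kd: "k * (card I * d) \<le> \<epsilon> / 4" .
  obtain e1 where e1: "0 < e1"
    "\<And>n g. g \<in> Lspace p K \<Longrightarrow> energy p K g < e1 \<Longrightarrow> (\<integral>\<^sup>+\<omega>. ennreal \<bar>J n g \<omega>\<bar> \<partial>M n) \<le> ennreal d"
    using mean_J_small[OF d] by blast
  obtain e2 where e2: "0 < e2"
    "\<And>h S a. h \<in> Lspace p K \<Longrightarrow> finite S \<Longrightarrow> energy p K (\<lambda>u. h u - step S a u) < e2 \<Longrightarrow>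
      (\<integral>\<^sup>+\<omega>. ennreal \<bar>W h \<omega> - (\<Sum>s\<in>S. a s * W (corner s) \<omega>)\<bar> \<partial>N) \<le> ennreal d"
    using mean_W_small[OF d] by blast
  \<comment> \<open>The errors from \<open>g n i\<close> to \<open>h i\<close> and from
    \<open>h i\<close> to its step function, combined by \<open>energy_triangle\<close>, stay below
    \<open>e1\<close>.\<close>
  define e where "e = e1 / (2 * 2 powr p)"
  have e: "0 < e" "2 powr p * (e + e) = e1" using e1(1) by (auto simp: e_def)
  have "\<forall>i\<in>I. \<exists>S a. finite S \<and> S \<subseteq> K \<and> energy p K (\<lambda>u. h i u - step S a u) < min e e2"
    using approxE[OF steps_dense[OF h], of _ "min e e2"] e(1) e2(1) by (metis min_less_iff_conj)
  then obtain S a where S: "\<And>i. i \<in> I \<Longrightarrow> finite (S i)" "\<And>i. i \<in> I \<Longrightarrow> S i \<subseteq> K"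
    "\<And>i. i \<in> I \<Longrightarrow> energy p K (\<lambda>u. h i u - step (S i) (a i) u) < min e e2" by metis
  \<comment> \<open>The linear combinations that express step integrals through the sheet are
    composed into the test function; the sum \<open>A\<close> of their coefficients enters the
    Lipschitz constant.\<close>
  define \<Psi> where "\<Psi> = (\<lambda>x. \<Phi> (\<lambda>i. \<Sum>s\<in>S i. a i s * x s))"
  define A where "A = (\<Sum>i\<in>I. \<Sum>s\<in>S i. \<bar>a i s\<bar>)"
  define SI where "SI = (\<Union>i\<in>I. S i)"
  have SI: "finite SI" "SI \<subseteq> K" using S I by (auto simp: SI_def)
  have \<Psi>: "coord_lipschitz SI (k * A) \<Psi>"
    unfolding coord_lipschitz_def
  proof (intro allI)
    fix x y :: "real ^ 'n \<Rightarrow> real"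
    have "\<bar>\<Psi> x - \<Psi> y\<bar> \<le> k * (\<Sum>i\<in>I. \<bar>(\<Sum>s\<in>S i. a i s * x s) - (\<Sum>s\<in>S i. a i s * y s)\<bar>)"
      unfolding \<Psi>_def by (rule coord_lipschitzD[OF \<Phi>k])
    also have "\<dots> \<le> k * (\<Sum>i\<in>I. \<Sum>s\<in>S i. \<bar>a i s\<bar> * (\<Sum>c\<in>SI. \<bar>x c - y c\<bar>))"
    proof (intro mult_left_mono sum_mono k)
      fix i assume i: "i \<in> I"
      have "\<bar>(\<Sum>s\<in>S i. a i s * x s) - (\<Sum>s\<in>S i. a i s * y s)\<bar> = \<bar>\<Sum>s\<in>S i. a i s * (x s - y s)\<bar>"
        by (simp add: right_diff_distrib sum_subtractf)
      also have "\<dots> \<le> (\<Sum>s\<in>S i. \<bar>a i s * (x s - y s)\<bar>)" by (rule sum_abs)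
      also have "\<dots> \<le> (\<Sum>s\<in>S i. \<bar>a i s\<bar> * (\<Sum>c\<in>SI. \<bar>x c - y c\<bar>))"
      proof (intro sum_mono)
        fix s assume "s \<in> S i"
        then have "\<bar>x s - y s\<bar> \<le> (\<Sum>c\<in>SI. \<bar>x c - y c\<bar>)"
          using i SI by (intro member_le_sum[of s SI "\<lambda>c. \<bar>x c - y c\<bar>"]) (auto simp: SI_def)
        then show "\<bar>a i s * (x s - y s)\<bar> \<le> \<bar>a i s\<bar> * (\<Sum>c\<in>SI. \<bar>x c - y c\<bar>)"
          unfolding abs_mult by (rule mult_left_mono) simp
      qed
      finally show "\<bar>(\<Sum>s\<in>S i. a i s * x s) - (\<Sum>s\<in>S i. a i s * y s)\<bar> \<le> (\<Sum>s\<in>S i. \<bar>a i s\<bar> * (\<Sum>c\<in>SI. \<bar>x c - y c\<bar>))" .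
    qed
    also have "\<dots> = k * A * (\<Sum>c\<in>SI. \<bar>x c - y c\<bar>)"
      by (simp add: A_def sum_distrib_right mult.assoc)
    finally show "\<bar>\<Psi> x - \<Psi> y\<bar> \<le> k * A * (\<Sum>c\<in>SI. \<bar>x c - y c\<bar>)" .
  qed
  define \<zeta> where "\<zeta> = (\<lambda>n. integral_process T (\<theta> n) (\<lambda>_. 1))"
  have W_corner: "brownian_sheet W \<omega> t = W (corner t) \<omega>" for \<omega> t
    by (simp add: brownian_sheet_def corner_def)
  have "(\<lambda>n. LINT \<omega>|M n. \<Psi> (\<zeta> n \<omega>)) \<longlonglongrightarrow> (LINT \<omega>|N. \<Psi> (brownian_sheet W \<omega>))"
    using fdd SI b unfolding fdd_converge_def \<zeta>_def
    by (intro coord_lipschitz_converges_in_law[OF SI(1) \<Psi>, where b=b]) (auto simp: \<Psi>_def)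
  then have step_lim: "\<forall>\<^sub>F n in sequentially. \<bar>(LINT \<omega>|M n. \<Psi> (\<zeta> n \<omega>)) - (LINT \<omega>|N. \<Psi> (brownian_sheet W \<omega>))\<bar> < \<epsilon> / 4"
    unfolding dist_real_def[symmetric] using \<epsilon> by (intro tendstoD) auto
  have W_err: "\<bar>(LINT \<omega>|N. \<Phi> (\<lambda>i. W (h i) \<omega>)) - (LINT \<omega>|N. \<Psi> (brownian_sheet W \<omega>))\<bar> \<le> k * (card I * d)"
    unfolding \<Psi>_def W_corner
  proof (rule lipschitz_mean_diff[OF N.prob_space_axioms I \<Phi>k k b])
    fix i assume i: "i \<in> I"
    show "(\<integral>\<^sup>+\<omega>. ennreal \<bar>W (h i) \<omega> - (\<Sum>s\<in>S i. a i s * W (corner s) \<omega>)\<bar> \<partial>N) \<le> ennreal d"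
      using S(3)[OF i] by (intro e2(2) h i S(1)) auto
    show "(\<lambda>\<omega>. W (h i) \<omega>) \<in> borel_measurable N"
      using Lspace_square(1)[OF _ h[OF i] p2] by (intro W_measurable) auto
    show "(\<lambda>\<omega>. \<Sum>s\<in>S i. a i s * W (corner s) \<omega>) \<in> borel_measurable N"
      using W_measurable[OF corner_Lspace[of 2]] by auto
  qed (use d in auto)
  have "\<forall>\<^sub>F n in sequentially. \<forall>i\<in>I. energy p K (\<lambda>u. g n i u - h i u) < e"
    using lim e(1) by (intro eventually_ball_finite I ballI order_tendstoD(2)) auto
  with step_lim have "\<forall>\<^sub>F n in sequentially.
      norm ((LINT \<omega>|M n. \<Phi> (\<lambda>i. J n (g n i) \<omega>)) - (LINT \<omega>|N. \<Phi> (\<lambda>i. W (h i) \<omega>))) < \<epsilon>"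
  proof eventually_elim
    case (elim n)
    have ae: "AE \<omega> in M n. \<forall>i\<in>I. J n (step (S i) (a i)) \<omega> = (\<Sum>s\<in>S i. a i s * \<zeta> n \<omega> s)
        \<and> J n (\<lambda>u. g n i u - step (S i) (a i) u) \<omega> = J n (g n i) \<omega> - J n (step (S i) (a i)) \<omega>"
    proof -
      have "AE \<omega> in M n. \<forall>i\<in>I. good n (g n i) \<omega>" using I integ g by (subst AE_finite_all) auto
      then show ?thesis
        using integ[OF Lspace_1, of n] AE_space
      proof eventually_elim
        case (elim \<omega>)
        show ?case
          using J_step[OF S(1,2) elim(2) \<theta>_section[OF elim(3)]] elim(1) by (auto simp: \<zeta>_def J_diff)
      qed
    qed
    have "\<bar>(LINT \<omega>|M n. \<Phi> (\<lambda>i. J n (g n i) \<omega>)) - (LINT \<omega>|M n. \<Phi> (\<lambda>i. \<Sum>s\<in>S i. a i s * \<zeta> n \<omega> s))\<bar> \<le> k * (card I * d)"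
    proof (rule lipschitz_mean_diff[OF prob I \<Phi>k k b])
      fix i assume i: "i \<in> I"
      have gs: "(\<lambda>u. g n i u - step (S i) (a i) u) \<in> Lspace p K"
        by (intro Lspace_diff(1) g i step_Lspace p)
      have "energy p K (\<lambda>u. g n i u - step (S i) (a i) u)
          \<le> 2 powr p * (energy p K (\<lambda>u. g n i u - h i u) + energy p K (\<lambda>u. h i u - step (S i) (a i) u))"
        by (intro energy_triangle g h i step_Lspace p)
      also have "\<dots> < 2 powr p * (e + e)"
        using elim(2) i S(3)[OF i] by (intro mult_strict_left_mono add_strict_mono) auto
      finally have "(\<integral>\<^sup>+\<omega>. ennreal \<bar>J n (\<lambda>u. g n i u - step (S i) (a i) u) \<omega>\<bar> \<partial>M n) \<le> ennreal d"
        using e(2) by (intro e1(2) gs) auto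
      also have "(\<integral>\<^sup>+\<omega>. ennreal \<bar>J n (\<lambda>u. g n i u - step (S i) (a i) u) \<omega>\<bar> \<partial>M n)
          = (\<integral>\<^sup>+\<omega>. ennreal \<bar>J n (g n i) \<omega> - (\<Sum>s\<in>S i. a i s * \<zeta> n \<omega> s)\<bar> \<partial>M n)"
        using ae by (intro nn_integral_cong_AE) (auto elim!: eventually_mono simp: i)
      finally show "(\<integral>\<^sup>+\<omega>. ennreal \<bar>J n (g n i) \<omega> - (\<Sum>s\<in>S i. a i s * \<zeta> n \<omega> s)\<bar> \<partial>M n) \<le> ennreal d" .
      show "(\<lambda>\<omega>. J n (g n i) \<omega>) \<in> borel_measurable (M n)" using J_measurable[OF LspaceD(1)[OF g[OF i]]] by simp
      show "(\<lambda>\<omega>. \<Sum>s\<in>S i. a i s * \<zeta> n \<omega> s) \<in> borel_measurable (M n)"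
        unfolding \<zeta>_def using S(2)[OF i]
        by (intro borel_measurable_sum borel_measurable_times borel_measurable_const integral_process_measurable[OF Lspace_1]) auto
    qed (use d in auto)
    then have "\<bar>(LINT \<omega>|M n. \<Phi> (\<lambda>i. J n (g n i) \<omega>)) - (LINT \<omega>|M n. \<Psi> (\<zeta> n \<omega>))\<bar> \<le> \<epsilon> / 4"
      using kd by (simp add: \<Psi>_def)
    then show ?case using W_err kd elim(1) \<epsilon> unfolding real_norm_def by linarith
  qed
  then show "\<exists>n0. \<forall>n\<ge>n0. norm ((LINT \<omega>|M n. \<Phi> (\<lambda>i. J n (g n i) \<omega>)) - (LINT \<omega>|N. \<Phi> (\<lambda>i. W (h i) \<omega>))) < \<epsilon>"
    by (simp add: eventually_sequentially)
qed

end

section \<open>Oscillations\<close>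

text \<open>Open on the left, so that it is disjoint from the half-space
  \<open>u $ k \<le> l * \<delta>\<close> in which two boxes differing in coordinate
  \<open>k\<close> agree.\<close>

definition slab :: "real ^ 'n \<Rightarrow> real \<Rightarrow> 'n \<Rightarrow> nat \<Rightarrow> (real ^ 'n) set"
  where "slab T \<delta> k l = {u \<in> cbox 0 T. l * \<delta> < u $ k \<and> u $ k \<le> l * \<delta> + 2 * \<delta>}"

lemma slab_sets: "slab T \<delta> k l \<in> sets lebesgue"
proof -
  have "slab T \<delta> k l = cbox 0 T \<inter> ({u. l * \<delta> < u $ k} \<inter> {u. u $ k \<le> l * \<delta> + 2 * \<delta>})"
    by (auto simp: slab_def)
  also have "\<dots> \<in> sets borel" by (intro sets.Int) auto
  finally show ?thesis by auto
qed

text \<open>The factors \<open>max 1 (T $ i)\<close> allow the missing side in direction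
  \<open>k\<close> to be put back, so that one bound, linear in \<delta>, serves all slabs.\<close>

lemma measure_slab_le:
  fixes T :: "real ^ 'n"
  assumes T: "\<And>i. 0 < T $ i" and \<delta>: "0 < \<delta>"
  shows "measure lebesgue (slab T \<delta> k l) \<le> 2 * \<delta> * (\<Prod>i\<in>UNIV. max 1 (T $ i))"
proof -
  define a b :: "real ^ 'n" where "a = (\<chi> i. if i = k then l * \<delta> else 0)"
    and "b = (\<chi> i. if i = k then l * \<delta> + 2 * \<delta> else T $ i)"
  have ab: "a $ i \<le> b $ i" for i using T[of i] \<delta> by (simp add: a_def b_def less_imp_le)
  have "slab T \<delta> k l \<subseteq> cbox a b"
    by (auto simp: slab_def a_def b_def mem_box_cart)
  then have "measure lebesgue (slab T \<delta> k l) \<le> measure lebesgue (cbox a b)"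
    by (intro measure_mono_fmeasurable slab_sets) auto
  also have "\<dots> = (\<Prod>i\<in>UNIV. b $ i - a $ i)"
    using content_cbox_cart[of a b] ab by (simp add: interval_ne_empty_cart)
  also have "\<dots> = 2 * \<delta> * (\<Prod>i\<in>UNIV - {k}. T $ i)"
    by (subst prod.remove[of _ k]) (auto simp: a_def b_def intro!: prod.cong)
  also have "\<dots> \<le> 2 * \<delta> * (\<Prod>i\<in>UNIV - {k}. max 1 (T $ i))"
    using \<delta> T by (intro mult_left_mono prod_mono) (auto simp: less_imp_le)
  also have "\<dots> \<le> 2 * \<delta> * (\<Prod>i\<in>UNIV. max 1 (T $ i))"
  proof (intro mult_left_mono)
    have "1 * (\<Prod>i\<in>UNIV - {k}. max 1 (T $ i)) \<le> max 1 (T $ k) * (\<Prod>i\<in>UNIV - {k}. max 1 (T $ i))"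
      by (intro mult_right_mono prod_nonneg) auto
    then show "(\<Prod>i\<in>UNIV - {k}. max 1 (T $ i)) \<le> (\<Prod>i\<in>UNIV. max 1 (T $ i))"
      by (subst (2) prod.remove[of _ k]) auto
  qed (use \<delta> in auto)
  finally show ?thesis .
qed

locale additive_set_function =
  fixes T :: "real ^ 'n" and \<nu> :: "(real ^ 'n) set \<Rightarrow> real"
  assumes add: "A \<in> sets lebesgue \<Longrightarrow> B \<in> sets lebesgue \<Longrightarrow> A \<inter> B = {} \<Longrightarrow> \<nu> (A \<union> B) = \<nu> A + \<nu> B"
begin

lemma lower_set_sets: "{u :: real ^ 'n. \<forall>i. u $ i \<le> c $ i} \<in> sets lebesgue"
proof -
  have "{u :: real ^ 'n. \<forall>i. u $ i \<le> c $ i} = {..c}" by (auto simp: less_eq_vec_def)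
  then show ?thesis by simp
qed

text \<open>Below height \<open>l * \<delta>\<close> in direction \<open>k\<close> the boxes have
  the same part \<open>Q\<close>, which cancels. What remains of each box is a lower set intersected
  with the slab.\<close>

lemma increment_one:
  assumes \<delta>: "0 < \<delta>" and st: "s \<in> cbox 0 T" "t \<in> cbox 0 T" and off: "\<And>i. i \<noteq> k \<Longrightarrow> s $ i = t $ i"
    and close: "\<bar>s $ k - t $ k\<bar> \<le> \<delta>"
    and l: "l * \<delta> \<le> s $ k" "l * \<delta> \<le> t $ k" "s $ k \<le> l * \<delta> + 2 * \<delta>" "t $ k \<le> l * \<delta> + 2 * \<delta>"
    and b: "\<bar>\<nu> (slab T \<delta> k l \<inter> {u. \<forall>i. u $ i \<le> s $ i})\<bar> \<le> b"
      "\<bar>\<nu> (slab T \<delta> k l \<inter> {u. \<forall>i. u $ i \<le> t $ i})\<bar> \<le> b"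
  shows "\<bar>\<nu> (cbox 0 s) - \<nu> (cbox 0 t)\<bar> \<le> 2 * b"
proof -
  define Q where "Q = cbox 0 s \<inter> {u. u $ k \<le> l * \<delta>}"
  have Q: "Q \<in> sets lebesgue"
  proof -
    have "Q \<in> sets borel" unfolding Q_def by (intro sets.Int) auto
    then show ?thesis by auto
  qed
  have Qt: "Q = cbox 0 t \<inter> {u. u $ k \<le> l * \<delta>}"
    using off l by (auto simp: Q_def mem_box_cart) (metis order_trans)+
  have decomp: "\<nu> (cbox 0 r) = \<nu> Q + \<nu> (slab T \<delta> k l \<inter> {u. \<forall>i. u $ i \<le> r $ i})"
    if r: "Q = cbox 0 r \<inter> {u. u $ k \<le> l * \<delta>}" "r \<in> cbox 0 T" "r $ k \<le> l * \<delta> + 2 * \<delta>" for r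
  proof -
    have "cbox 0 r = Q \<union> (slab T \<delta> k l \<inter> {u. \<forall>i. u $ i \<le> r $ i})"
      unfolding r(1) using r(2,3) by (auto simp: slab_def mem_box_cart) (meson order_trans)+
    then have eq: "\<nu> (cbox 0 r) = \<nu> (Q \<union> (slab T \<delta> k l \<inter> {u. \<forall>i. u $ i \<le> r $ i}))"
      by (rule arg_cong)
    have "Q \<inter> (slab T \<delta> k l \<inter> {u. \<forall>i. u $ i \<le> r $ i}) = {}"
      by (auto simp: Q_def slab_def)
    from add[OF Q sets.Int[OF slab_sets lower_set_sets] this] show ?thesis unfolding eq .
  qed
  show ?thesis
    using decomp[OF Q_def st(1) l(3)] decomp[OF Qt st(2) l(4)] b by linarith
qed

text \<open>The coordinates are changed one at a time. The slabs have twice the mesh width, so that any two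
  points of mesh distance share a slab.\<close>

lemma increments:
  fixes R :: nat and F :: "'n \<Rightarrow> real set" and \<delta> b :: real
  assumes \<delta>: "0 < \<delta>" and R: "\<And>k. T $ k \<le> R * \<delta>" and b0: "0 \<le> b"
    and b: "\<And>k l c. l \<le> R \<Longrightarrow> c \<in> cbox 0 T \<Longrightarrow> (\<forall>i. c $ i \<in> F i) \<Longrightarrow>
      \<bar>\<nu> (slab T \<delta> k l \<inter> {u. \<forall>i. u $ i \<le> c $ i})\<bar> \<le> b"
    and st: "s \<in> cbox 0 T" "t \<in> cbox 0 T" "\<forall>i. s $ i \<in> F i" "\<forall>i. t $ i \<in> F i" and close: "\<forall>i. \<bar>s $ i - t $ i\<bar> \<le> \<delta>"
  shows "\<bar>\<nu> (cbox 0 s) - \<nu> (cbox 0 t)\<bar> \<le> CARD('n) * (2 * b)"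
proof -
  have one: "\<bar>\<nu> (cbox 0 s) - \<nu> (cbox 0 t)\<bar> \<le> 2 * b"
    if st: "s \<in> cbox 0 T" "t \<in> cbox 0 T" "\<forall>i. s $ i \<in> F i" "\<forall>i. t $ i \<in> F i"
      and off: "\<And>i. i \<noteq> k \<Longrightarrow> s $ i = t $ i" and close: "\<bar>s $ k - t $ k\<bar> \<le> \<delta>" for s t k
  proof -
    define x where "x = min (s $ k) (t $ k) / \<delta>"
    \<comment> \<open>The smaller coordinate lies between \<open>l * \<delta>\<close> and
      \<open>(l + 1) * \<delta>\<close>, hence the larger one is at most
      \<open>(l + 2) * \<delta>\<close>, the upper face of the slab.\<close>
    define l where "l = nat \<lfloor>x\<rfloor>"
    have x: "0 \<le> x" using st \<delta> by (auto simp: x_def mem_box_cart)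
    have lx: "real l \<le> x" "x < real l + 1" unfolding l_def using x by linarith+
    then have l: "real l * \<delta> \<le> min (s $ k) (t $ k)" "min (s $ k) (t $ k) \<le> (real l + 1) * \<delta>"
      using \<delta> by (auto simp: x_def pos_le_divide_eq pos_divide_less_eq min_def split: if_splits)
    have "min (s $ k) (t $ k) \<le> real R * \<delta>" using st(1) R[of k] by (auto simp: mem_box_cart min_def intro: order_trans)
    then have "x \<le> real R" using \<delta> by (simp add: x_def pos_divide_le_eq)
    then have lR: "l \<le> R" using lx by linarith
    show ?thesis
    proof (rule increment_one[OF \<delta> st(1,2) off close])
      show "\<bar>\<nu> (slab T \<delta> k l \<inter> {u. \<forall>i. u $ i \<le> s $ i})\<bar> \<le> b" "\<bar>\<nu> (slab T \<delta> k l \<inter> {u. \<forall>i. u $ i \<le> t $ i})\<bar> \<le> b"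
        using b[OF lR] st by auto
    qed (use l close in \<open>auto simp: algebra_simps min_def split: if_splits\<close>)
  qed
  have "\<bar>\<nu> (cbox 0 s) - \<nu> (cbox 0 t)\<bar> \<le> card D * (2 * b)"
    if "finite D" "s \<in> cbox 0 T" "t \<in> cbox 0 T" "\<forall>i. s $ i \<in> F i" "\<forall>i. t $ i \<in> F i"
      "\<forall>i. \<bar>s $ i - t $ i\<bar> \<le> \<delta>" "\<forall>i. i \<notin> D \<longrightarrow> s $ i = t $ i" for D :: "'n set" and s t
    using that
  proof (induction D arbitrary: t)
    case empty
    then have "s = t" by (simp add: vec_eq_iff)
    then show ?case by simp
  next
    case (insert k D)
    \<comment> \<open>The intermediate point mixes coordinates of \<open>s\<close> and
      \<open>t\<close>. It need not belong to the original finite set, but its coordinates stay in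
      the sets \<open>F i\<close>, so the bound is assumed on the whole product grid.\<close>
    define r where "r = (\<chi> i. if i = k then s $ k else t $ i)"
    have r: "r $ i = (if i = k then s $ k else t $ i)" for i by (simp add: r_def)
    have "\<bar>\<nu> (cbox 0 s) - \<nu> (cbox 0 r)\<bar> \<le> card D * (2 * b)"
      using insert.prems \<delta> by (intro insert.IH) (auto simp: r mem_box_cart)
    moreover have "\<bar>\<nu> (cbox 0 r) - \<nu> (cbox 0 t)\<bar> \<le> 2 * b"
      using insert.prems by (intro one[of r t k]) (auto simp: r mem_box_cart)
    moreover have "card (insert k D) * (2 * b) = card D * (2 * b) + 2 * b"
      using insert.hyps by (simp add: algebra_simps)
    ultimately show ?case by linarith
  qed
  from this[of UNIV s t] show ?thesis using st close by simp
qed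

end

section \<open>The maximal inequality for the integrals and their oscillations\<close>

context moment_setting
begin

lemma sets_L: "A \<in> sets L \<Longrightarrow> A \<in> sets lebesgue" "A \<in> sets lebesgue \<Longrightarrow> A \<subseteq> K \<Longrightarrow> A \<in> sets L"
  by (auto simp: sets_restrict_space_iff)

lemma Lspace_restrict: "g \<in> Lspace p K \<Longrightarrow> A \<in> sets L \<Longrightarrow> (\<lambda>u. g u * indicator A u) \<in> Lspace p K"
  using p2 sets_L(1) by (intro Lspace_mult_indicator(1)) auto

lemma energy_finitely_additive:
  assumes g: "g \<in> Lspace p K"
  shows "finitely_additive L (\<lambda>A. energy p K (\<lambda>u. g u * indicator A u)) m \<gamma>"
proof
  fix A B assume AB: "A \<in> sets L" "B \<in> sets L" "A \<inter> B = {}"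
  have "\<bar>g u * indicator (A \<union> B) u\<bar> powr p = \<bar>g u * indicator A u\<bar> powr p + \<bar>g u * indicator B u\<bar> powr p" for u
    using AB(3) by (auto simp: indicator_def)
  then show "energy p K (\<lambda>u. g u * indicator (A \<union> B) u)
      = energy p K (\<lambda>u. g u * indicator A u) + energy p K (\<lambda>u. g u * indicator B u)"
    unfolding energy_def
    using LspaceD(2)[OF Lspace_restrict[OF g AB(1)]] LspaceD(2)[OF Lspace_restrict[OF g AB(2)]] by simp
qed (use energy_nonneg exponents in auto)

lemma J_additive:
  assumes g: "good n g \<omega>" and A: "A \<in> sets lebesgue" and B: "B \<in> sets lebesgue" and AB: "A \<inter> B = {}"
  shows "J n (\<lambda>u. g u * indicator (A \<union> B) u) \<omega> = J n (\<lambda>u. g u * indicator A u) \<omega> + J n (\<lambda>u. g u * indicator B u) \<omega>"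
proof -
  have "(\<lambda>u. g u * indicator (A \<union> B) u * \<theta> n \<omega> u)
      = (\<lambda>u. g u * indicator A u * \<theta> n \<omega> u + g u * indicator B u * \<theta> n \<omega> u)"
    using AB by (auto simp: indicator_def fun_eq_iff)
  then show ?thesis
    unfolding J_def using good_mult_indicator[OF g A] good_mult_indicator[OF g B] by simp
qed

text \<open>One factor \<open>max_const\<close> for each coordinate over which the maximum is
  taken.\<close>

definition max_bound :: real
  where "max_bound = finitely_additive.max_const m \<gamma> ^ CARD('n) * C"

lemma max_bound_nonneg: "0 \<le> max_bound"
proof -
  interpret finitely_additive L "\<lambda>A. energy p K (\<lambda>u. 1 * indicator A u)" m \<gamma>
    by (rule energy_finitely_additive[OF Lspace_1])
  show ?thesis using max_const_pos C by (simp add: max_bound_def)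
qed

text \<open>The dominating functional \<open>S\<close> depends on the grid \<open>F\<close>, but its
  moment bound depends neither on \<open>F\<close> nor on \<open>n\<close>. This uniformity makes
  oscillations over arbitrary finite sets accessible.\<close>

lemma maximal_J:
  assumes g: "g \<in> Lspace p K" and F: "\<And>i :: 'n. finite (F i :: real set)"
  obtains S where "\<And>A. A \<in> sets L \<Longrightarrow> S A \<in> borel_measurable (M n)"
    "\<And>A \<omega>. A \<in> sets L \<Longrightarrow> \<omega> \<in> space (M n) \<Longrightarrow> 0 \<le> S A \<omega>"
    "\<And>A. A \<in> sets L \<Longrightarrow> (\<integral>\<^sup>+\<omega>. ennreal (S A \<omega> powr m) \<partial>M n)
      \<le> ennreal (max_bound * energy p K (\<lambda>u. g u * indicator A u) powr \<gamma>)"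
    "\<And>A \<omega> c. A \<in> sets L \<Longrightarrow> \<omega> \<in> space (M n) \<Longrightarrow> good n g \<omega> \<Longrightarrow> (\<forall>i. c $ i \<in> F i) \<Longrightarrow>
      \<bar>J n (\<lambda>u. g u * indicator (A \<inter> {u. \<forall>i. u $ i \<le> c $ i}) u) \<omega>\<bar> \<le> S A \<omega>"
proof -
  define v where "v = (\<lambda>A. energy p K (\<lambda>u. g u * indicator A u))"
  interpret finitely_additive L v m \<gamma>
    unfolding v_def by (rule energy_finitely_additive[OF g])
  \<comment> \<open>Subadditivity is required at every \<omega>, while integrals over disjoint
    pieces add up only where \<open>g * \<theta>\<close> is integrable; hence the value
    \<open>0\<close> elsewhere.\<close>
  define S0 where "S0 = (\<lambda>A \<omega>. if good n g \<omega> then \<bar>J n (\<lambda>u. g u * indicator A u) \<omega>\<bar> else 0)"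
  have dom: "moment_dominated (M n) L v m \<gamma> C S0"
    unfolding moment_dominated_def
  proof (intro conjI ballI impI)
    fix A assume A: "A \<in> sets L"
    show "S0 A \<in> borel_measurable (M n)"
      unfolding S0_def[abs_def]
      by (intro measurable_If borel_measurable_abs J_measurable LspaceD(1)[OF Lspace_restrict[OF g A]]
          predE[OF good_measurable] LspaceD(1)[OF g]) auto
    show "0 \<le> S0 A \<omega>" for \<omega> by (simp add: S0_def)
    have "(\<integral>\<^sup>+\<omega>. ennreal (S0 A \<omega> powr m) \<partial>M n) \<le> (\<integral>\<^sup>+\<omega>. ennreal (\<bar>J n (\<lambda>u. g u * indicator A u) \<omega>\<bar> powr m) \<partial>M n)"
      using exponents by (intro nn_integral_mono) (auto simp: S0_def)
    also have "\<dots> \<le> ennreal (C * v A powr \<gamma>)"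
      unfolding v_def by (rule moment_J[OF Lspace_restrict[OF g A]])
    finally show "(\<integral>\<^sup>+\<omega>. ennreal (S0 A \<omega> powr m) \<partial>M n) \<le> ennreal (C * v A powr \<gamma>)" .
    fix B \<omega> assume "B \<in> sets L" "A \<inter> B = {}"
    then show "S0 (A \<union> B) \<omega> \<le> S0 A \<omega> + S0 B \<omega>"
      using J_additive[OF _ sets_L(1)[OF A] sets_L(1), where n=n and g=g and \<omega>=\<omega> and B=B] by (auto simp: S0_def)
  qed
  have coord: "(\<lambda>u :: real ^ 'n. u $ i) \<in> borel_measurable L" for i
    by (intro measurable_restrict_space1 measurable_completion) auto
  obtain S where S: "moment_dominated (M n) L v m \<gamma> max_bound S"
    "\<And>A \<omega> c. A \<in> sets L \<Longrightarrow> \<omega> \<in> space (M n) \<Longrightarrow> (\<forall>i\<in>UNIV. c i \<in> F i) \<Longrightarrow>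
      S0 {u \<in> A. \<forall>i\<in>UNIV. u $ i \<le> c i} \<omega> \<le> S A \<omega>"
    using multiparameter_maximal[OF dom less_imp_le[OF C] finite_class.finite_UNIV, of "\<lambda>i u. u $ i" F] coord F
    unfolding max_bound_def by blast
  show ?thesis
  proof (rule that)
    show "S A \<in> borel_measurable (M n)" if "A \<in> sets L" for A by (rule moment_dominatedD(1)[OF S(1) that])
    show "0 \<le> S A \<omega>" if "A \<in> sets L" "\<omega> \<in> space (M n)" for A \<omega> by (rule moment_dominatedD(2)[OF S(1) that])
    show "(\<integral>\<^sup>+\<omega>. ennreal (S A \<omega> powr m) \<partial>M n)
      \<le> ennreal (max_bound * energy p K (\<lambda>u. g u * indicator A u) powr \<gamma>)" if "A \<in> sets L" for A
      using moment_dominatedD(4)[OF S(1) that] by (simp add: v_def)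
    fix A \<omega> c assume A: "A \<in> sets L" "\<omega> \<in> space (M n)" and gd: "good n g \<omega>" and c: "\<forall>i. c $ i \<in> F i"
    have "A \<inter> {u. \<forall>i. u $ i \<le> c $ i} = {u \<in> A. \<forall>i\<in>UNIV. u $ i \<le> c $ i}" by auto
    then show "\<bar>J n (\<lambda>u. g u * indicator (A \<inter> {u. \<forall>i. u $ i \<le> c $ i}) u) \<omega>\<bar> \<le> S A \<omega>"
      using S(2)[OF A, of "\<lambda>i. c $ i"] c gd by (simp add: S0_def)
  qed
qed

text \<open>Boundedness turns small volume into small mass. This is why the step function, and not a
  general element of \<open>L^p\<close>, is treated by slabs.\<close>

lemma energy_slab_le:
  assumes c: "0 < c" "\<And>u. \<bar>g u\<bar> \<le> c" and \<delta>: "0 < \<delta>"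
  shows "energy p K (\<lambda>u. g u * indicator (slab T \<delta> k l) u) \<le> c powr p * (2 * (\<Prod>i\<in>UNIV. max 1 (T $ i))) * \<delta>"
proof -
  let ?A = "slab T \<delta> k l"
  have A: "?A \<in> sets L" by (intro sets_L(2) slab_sets) (auto simp: slab_def)
  have "energy p K (\<lambda>u. g u * indicator ?A u) \<le> (LINT u|L. c powr p * indicator ?A u)"
    unfolding energy_def
  proof (rule integral_mono')
    show "integrable L (\<lambda>u. c powr p * indicator ?A u)"
      using A by (intro integrable_mult_right integrable_real_indicator) (auto simp: L.emeasure_finite less_top[symmetric])
    show "\<bar>g u * indicator ?A u\<bar> powr p \<le> c powr p * indicator ?A u" for u
      using c(2)[of u] p by (auto simp: indicator_def intro!: powr_mono2)
  qed auto
  also have "\<dots> = c powr p * measure L ?A" using sets.sets_into_space[OF A] by (simp add: Int_absorb2)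
  also have "measure L ?A = measure lebesgue ?A"
    by (subst measure_restrict_space) (auto simp: slab_def)
  also have "c powr p * \<dots> \<le> c powr p * (2 * \<delta> * (\<Prod>i\<in>UNIV. max 1 (T $ i)))"
    by (intro mult_left_mono measure_slab_le T_pos \<delta>) auto
  finally show ?thesis by (simp add: mult_ac)
qed

lemma cbox_eq_lower: "t \<in> K \<Longrightarrow> cbox 0 t = K \<inter> {u. \<forall>i. u $ i \<le> t $ i}"
  by (auto simp: mem_box_cart) (meson order_trans)

text \<open>The remainder \<open>h\<close> contributes through its maximal function on all of
  \<open>K\<close>, small by its energy alone. The step part \<open>g\<close> is fixed before
  \<delta> is chosen, so its bound and its slab constants do not change as \<delta> shrinks.\<close>

theorem oscillation_small:
  assumes f: "\<And>n. f n \<in> Lspace p K" and f_lim: "f_lim \<in> Lspace p K"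
    and conv: "(\<lambda>n. energy p K (\<lambda>u. f n u - f_lim u)) \<longlonglongrightarrow> 0" and e: "0 < e"
  shows "\<exists>\<delta>>0. \<forall>\<^sub>F n in sequentially. \<forall>Q. finite Q \<and> Q \<subseteq> K \<longrightarrow>
    (\<integral>\<^sup>+\<omega>. ennreal (min 1 (oscillation \<delta> Q (integral_process T (\<theta> n) (f n) \<omega>))) \<partial>M n) \<le> ennreal e"
proof -
  define d where "d = real CARD('n)"
  have d: "0 < d" by (simp add: d_def)
  \<comment> \<open>Budget: the cut-offs in \<open>le_add_powr\<close>, two for the remainder and
    \<open>2 * d\<close> for the slabs, use \<open>e / 2\<close>; the moments of the slab part and
    of the remainder use \<open>e / 4\<close> each.\<close>
  define \<eta> where "\<eta> = e / (4 * (d + 1))"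
  have \<eta>: "0 < \<eta>" "(2 * d + 2) * \<eta> = e / 2" using e d by (auto simp: \<eta>_def field_simps)
  define a0 where "a0 = \<eta> powr (1 - m)"
  have a0: "0 \<le> a0" by (simp add: a0_def)
  let ?k = max_bound
  obtain e1 where e1: "0 < e1" "\<And>x. 0 \<le> x \<Longrightarrow> x < e1 \<Longrightarrow> (2 * a0 * ?k) * x powr \<gamma> \<le> e / 4"
    using powr_eventually_small[of "2 * a0 * ?k" "e / 4" \<gamma>] a0 max_bound_nonneg e exponents by auto
  define e2 where "e2 = e1 / (2 * 2 powr p)"
  have e2: "0 < e2" "2 powr p * (e2 + e2) = e1" using e1(1) by (auto simp: e2_def)
  obtain S a where "energy p K (\<lambda>u. f_lim u - step S a u) < e2"
    using approxE[OF steps_dense[OF f_lim] e2(1)] by blast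
  then obtain g where g: "g = step S a" and fg: "energy p K (\<lambda>u. f_lim u - g u) < e2" by auto
  have gL: "g \<in> Lspace p K" unfolding g by (rule step_Lspace)
  obtain c where c: "0 < c" "\<And>u. \<bar>g u\<bar> \<le> c" using step_bounded[of S a] unfolding g by blast
  define c2 where "c2 = c powr p * (2 * (\<Prod>i\<in>UNIV. max 1 (T $ i)))"
  have c2: "0 \<le> c2" unfolding c2_def by (intro mult_nonneg_nonneg prod_nonneg) auto
  define Tm where "Tm = (\<Sum>i\<in>UNIV. T $ i)"
  have Tm: "T $ k \<le> Tm" "0 \<le> Tm" for k
    unfolding Tm_def using T_pos
    by (intro member_le_sum[of k UNIV "\<lambda>i. T $ i"] sum_nonneg; simp add: less_imp_le)+
  \<comment> \<open>Number of slabs times the moment bound of one slab, with all powers of \<delta>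
    collected into the single factor \<open>\<delta> powr (\<gamma> - 1)\<close>.\<close>
  define c3 where "c3 = 2 * d * a0 * (d * (Tm + 2) * (?k * c2 powr \<gamma>))"
  have c3: "0 \<le> c3" unfolding c3_def using d a0 Tm max_bound_nonneg by auto
  obtain e3 where e3: "0 < e3" "\<And>x. 0 \<le> x \<Longrightarrow> x < e3 \<Longrightarrow> c3 * x powr (\<gamma> - 1) \<le> e / 4"
    using powr_eventually_small[of c3 "e / 4" "\<gamma> - 1"] c3 e exponents by auto
  \<comment> \<open>The cap 1 lets the additive constant in the number of slabs be absorbed:
    \<open>Tm / \<delta> + 2 \<le> (Tm + 2) / \<delta>\<close>.\<close>
  define \<delta> where "\<delta> = min 1 (e3 / 2)"
  have \<delta>: "0 < \<delta>" "\<delta> \<le> 1" "\<delta> < e3" using e3(1) by (auto simp: \<delta>_def)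
  define R where "R = nat \<lceil>Tm / \<delta>\<rceil>"
  have R: "Tm / \<delta> \<le> R" "R \<le> Tm / \<delta> + 1" using Tm \<delta> unfolding R_def by (auto simp: of_nat_nat ceiling_correct)
  have TR: "T $ k \<le> R * \<delta>" for k using R(1) Tm(1)[of k] \<delta> by (simp add: pos_divide_le_eq)
  define P where "P = (UNIV :: 'n set) \<times> {..R}"
  have P: "finite P" "card P = CARD('n) * (R + 1)" by (auto simp: P_def card_cartesian_product)
  have slab_total: "2 * d * a0 * (card P * (?k * (c2 * \<delta>) powr \<gamma>)) \<le> e / 4"
  proof -
    have scale: "(c2 * \<delta>) powr \<gamma> = c2 powr \<gamma> * (\<delta> * \<delta> powr (\<gamma> - 1))"
    proof -
      have "\<delta> powr \<gamma> = \<delta> powr 1 * \<delta> powr (\<gamma> - 1)" unfolding powr_add[symmetric] by simp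
      then show ?thesis using \<delta> c2 by (simp add: powr_mult)
    qed
    have "real (card P) \<le> d * ((Tm + 2) / \<delta>)"
    proof -
      have "real (R + 1) \<le> Tm / \<delta> + 2" using R(2) by simp
      also have "\<dots> \<le> (Tm + 2) / \<delta>" using \<delta> by (simp add: field_simps)
      finally show ?thesis unfolding P(2) d_def of_nat_mult by (intro mult_left_mono) auto
    qed
    then have "2 * d * a0 * (card P * (?k * (c2 * \<delta>) powr \<gamma>)) \<le> 2 * d * a0 * (d * ((Tm + 2) / \<delta>) * (?k * (c2 * \<delta>) powr \<gamma>))"
      using d a0 max_bound_nonneg by (intro mult_left_mono mult_right_mono) auto
    also have "\<dots> = c3 * \<delta> powr (\<gamma> - 1)"
      using \<delta>(1) unfolding scale c3_def by simp
    also have "\<dots> \<le> e / 4" using \<delta> by (intro e3(2)) auto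
    finally show ?thesis .
  qed
  have "\<forall>\<^sub>F n in sequentially. energy p K (\<lambda>u. f n u - f_lim u) < e2"
    using conv e2(1) by (rule order_tendstoD)
  then have "\<forall>\<^sub>F n in sequentially. \<forall>Q. finite Q \<and> Q \<subseteq> K \<longrightarrow>
    (\<integral>\<^sup>+\<omega>. ennreal (min 1 (oscillation \<delta> Q (integral_process T (\<theta> n) (f n) \<omega>))) \<partial>M n) \<le> ennreal e"
  proof eventually_elim
    case (elim n)
    interpret prob_space "M n" by (rule prob)
    define h where "h = (\<lambda>u. f n u - g u)"
    have hL: "h \<in> Lspace p K" unfolding h_def by (intro Lspace_diff(1) f gL p)
    have "energy p K h \<le> 2 powr p * (energy p K (\<lambda>u. f n u - f_lim u) + energy p K (\<lambda>u. f_lim u - g u))"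
      unfolding h_def by (intro energy_triangle f f_lim gL p)
    also have "\<dots> < 2 powr p * (e2 + e2)" using elim fg by (intro mult_strict_left_mono add_strict_mono) auto
    finally have h_small: "energy p K h < e1" using e2(2) by simp
    show ?case
    proof (intro allI impI)
      fix Q assume Q: "finite Q \<and> Q \<subseteq> K"
      \<comment> \<open>The product of the coordinate projections of \<open>Q\<close> also contains
        the mixed points visited when coordinates are changed one at a time.\<close>
      define F where "F = (\<lambda>i :: 'n. (\<lambda>t. t $ i) ` Q)"
      have F: "finite (F i)" for i using Q by (simp add: F_def)
      have QF: "\<forall>i. t $ i \<in> F i" if "t \<in> Q" for t using that by (auto simp: F_def)
      obtain S1 where S1: "\<And>A. A \<in> sets L \<Longrightarrow> S1 A \<in> borel_measurable (M n)"
        "\<And>A \<omega>. A \<in> sets L \<Longrightarrow> \<omega> \<in> space (M n) \<Longrightarrow> 0 \<le> S1 A \<omega>"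
        "\<And>A. A \<in> sets L \<Longrightarrow> (\<integral>\<^sup>+\<omega>. ennreal (S1 A \<omega> powr m) \<partial>M n)
          \<le> ennreal (?k * energy p K (\<lambda>u. h u * indicator A u) powr \<gamma>)"
        "\<And>A \<omega> c. A \<in> sets L \<Longrightarrow> \<omega> \<in> space (M n) \<Longrightarrow> good n h \<omega> \<Longrightarrow> (\<forall>i. c $ i \<in> F i) \<Longrightarrow>
          \<bar>J n (\<lambda>u. h u * indicator (A \<inter> {u. \<forall>i. u $ i \<le> c $ i}) u) \<omega>\<bar> \<le> S1 A \<omega>"
        by (rule maximal_J[where n=n and F=F, OF hL F]) (rule that)
      obtain S2 where S2: "\<And>A. A \<in> sets L \<Longrightarrow> S2 A \<in> borel_measurable (M n)"
        "\<And>A \<omega>. A \<in> sets L \<Longrightarrow> \<omega> \<in> space (M n) \<Longrightarrow> 0 \<le> S2 A \<omega>"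
        "\<And>A. A \<in> sets L \<Longrightarrow> (\<integral>\<^sup>+\<omega>. ennreal (S2 A \<omega> powr m) \<partial>M n)
          \<le> ennreal (?k * energy p K (\<lambda>u. g u * indicator A u) powr \<gamma>)"
        "\<And>A \<omega> c. A \<in> sets L \<Longrightarrow> \<omega> \<in> space (M n) \<Longrightarrow> good n g \<omega> \<Longrightarrow> (\<forall>i. c $ i \<in> F i) \<Longrightarrow>
          \<bar>J n (\<lambda>u. g u * indicator (A \<inter> {u. \<forall>i. u $ i \<le> c $ i}) u) \<omega>\<bar> \<le> S2 A \<omega>"
        by (rule maximal_J[where n=n and F=F, OF gL F]) (rule that)
      define sl where "sl = (\<lambda>x. slab T \<delta> (fst x :: 'n) (snd x))"
      have sl: "sl x \<in> sets L" for x
        unfolding sl_def by (intro sets_L(2) slab_sets) (auto simp: slab_def)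
      have KL: "K \<in> sets L" by (intro sets_L(2)) auto
      \<comment> \<open>The sum of the powers stands for the maximum over all slabs. This union
        bound loses the number of slabs, of order \<open>1/\<delta>\<close>, which the factor
        \<open>\<delta> powr \<gamma>\<close> of each term outweighs.\<close>
      define BB where "BB = (\<lambda>\<omega>. \<Sum>x\<in>P. S2 (sl x) \<omega> powr m)"
      have BB0: "0 \<le> BB \<omega>" for \<omega> unfolding BB_def by (intro sum_nonneg) auto
      have pointwise: "oscillation \<delta> Q (integral_process T (\<theta> n) (f n) \<omega>)
          \<le> e / 2 + 2 * d * a0 * BB \<omega> + 2 * a0 * S1 K \<omega> powr m"
        if \<omega>: "\<omega> \<in> space (M n)" and gf: "good n (f n) \<omega>" and gg: "good n g \<omega>" for \<omega>
      proof -
        have gh: "good n h \<omega>" unfolding h_def using gf gg by (rule good_diff)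
        define \<nu> where "\<nu> = (\<lambda>A. J n (\<lambda>u. g u * indicator A u) \<omega>)"
        interpret \<nu>: additive_set_function T \<nu>
          unfolding \<nu>_def by unfold_locales (rule J_additive[OF gg])
        define b where "b = \<eta> + a0 * BB \<omega>"
        have b0: "0 \<le> b" unfolding b_def using \<eta> a0 BB0 by simp
        have slab_b: "\<bar>\<nu> (slab T \<delta> k l \<inter> {u. \<forall>i. u $ i \<le> c $ i})\<bar> \<le> b"
          if "l \<le> R" "\<forall>i. c $ i \<in> F i" for k l c
        proof -
          have x: "(k, l) \<in> P" using that by (simp add: P_def)
          have "\<bar>\<nu> (slab T \<delta> k l \<inter> {u. \<forall>i. u $ i \<le> c $ i})\<bar> \<le> S2 (sl (k, l)) \<omega>"
            unfolding \<nu>_def using S2(4)[OF sl[of "(k, l)"] \<omega> gg that(2)] by (simp add: sl_def)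
          also have "\<dots> \<le> \<eta> + a0 * S2 (sl (k, l)) \<omega> powr m"
            unfolding a0_def using S2(2)[OF sl \<omega>] \<eta> exponents by (intro le_add_powr) auto
          also have "\<dots> \<le> b"
            unfolding b_def BB_def using x P a0
            by (intro add_left_mono mult_left_mono member_le_sum[of "(k, l)" P "\<lambda>x. S2 (sl x) \<omega> powr m"]) auto
          finally show ?thesis .
        qed
        have S1_le: "S1 K \<omega> \<le> \<eta> + a0 * S1 K \<omega> powr m"
          unfolding a0_def using S1(2)[OF KL \<omega>] \<eta> exponents by (intro le_add_powr) auto
        have path: "integral_process T (\<theta> n) (f n) \<omega> t = J n (\<lambda>u. h u * indicator (cbox 0 t) u) \<omega> + \<nu> (cbox 0 t)"
          if t: "t \<in> K" for t
        proof -
          have "good n (\<lambda>u. h u * indicator (cbox 0 t) u) \<omega>" "good n (\<lambda>u. g u * indicator (cbox 0 t) u) \<omega>"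
            using good_mult_indicator[OF gh, of "cbox 0 t"] good_mult_indicator[OF gg, of "cbox 0 t"] by auto
          then have "J n (\<lambda>u. h u * indicator (cbox 0 t) u) \<omega> + \<nu> (cbox 0 t)
              = (LINT u|L. h u * indicator (cbox 0 t) u * \<theta> n \<omega> u + g u * indicator (cbox 0 t) u * \<theta> n \<omega> u)"
            unfolding \<nu>_def J_def by (rule Bochner_Integration.integral_add[symmetric])
          also have "\<dots> = J n (\<lambda>u. f n u * indicator (cbox 0 t) u) \<omega>"
            unfolding J_def h_def by (simp add: algebra_simps)
          finally show ?thesis using integral_process_eq[OF t gf] by simp
        qed
        show ?thesis
        proof (rule oscillation_le)
          show "finite Q" using Q by simp
          show "0 \<le> e / 2 + 2 * d * a0 * BB \<omega> + 2 * a0 * S1 K \<omega> powr m"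
            using e d a0 BB0 by (intro add_nonneg_nonneg mult_nonneg_nonneg) auto
          fix s t assume st: "s \<in> Q" "t \<in> Q" "dist s t < \<delta>"
          then have stK: "s \<in> K" "t \<in> K" using Q by auto
          have close: "\<forall>i. \<bar>s $ i - t $ i\<bar> \<le> \<delta>"
          proof
            fix i
            have "\<bar>(s - t) $ i\<bar> \<le> norm (s - t)" by (rule component_le_norm_cart)
            then show "\<bar>s $ i - t $ i\<bar> \<le> \<delta>" using st(3) by (simp add: dist_norm)
          qed
          have "\<bar>\<nu> (cbox 0 s) - \<nu> (cbox 0 t)\<bar> \<le> CARD('n) * (2 * b)"
            using slab_b QF st stK close by (intro \<nu>.increments[OF \<delta>(1) TR b0, where F=F]) auto
          note nu = this
          have hJ: "\<bar>J n (\<lambda>u. h u * indicator (cbox 0 r) u) \<omega>\<bar> \<le> S1 K \<omega>" if "r \<in> Q" for r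
            using S1(4)[OF KL \<omega> gh QF[OF that]] that Q cbox_eq_lower[of r] by auto
          have "\<bar>integral_process T (\<theta> n) (f n) \<omega> s - integral_process T (\<theta> n) (f n) \<omega> t\<bar>
              \<le> 2 * S1 K \<omega> + d * (2 * b)"
            using nu hJ[OF st(1)] hJ[OF st(2)] unfolding path[OF stK(1)] path[OF stK(2)] d_def by linarith
          also have "\<dots> \<le> 2 * (\<eta> + a0 * S1 K \<omega> powr m) + d * (2 * b)" using S1_le by simp
          also have "\<dots> = (2 * d + 2) * \<eta> + 2 * d * a0 * BB \<omega> + 2 * a0 * S1 K \<omega> powr m"
            by (simp add: b_def algebra_simps)
          finally show "\<bar>integral_process T (\<theta> n) (f n) \<omega> s - integral_process T (\<theta> n) (f n) \<omega> t\<bar>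
              \<le> e / 2 + 2 * d * a0 * BB \<omega> + 2 * a0 * S1 K \<omega> powr m" using \<eta>(2) by simp
        qed
      qed
      have "AE \<omega> in M n. ennreal (min 1 (oscillation \<delta> Q (integral_process T (\<theta> n) (f n) \<omega>)))
          \<le> ennreal (e / 2) + ennreal (2 * d * a0) * (\<Sum>x\<in>P. ennreal (S2 (sl x) \<omega> powr m)) + ennreal (2 * a0) * ennreal (S1 K \<omega> powr m)"
        using integ[OF f[of n], of n] integ[OF gL, of n] AE_space
      proof eventually_elim
        case (elim \<omega>)
        have "min 1 (oscillation \<delta> Q (integral_process T (\<theta> n) (f n) \<omega>))
            \<le> e / 2 + 2 * d * a0 * BB \<omega> + 2 * a0 * S1 K \<omega> powr m"
          using pointwise[OF elim(3,1,2)] by linarith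
        then have "ennreal (min 1 (oscillation \<delta> Q (integral_process T (\<theta> n) (f n) \<omega>)))
            \<le> ennreal (e / 2 + 2 * d * a0 * BB \<omega> + 2 * a0 * S1 K \<omega> powr m)" by (rule ennreal_leI)
        also have "\<dots> = ennreal (e / 2) + ennreal (2 * d * a0) * ennreal (BB \<omega>) + ennreal (2 * a0) * ennreal (S1 K \<omega> powr m)"
          using e d a0 BB0 by (simp add: ennreal_mult)
        also have "ennreal (BB \<omega>) = (\<Sum>x\<in>P. ennreal (S2 (sl x) \<omega> powr m))"
          unfolding BB_def by simp
        finally show ?case .
      qed
      then have "(\<integral>\<^sup>+\<omega>. ennreal (min 1 (oscillation \<delta> Q (integral_process T (\<theta> n) (f n) \<omega>))) \<partial>M n)
          \<le> (\<integral>\<^sup>+\<omega>. ennreal (e / 2) + ennreal (2 * d * a0) * (\<Sum>x\<in>P. ennreal (S2 (sl x) \<omega> powr m)) + ennreal (2 * a0) * ennreal (S1 K \<omega> powr m) \<partial>M n)"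
        by (rule nn_integral_mono_AE)
      also have "\<dots> = ennreal (e / 2) + ennreal (2 * d * a0) * (\<Sum>x\<in>P. \<integral>\<^sup>+\<omega>. ennreal (S2 (sl x) \<omega> powr m) \<partial>M n)
          + ennreal (2 * a0) * (\<integral>\<^sup>+\<omega>. ennreal (S1 K \<omega> powr m) \<partial>M n)"
      proof -
        have [measurable]: "S2 (sl x) \<in> borel_measurable (M n)" "S1 K \<in> borel_measurable (M n)" for x
          using S2(1)[OF sl] S1(1)[OF KL] by auto
        show ?thesis
          by (simp add: nn_integral_add nn_integral_cmult nn_integral_sum emeasure_space_1 del: sum_ennreal)
      qed
      also have "\<dots> \<le> ennreal (e / 2) + ennreal (2 * d * a0) * (\<Sum>x\<in>P. ennreal (?k * (c2 * \<delta>) powr \<gamma>))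
          + ennreal (2 * a0) * ennreal (?k * energy p K h powr \<gamma>)"
      proof (intro add_mono mult_left_mono sum_mono order_refl)
        fix x
        have "energy p K (\<lambda>u. g u * indicator (sl x) u) \<le> c2 * \<delta>"
          unfolding sl_def c2_def by (rule energy_slab_le[OF c \<delta>(1)])
        then have "ennreal (?k * energy p K (\<lambda>u. g u * indicator (sl x) u) powr \<gamma>) \<le> ennreal (?k * (c2 * \<delta>) powr \<gamma>)"
          using max_bound_nonneg exponents energy_nonneg
          by (intro ennreal_leI mult_left_mono powr_mono2) auto
        then show "(\<integral>\<^sup>+\<omega>. ennreal (S2 (sl x) \<omega> powr m) \<partial>M n) \<le> ennreal (?k * (c2 * \<delta>) powr \<gamma>)"
          using S2(3)[OF sl] by (rule order_trans[rotated])
        have "energy p K (\<lambda>u. h u * indicator K u) \<le> energy p K h"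
          using p by (intro Lspace_mult_indicator(2) hL) auto
        then have "ennreal (?k * energy p K (\<lambda>u. h u * indicator K u) powr \<gamma>) \<le> ennreal (?k * energy p K h powr \<gamma>)"
          using max_bound_nonneg exponents energy_nonneg
          by (intro ennreal_leI mult_left_mono powr_mono2) auto
        then show "(\<integral>\<^sup>+\<omega>. ennreal (S1 K \<omega> powr m) \<partial>M n) \<le> ennreal (?k * energy p K h powr \<gamma>)"
          using S1(3)[OF KL] by (rule order_trans[rotated])
      qed auto
      also have "\<dots> = ennreal (e / 2 + 2 * d * a0 * (card P * (?k * (c2 * \<delta>) powr \<gamma>)) + 2 * a0 * (?k * energy p K h powr \<gamma>))"
        using e d a0 max_bound_nonneg
        by (simp add: ennreal_mult ennreal_of_nat_eq_real_of_nat)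
      also have "\<dots> \<le> ennreal e"
      proof (rule ennreal_leI)
        show "e / 2 + 2 * d * a0 * (card P * (?k * (c2 * \<delta>) powr \<gamma>)) + 2 * a0 * (?k * energy p K h powr \<gamma>) \<le> e"
          using slab_total e1(2)[OF energy_nonneg h_small] by (simp add: mult.assoc)
      qed
      finally show "(\<integral>\<^sup>+\<omega>. ennreal (min 1 (oscillation \<delta> Q (integral_process T (\<theta> n) (f n) \<omega>))) \<partial>M n) \<le> ennreal e" .
    qed
  qed
  then show ?thesis using \<delta>(1) by blast
qed

end

section \<open>Convergence of the integral processes\<close>

context moment_setting
begin

text \<open>Dominated convergence: the indicators of the boxes converge at every \<open>u\<close>
  off the hyperplanes \<open>u $ i = t $ i\<close>, which form a null set.\<close>

lemma integral_process_continuous: "continuous_on K (integral_process T (\<theta> n) g \<omega>)"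
proof (cases "good n g \<omega>")
  case False
  then show ?thesis
    by (intro continuous_on_eq[OF continuous_on_const[of K 0]]) (simp add: integral_process_def)
next
  case gd: True
  have "continuous_on K (\<lambda>t. J n (\<lambda>u. g u * indicator (cbox 0 t) u) \<omega>)"
    unfolding continuous_on_sequentially
  proof (intro allI ballI impI)
    fix x t assume xt: "t \<in> K" "(\<forall>k. x k \<in> K) \<and> x \<longlonglongrightarrow> t"
    have x: "\<And>i. (\<lambda>k. x k $ i) \<longlonglongrightarrow> t $ i" using xt(2) by (auto intro: tendsto_vec_nth)
    have "(\<lambda>k. LINT u|L. g u * indicator (cbox 0 (x k)) u * \<theta> n \<omega> u) \<longlonglongrightarrow> (LINT u|L. g u * indicator (cbox 0 t) u * \<theta> n \<omega> u)"
    proof (rule integral_dominated_convergence[where w="\<lambda>u. \<bar>g u * \<theta> n \<omega> u\<bar>"])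
      show "(\<lambda>u. g u * indicator (cbox 0 t) u * \<theta> n \<omega> u) \<in> borel_measurable L" for t
        using good_mult_indicator[OF gd, of "cbox 0 t"] by (auto dest: borel_measurable_integrable)
      then show "(\<lambda>u. g u * indicator (cbox 0 (x k)) u * \<theta> n \<omega> u) \<in> borel_measurable L" for k .
      show "integrable L (\<lambda>u. \<bar>g u * \<theta> n \<omega> u\<bar>)" using gd by (rule integrable_abs)
      show "AE u in L. norm (g u * indicator (cbox 0 (x k)) u * \<theta> n \<omega> u) \<le> \<bar>g u * \<theta> n \<omega> u\<bar>" for k
        by (intro AE_I2) (auto simp: indicator_def)
      show "AE u in L. (\<lambda>k. g u * indicator (cbox 0 (x k)) u * \<theta> n \<omega> u) \<longlonglongrightarrow> g u * indicator (cbox 0 t) u * \<theta> n \<omega> u"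
        using AE_hyperplanes[of t] AE_space
      proof eventually_elim
        case (elim u)
        have u0: "0 \<le> u $ i" for i using elim(2) by (auto simp: mem_box_cart)
        \<comment> \<open>Off the hyperplanes every comparison with \<open>t\<close> is strict, so
          the comparison with \<open>x k\<close> eventually has the same outcome in all
          coordinates.\<close>
        have "\<forall>\<^sub>F k in sequentially. \<forall>i. (u $ i \<le> x k $ i) = (u $ i \<le> t $ i)"
        proof (rule eventually_all_finite)
          fix i
          consider "u $ i < t $ i" | "t $ i < u $ i" using elim(1) by (meson linorder_neqE)
          then show "\<forall>\<^sub>F k in sequentially. (u $ i \<le> x k $ i) = (u $ i \<le> t $ i)"
          proof cases
            case 1
            from order_tendstoD(1)[OF x 1] show ?thesis by eventually_elim (use 1 in auto)
          next
            case 2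
            from order_tendstoD(2)[OF x 2] show ?thesis by eventually_elim (use 2 in auto)
          qed
        qed
        then have "\<forall>\<^sub>F k in sequentially. g u * indicator (cbox 0 (x k)) u * \<theta> n \<omega> u = g u * indicator (cbox 0 t) u * \<theta> n \<omega> u"
          by eventually_elim (use u0 in \<open>auto simp: indicator_def mem_box_cart\<close>)
        then show ?case by (rule tendsto_eventually)
      qed
    qed
    then show "((\<lambda>t. J n (\<lambda>u. g u * indicator (cbox 0 t) u) \<omega>) \<circ> x) \<longlonglongrightarrow> J n (\<lambda>u. g u * indicator (cbox 0 t) u) \<omega>"
      by (simp add: o_def J_def)
  qed
  then show ?thesis by (rule continuous_on_eq) (simp add: integral_process_eq[OF _ gd])
qed

lemma integral_process_mspace: "integral_process T (\<theta> n) g \<omega> \<in> mspace (Cspace K)"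
  using integral_process_continuous by (simp add: mspace_Cspace) (simp add: integral_process_def)

text \<open>Restriction to \<open>cbox 0 t\<close> does not increase the energy of
  \<open>f n - f_lim\<close>, so \<open>integrals_converge\<close> yields the finite dimensional
  input, and \<open>oscillation_small\<close> the other one. The guarded path and the versions agree
  almost surely at finitely many points.\<close>

theorem integral_process_converges:
  assumes f: "\<And>n. f n \<in> Lspace p K" and f_lim: "f_lim \<in> Lspace p K"
    and conv: "(\<lambda>n. energy p K (\<lambda>u. f n u - f_lim u)) \<longlonglongrightarrow> 0"
    and X: "continuous_version N K (wiener_integral W f_lim) X"
  shows "converges_in_law (mtopology_of (Cspace K)) M (\<lambda>n. integral_process T (\<theta> n) (f n)) N X"
proof (rule converges_in_law_Cspace[OF compact_cbox prob N.prob_space_axioms])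
  have XW: "AE \<omega> in N. X \<omega> t = W (\<lambda>u. f_lim u * indicator (cbox 0 t) u) \<omega>" if "t \<in> K" for t
    using X that by (simp add: continuous_version_def wiener_integral_def)
  have restr: "(\<lambda>u. g u * indicator (cbox 0 t) u) \<in> Lspace p K" if "g \<in> Lspace p K" for g t
    using p2 that by (intro Lspace_mult_indicator(1)) auto
  have mW: "W (\<lambda>u. f_lim u * indicator (cbox 0 t) u) \<in> borel_measurable N" for t
    using Lspace_square(1)[OF _ restr[OF f_lim] p2] by (intro W_measurable) auto
  have mX: "(\<lambda>\<omega>. X \<omega> t) \<in> borel_measurable N" if "t \<in> K" for t
  proof (rule AE_eq_measurable_complete[OF _ mW])
    show "complete_measure N" using W by (simp add: isonormal_def)
    show "AE \<omega> in N. W (\<lambda>u. f_lim u * indicator (cbox 0 t) u) \<omega> = X \<omega> t" using XW[OF that] by eventually_elim simp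
  qed
  then show "(\<lambda>\<omega>. X \<omega> t) \<in> borel_measurable N" if "t \<in> K" for t using that .
  show "integral_process T (\<theta> n) (f n) \<omega> \<in> mspace (Cspace K)" for n \<omega> by (rule integral_process_mspace)
  show "X \<omega> \<in> mspace (Cspace K)" if "\<omega> \<in> space N" for \<omega> using X that by (simp add: continuous_version_def)
  show "(\<lambda>\<omega>. integral_process T (\<theta> n) (f n) \<omega> t) \<in> borel_measurable (M n)" if "t \<in> K" for n t
    by (rule integral_process_measurable[OF f that])
  show "\<exists>\<delta>>0. \<forall>\<^sub>F n in sequentially. \<forall>Q. finite Q \<and> Q \<subseteq> K \<longrightarrow>
    (\<integral>\<^sup>+\<omega>. ennreal (min 1 (oscillation \<delta> Q (integral_process T (\<theta> n) (f n) \<omega>))) \<partial>M n) \<le> ennreal e" if "0 < e" for e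
    by (rule oscillation_small[OF f f_lim conv that])
  fix Q k b and \<Phi> :: "(real ^ 'n \<Rightarrow> real) \<Rightarrow> real"
  assume Q: "finite Q" "Q \<subseteq> K" and \<Phi>: "coord_lipschitz Q k \<Phi>" and b: "\<And>x. \<bar>\<Phi> x\<bar> \<le> b"
  define g where "g = (\<lambda>n t u. f n u * indicator (cbox 0 t) u :: real)"
  define h where "h = (\<lambda>t u. f_lim u * indicator (cbox 0 t) u :: real)"
  have gL: "g n t \<in> Lspace p K" for n t unfolding g_def by (rule restr[OF f])
  have "(\<lambda>n. LINT \<omega>|M n. \<Phi> (\<lambda>t. J n (g n t) \<omega>)) \<longlonglongrightarrow> (LINT \<omega>|N. \<Phi> (\<lambda>t. W (h t) \<omega>))"
  proof (rule integrals_converge[OF Q(1) _ gL _ \<Phi> b])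
    show "h t \<in> Lspace p K" for t unfolding h_def by (rule restr[OF f_lim])
    fix t
    show "(\<lambda>n. energy p K (\<lambda>u. g n t u - h t u)) \<longlonglongrightarrow> 0"
    proof (rule tendsto_sandwich[OF _ _ tendsto_const conv])
      show "\<forall>\<^sub>F n in sequentially. energy p K (\<lambda>u. g n t u - h t u) \<le> energy p K (\<lambda>u. f n u - f_lim u)"
      proof (intro always_eventually allI)
        fix n
        have "(\<lambda>u. g n t u - h t u) = (\<lambda>u. (f n u - f_lim u) * indicator (cbox 0 t) u)"
          by (simp add: g_def h_def left_diff_distrib)
        then show "energy p K (\<lambda>u. g n t u - h t u) \<le> energy p K (\<lambda>u. f n u - f_lim u)"
          using Lspace_mult_indicator(2)[OF Lspace_diff(1)[OF f f_lim p], of "cbox 0 t"] p by simp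
      qed
    qed (simp add: energy_nonneg)
  qed
  moreover have "(LINT \<omega>|M n. \<Phi> (integral_process T (\<theta> n) (f n) \<omega>)) = (LINT \<omega>|M n. \<Phi> (\<lambda>t. J n (g n t) \<omega>))" for n
  proof (rule integral_cong_AE)
    show "(\<lambda>\<omega>. \<Phi> (integral_process T (\<theta> n) (f n) \<omega>)) \<in> borel_measurable (M n)"
      using Q by (intro coord_lipschitz_measurable[OF Q(1) \<Phi>] integral_process_measurable[OF f]) auto
    show "(\<lambda>\<omega>. \<Phi> (\<lambda>t. J n (g n t) \<omega>)) \<in> borel_measurable (M n)"
      using J_measurable[OF LspaceD(1)[OF gL]] by (intro coord_lipschitz_measurable[OF Q(1) \<Phi>]) auto
    show "AE \<omega> in M n. \<Phi> (integral_process T (\<theta> n) (f n) \<omega>) = \<Phi> (\<lambda>t. J n (g n t) \<omega>)"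
      using integ[OF f[of n], of n]
    proof eventually_elim
      case (elim \<omega>)
      show ?case by (rule coord_lipschitz_cong[OF \<Phi>]) (use Q elim in \<open>auto simp: g_def integral_process_eq\<close>)
    qed
  qed
  moreover have "(LINT \<omega>|N. \<Phi> (X \<omega>)) = (LINT \<omega>|N. \<Phi> (\<lambda>t. W (h t) \<omega>))"
  proof (rule integral_cong_AE)
    show "(\<lambda>\<omega>. \<Phi> (X \<omega>)) \<in> borel_measurable N"
      using Q mX by (intro coord_lipschitz_measurable[OF Q(1) \<Phi>]) auto
    show "(\<lambda>\<omega>. \<Phi> (\<lambda>t. W (h t) \<omega>)) \<in> borel_measurable N"
      using mW by (intro coord_lipschitz_measurable[OF Q(1) \<Phi>]) (auto simp: h_def)
    have "AE \<omega> in N. \<forall>t\<in>Q. X \<omega> t = W (h t) \<omega>"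
      using Q XW by (subst AE_finite_all) (auto simp: h_def)
    then show "AE \<omega> in N. \<Phi> (X \<omega>) = \<Phi> (\<lambda>t. W (h t) \<omega>)"
      by eventually_elim (rule coord_lipschitz_cong[OF \<Phi>], auto)
  qed
  ultimately show "(\<lambda>n. LINT \<omega>|M n. \<Phi> (integral_process T (\<theta> n) (f n) \<omega>)) \<longlonglongrightarrow> (LINT \<omega>|N. \<Phi> (X \<omega>))" by simp
qed

end

lemma energy_eq_Lnorm_powr: "0 < p \<Longrightarrow> energy p K g = Lnorm p K g powr p"
  by (simp add: Lnorm_def energy_def powr_powr)

theorem theorem3p1:
  fixes T :: "real ^ 'n"
    and M :: "nat \<Rightarrow> 'a measure"
    and \<theta> :: "nat \<Rightarrow> 'a \<Rightarrow> real ^ 'n \<Rightarrow> real"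
    and N :: "'b measure"
    and W :: "(real ^ 'n \<Rightarrow> real) \<Rightarrow> 'b \<Rightarrow> real"
    and q m C :: real
    and f :: "nat \<Rightarrow> real ^ 'n \<Rightarrow> real"
    and f_lim :: "real ^ 'n \<Rightarrow> real"
    and X :: "'b \<Rightarrow> real ^ 'n \<Rightarrow> real"
  assumes T_pos: "\<And>i. 0 < T $ i"
    and prob: "\<And>n. prob_space (M n)"
    and meas: "\<And>n. (\<lambda>(\<omega>, u). \<theta> n \<omega> u) \<in> borel_measurable (M n \<Otimes>\<^sub>M lebesgue_on (cbox 0 T))"
    and W: "isonormal N (cbox 0 T) W"
    and fdd: "fdd_converge (cbox 0 T) M (\<lambda>n. integral_process T (\<theta> n) (\<lambda>_. 1)) N (brownian_sheet W)"
    and q: "1 \<le> q"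
    and integ: "\<And>g n. g \<in> Lspace (2 * q) (cbox 0 T) \<Longrightarrow>
      AE \<omega> in M n. integrable (lebesgue_on (cbox 0 T)) (\<lambda>u. g u * \<theta> n \<omega> u)"
    and m: "2 * q < m"
    and C: "0 < C"
    and moment: "\<And>(g :: nat \<Rightarrow> real ^ 'n \<Rightarrow> real) n. (\<And>k. g k \<in> Lspace (2 * q) (cbox 0 T)) \<Longrightarrow>
      (\<integral>\<^sup>+ \<omega>. ennreal (\<bar>LINT u|lebesgue_on (cbox 0 T). g n u * \<theta> n \<omega> u\<bar> powr m) \<partial>M n)
        \<le> ennreal (C * (LINT u|lebesgue_on (cbox 0 T). \<bar>g n u\<bar> powr (2 * q)) powr (m / (2 * q)))"
    and f: "\<And>n. f n \<in> Lspace (2 * q) (cbox 0 T)"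
    and f_lim: "f_lim \<in> Lspace (2 * q) (cbox 0 T)"
    and f_conv: "(\<lambda>n. Lnorm (2 * q) (cbox 0 T) (\<lambda>u. f n u - f_lim u)) \<longlonglongrightarrow> 0"
    and X: "continuous_version N (cbox 0 T) (wiener_integral W f_lim) X"
  shows "converges_in_law (mtopology_of (Cspace (cbox 0 T)))
           M (\<lambda>n. integral_process T (\<theta> n) (f n)) N X"
proof -
  \<comment> \<open>Constant sequences turn the assumption on sequences into a bound for each single
    function and each \<open>n\<close>.\<close>
  have mom: "(\<integral>\<^sup>+ \<omega>. ennreal (\<bar>LINT u|lebesgue_on (cbox 0 T). g u * \<theta> n \<omega> u\<bar> powr m) \<partial>M n)
      \<le> ennreal (C * energy (2 * q) (cbox 0 T) g powr (m / (2 * q)))"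
    if "g \<in> Lspace (2 * q) (cbox 0 T)" for g n
    unfolding energy_def using that by (rule moment[where g="\<lambda>_. g"])
  interpret moment_setting T M \<theta> N W "2 * q" m C
  proof (rule moment_setting.intro)
    show "2 \<le> 2 * q" using q by simp
    show "AE \<omega> in M n. integrable (lebesgue_on (cbox 0 T)) (\<lambda>u. g u * \<theta> n \<omega> u)"
      if "g \<in> Lspace (2 * q) (cbox 0 T)" for g n by (rule integ[OF that])
  qed (rule T_pos prob meas W fdd m C mom, assumption?)+
  \<comment> \<open>Convergence of the norms is raised to the power \<open>2 * q\<close> to obtain
    convergence of the energies.\<close>
  have "(\<lambda>n. Lnorm (2 * q) (cbox 0 T) (\<lambda>u. f n u - f_lim u) powr (2 * q)) \<longlonglongrightarrow> 0 powr (2 * q)"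
    using f_conv q by (intro tendsto_powr2) (auto simp: Lnorm_def)
  then have "(\<lambda>n. energy (2 * q) (cbox 0 T) (\<lambda>u. f n u - f_lim u)) \<longlonglongrightarrow> 0"
    using q by (simp add: energy_eq_Lnorm_powr)
  then show ?thesis by (rule integral_process_converges[OF f f_lim _ X])
qed

end
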